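(* Let $n\ge 2$ be an integer, let $p=p(n)$ be the smallest prime divisor of $n$, and let $f(x)=a_dx^d+\cdots+a_0\in\mathbb{Z}[x]$ be a polynomial of positive degree $d$ with $\gcd(a_d,\dots,a_1,n)=1$. Put $C_d=e^{1.85d}$ and $\delta(n)=\sum_{i\mid n,\ \mu(i)=-1}\frac 1i$. Let $D\subseteq \mathbb{Z}/n\mathbb{Z}$ be a subset with $|D|=n-c\geq C_d\,n\,p^{-\frac1d}+c$, let $b\in\mathbb{Z}/n\mathbb{Z}$, let $k$ be an integer with $0\le k\le |D|$, and let $N_f(D,k,b)$ be the number of $k$-element subsets $S\subseteq D$ such that $\sum_{x\in S}f(x)=b$ in $\mathbb{Z}/n\mathbb{Z}$. Then $$\left| N_f(D, k, b)-\frac{1}{n}\binom{n-c}{k}\right|\leq \binom{\delta(n)(n-c)+(1-\delta(n))\left(C_d\,n\,p^{-\frac 1d}+c\right)+k-1}{k}.$$ Furthermore, if $n$ is a power of a prime, then $\delta(n)=1/p$ and the same statement holds with the constant $C_d=e^{1.85d}$ replaced throughout (in both the hypothesis on $|D|$ and the conclusion) by the absolute constant $4.41$.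
   Context: For a real number $x$ and an integer $k\ge 0$, $\binom{x}{k}=\frac{(x)_k}{k!}$ with $(x)_0=1$ and $(x)_k=x(x-1)\cdots(x-k+1)$ for $k\geq 1$. $\mu$ is the Möbius function, and the sum defining $\delta(n)$ runs over the positive divisors $i$ of $n$ with $\mu(i)=-1$. The polynomial $f$ is evaluated on $\mathbb{Z}/n\mathbb{Z}$ by reducing its coefficients modulo $n$. *)

theory Defs
  imports
    Complex_Main
    "HOL-Computational_Algebra.Computational_Algebra"
    "HOL-Number_Theory.Cong"
    "HOL-Number_Theory.Prime_Powers"
begin

definition moebius :: "nat \<Rightarrow> int" where
  "moebius n = (if squarefree n then (-1) ^ card (prime_factors n) else 0)"

definition smallest_prime_divisor :: "nat \<Rightarrow> nat" where
  "smallest_prime_divisor n = (LEAST p. prime p \<and> p dvd n)"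

definition delta :: "nat \<Rightarrow> real" where
  "delta n = (\<Sum>i | i dvd n \<and> moebius i = -1. 1 / real i)"

(* Elements of Z/nZ are represented by their residues in {0..<int n}. Evaluating f over the
   integers and comparing modulo n gives the same result as first reducing its coefficients
   modulo n. *)
definition subset_sum_count :: "nat \<Rightarrow> int poly \<Rightarrow> int set \<Rightarrow> nat \<Rightarrow> int \<Rightarrow> nat" where
  "subset_sum_count n f D k b =
     card {S. S \<subseteq> D \<and> card S = k \<and> [(\<Sum>x\<in>S. poly f x) = b] (mod int n)}"

end

theory Submission
  imports Defs
begin

text \<open>
  Detecting the condition $\sum_{x \in S} f(x) = b$ by additive characters of $\mathbb{Z}/n\mathbb{Z}$
  turns the count into an average of elementary symmetric functions in the values
  $e(a f(x)/n)$, $x \in D$. For $a = 0$ this is $\binom{|D|}{k}$. For $a \ne 0$ the $i$-th power sum of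
  these values is trivial only when $i$ is a multiple of the order of the character, and Newton's
  identities majorise the elementary symmetric function by a binomial coefficient, as soon as the
  other power sums are bounded.

  For this one needs $|\sum_x e(a f(x)/h)| \le h q^{-1/d}$ for one prime $q \mid h$. A branching at
  the roots of $f'$ modulo $q$ reduces the modulus to $q$ itself; the losses are absorbed because a
  nonvacuous hypothesis forces $q \ge 4.41^d$. For a prime modulus the estimate is Weil's bound
  $(d-1)\sqrt q$, obtained from Stepanov's auxiliary polynomial and the rationality of the
  $L$-function. Both are carried out in $\mathbb{F}_q[X]$ alone: elements of extension fields are
  replaced by irreducible polynomials.
\<close>

section \<open>Congruences modulo ideals\<close>

text \<open>Stepanov's method yields only an upper bound, with a factor depending on p and d, and
  only over fields with p^(2 mu) elements. Summed over all trace values the bound becomes two-sided,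
  and the finitely many inverse roots of the L-function absorb the factor: complex numbers whose
  power sums stay bounded have modulus at most 1. The trace of f at an element of an extension field
  is a linear combination of power sums of its conjugates. Newton's identities give it a meaning for
  every monic polynomial, and there it turns products into sums, so the character is multiplicative
  without any field. The number 4.41 = 2.1^2 enters twice: for q >= 4.41^d it makes (d - 1) sqrt q
  at most q^(1 - 1/d), and 4.41 >= e pays for adding up the branches at the roots of f'. As e^(1.85
  d) >= 4.41, one estimate for constants C >= 4.41 covers both cases. The term delta(n) stems from
  characters of order h > 1: the multiples of h carry at most the share 1/h of the majorant, and 1/h
  <= 1/q for a prime q dividing h, where 1/q is a term of delta(n).\<close>

locale ideal_pred =
  fixes I :: "'a::comm_ring_1 \<Rightarrow> bool"
  assumes zero: "I 0"
    and add: "I a \<Longrightarrow> I b \<Longrightarrow> I (a + b)"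
    and mult: "I a \<Longrightarrow> I (a * b)"
begin

lemma mult_left: "I b \<Longrightarrow> I (a * b)"
  using mult[of b a] by (simp add: mult.commute)

lemma uminus: "I a \<Longrightarrow> I (- a)"
  using mult[of a "-1"] by simp

lemma diff: "I a \<Longrightarrow> I b \<Longrightarrow> I (a - b)"
  using add[of a "- b"] uminus[of b] by simp

lemma sum: "(\<And>x. x \<in> A \<Longrightarrow> I (f x)) \<Longrightarrow> I (\<Sum>x\<in>A. f x)"
  by (induction A rule: infinite_finite_induct) (auto intro: zero add)

lemma cong_sym: "I (a - b) \<Longrightarrow> I (b - a)"
  using uminus[of "a - b"] by simp

lemma cong_trans: "I (a - b) \<Longrightarrow> I (b - c) \<Longrightarrow> I (a - c)"
  using add[of "a - b" "b - c"] by simp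

lemma cong_add: "I (a - b) \<Longrightarrow> I (c - d) \<Longrightarrow> I ((a + c) - (b + d))"
  using add[of "a - b" "c - d"] by (simp add: algebra_simps)

lemma cong_diff: "I (a - b) \<Longrightarrow> I (c - d) \<Longrightarrow> I ((a - c) - (b - d))"
  using diff[of "a - b" "c - d"] by (simp add: algebra_simps)

lemma cong_mult:
  assumes "I (a - b)" "I (c - d)"
  shows "I (a * c - b * d)"
proof -
  have "I ((a - b) * c + b * (c - d))"
    using assms by (intro add mult mult_left)
  then show ?thesis
    by (simp add: algebra_simps)
qed

lemma cong_power: "I (a - b) \<Longrightarrow> I (a ^ n - b ^ n)"
  by (induction n) (simp_all add: zero cong_mult)

lemma cong_sum: "(\<And>x. x \<in> A \<Longrightarrow> I (f x - g x)) \<Longrightarrow> I ((\<Sum>x\<in>A. f x) - (\<Sum>x\<in>A. g x))"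
  by (simp add: sum flip: sum_subtractf)

lemma cong_prod: "(\<And>x. x \<in> A \<Longrightarrow> I (f x - g x)) \<Longrightarrow> I ((\<Prod>x\<in>A. f x) - (\<Prod>x\<in>A. g x))"
  by (induction A rule: infinite_finite_induct) (auto intro: zero cong_mult)

lemma cong_iff: "I (a - b) \<Longrightarrow> I a \<longleftrightarrow> I b"
  using add[of "a - b" b] diff[of a "a - b"] by auto

lemma coeff_mult_in:
  assumes "\<And>i. I (coeff G i)"
  shows "I (coeff (F * G) i)"
  by (simp add: coeff_mult assms mult_left sum)

end

locale prime_ideal_pred = ideal_pred +
  assumes one: "\<not> I 1"
    and prime: "I (a * b) \<Longrightarrow> I a \<or> I b"
begin

lemma prime_power: "I (a ^ n) \<Longrightarrow> I a"
  by (induction n) (use one prime in auto)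

lemma prime_prod: "finite A \<Longrightarrow> I (\<Prod>x\<in>A. f x) \<Longrightarrow> \<exists>x\<in>A. I (f x)"
  by (induction A rule: finite_induct) (use one prime in auto)

text \<open>Synthetic division by \<open>X - a\<close> leaves a quotient that is again nonzero
  modulo the ideal, since otherwise every coefficient of \<open>F\<close> would lie in it; primality
  passes the remaining roots on to the quotient. \<open>A\<close> consists of pairwise incongruent
  representatives, and \<open>degree F\<close> is the degree before reduction, which can only be
  larger.\<close>

lemma card_roots_le:
  fixes F :: "'a poly"
  assumes "\<not> I (coeff F k)" and "finite A" and "\<And>a. a \<in> A \<Longrightarrow> I (poly F a)"
    and "\<And>a b. a \<in> A \<Longrightarrow> b \<in> A \<Longrightarrow> I (a - b) \<Longrightarrow> a = b"
  shows "card A \<le> degree F"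
  using assms
proof (induction "degree F" arbitrary: F k A)
  case 0
  then obtain c where F: "F = [:c:]"
    by (metis degree_eq_zeroE)
  have "\<not> I c"
    using 0 zero by (auto simp: F coeff_pCons split: nat.splits)
  then have "A = {}"
    using 0 by (auto simp: F)
  then show ?case by simp
next
  case (Suc n)
  show ?case
  proof (cases "A = {}")
    case False
    then obtain a where a: "a \<in> A" by auto
    define G where "G = synthetic_div F a"
    have F: "F = [:-a, 1:] * G + [:poly F a:]"
      unfolding G_def by (rule synthetic_div_correct'[symmetric])
    have "\<exists>i. \<not> I (coeff G i)"
    proof (rule ccontr)
      assume "\<not> ?thesis"
      then have "I (coeff ([:-a, 1:] * G) k)"
        by (intro coeff_mult_in) auto
      moreover have "I (coeff [:poly F a:] k)"
        using Suc.prems(3)[OF a] zero by (auto simp: coeff_pCons split: nat.splits)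
      ultimately have "I (coeff F k)"
        by (subst F, subst coeff_add) (rule add)
      then show False using Suc.prems by simp
    qed
    then obtain i where i: "\<not> I (coeff G i)" by auto
    have deg: "degree G = n"
      using Suc.hyps(2) by (simp add: G_def degree_synthetic_div)
    have root: "I (poly G b)" if "b \<in> A - {a}" for b
    proof -
      have "poly F b = (b - a) * poly G b + poly F a"
        by (subst F) (simp add: algebra_simps)
      then have "(b - a) * poly G b = poly F b - poly F a" by simp
      moreover have "I (poly F b - poly F a)"
        using Suc.prems(3) a that by (intro diff) auto
      ultimately have "I ((b - a) * poly G b)"
        by (simp only:)
      then show ?thesis
        using prime Suc.prems(4)[of b a] a that by blast
    qed
    have "card (A - {a}) \<le> degree G"
    proof (rule Suc.hyps(1)[OF deg[symmetric] i])
      show "finite (A - {a})" using Suc.prems by simp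
    next
      fix b assume "b \<in> A - {a}"
      then show "I (poly G b)" by (rule root)
    next
      fix b c assume "b \<in> A - {a}" "c \<in> A - {a}" "I (b - c)"
      then show "b = c" using Suc.prems(4) by auto
    qed
    then show ?thesis
      using a Suc.prems(2) Suc.hyps(2) deg by (simp add: card_Diff_singleton)
  qed simp
qed

end

section \<open>Frobenius modulo an ideal that contains a prime number\<close>

lemma (in ideal_pred) frobenius_add:
  assumes "prime p" and "I (of_nat p)"
  shows "I ((a + b) ^ p - (a ^ p + b ^ p))"
proof -
  have p: "p > 0" "p \<noteq> 0" using assms prime_gt_0_nat by auto
  have "(a + b) ^ p = (\<Sum>k\<le>p. of_nat (p choose k) * a ^ k * b ^ (p - k))"
    by (rule binomial_ring)
  also have "{..p} = insert 0 (insert p {0<..<p})" using p by auto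
  also have "(\<Sum>k\<in>\<dots>. of_nat (p choose k) * a ^ k * b ^ (p - k))
      = b ^ p + (a ^ p + (\<Sum>k\<in>{0<..<p}. of_nat (p choose k) * a ^ k * b ^ (p - k)))"
    using p by simp
  finally have eq: "(a + b) ^ p - (a ^ p + b ^ p)
      = (\<Sum>k\<in>{0<..<p}. of_nat (p choose k) * a ^ k * b ^ (p - k))"
    by simp
  have "I (of_nat (p choose k) * a ^ k * b ^ (p - k))" if k: "k \<in> {0<..<p}" for k
  proof -
    have "p dvd (p choose k)"
      using k assms(1) by (intro dvd_choose_prime) auto
    then obtain m where "p choose k = p * m" by auto
    then show ?thesis
      using assms(2) by (auto intro!: mult)
  qed
  then show ?thesis
    unfolding eq by (rule sum)
qed

lemma (in ideal_pred) frobenius_power_add: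
  assumes "prime p" and "I (of_nat p)"
  shows "I ((a + b) ^ (p ^ n) - (a ^ (p ^ n) + b ^ (p ^ n)))"
proof (induction n)
  case (Suc n)
  have "I (((a + b) ^ (p ^ n)) ^ p - (a ^ (p ^ n) + b ^ (p ^ n)) ^ p)"
    by (rule cong_power[OF Suc])
  from cong_trans[OF this frobenius_add[OF assms]] show ?case
    by (simp add: power_mult[symmetric] mult.commute)
qed (simp add: zero)

lemma (in ideal_pred) frobenius_sum:
  assumes "prime p" and "I (of_nat p)"
  shows "I ((\<Sum>x\<in>A. f x) ^ (p ^ n) - (\<Sum>x\<in>A. f x ^ (p ^ n)))"
proof (induction A rule: infinite_finite_induct)
  case (insert x A)
  have "I ((f x + (\<Sum>x\<in>A. f x)) ^ (p ^ n) - (f x ^ (p ^ n) + (\<Sum>x\<in>A. f x) ^ (p ^ n)))"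
    by (rule frobenius_power_add[OF assms])
  moreover have "I ((f x ^ (p ^ n) + (\<Sum>x\<in>A. f x) ^ (p ^ n))
      - (f x ^ (p ^ n) + (\<Sum>x\<in>A. f x ^ (p ^ n))))"
    using insert by simp
  ultimately show ?case
    using cong_trans insert.hyps by (auto simp del: add_diff_cancel_left)
qed (use prime_gt_0_nat[OF assms(1)] in \<open>simp_all add: zero power_0_left\<close>)

lemma (in ideal_pred) fermat_of_int:
  assumes "prime p" and "I (of_nat p)"
  shows "I (of_int c ^ (p ^ n) - of_int c)"
proof -
  have nat: "I (of_nat m ^ (p ^ n) - of_nat m)" for m :: nat
  proof (induction m)
    case (Suc m)
    have "I ((1 + of_nat m) ^ (p ^ n) - (1 ^ (p ^ n) + of_nat m ^ (p ^ n)))"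
      by (rule frobenius_power_add[OF assms])
    moreover have "I ((1 ^ (p ^ n) + of_nat m ^ (p ^ n)) - (1 + of_nat m))"
      using Suc by simp
    ultimately show ?case
      using cong_trans by (metis of_nat_Suc)
  qed (use prime_gt_0_nat[OF assms(1)] in \<open>simp add: zero power_0_left\<close>)
  define m where "m = nat (c mod int p)"
  have p: "int p > 0" using prime_gt_0_nat[OF assms(1)] by simp
  have "c = int m + int p * (c div int p)"
    using p by (simp add: m_def)
  then have "(of_int c :: 'a) = of_nat m + of_nat p * of_int (c div int p)"
    by (metis of_int_add of_int_mult of_int_of_nat_eq)
  then have c: "I (of_int c - of_nat m)"
    using assms(2) mult by simp
  show ?thesis
    by (rule cong_trans[OF cong_trans[OF cong_power[OF c] nat] cong_sym[OF c]])
qed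

section \<open>Polynomials over the field with p elements\<close>

locale prime_modulus =
  fixes p :: nat
  assumes prime_p: "prime p"
begin

lemma p_gt_1: "int p > 1" "p > 1" "p > 0"
  using prime_gt_1_nat[OF prime_p] by auto

text \<open>
  Elements of $\mathbb{F}_p[X]$ are integer polynomials taken up to \<open>dvdm 0\<close>, divisibility of all
  coefficients by $p$; \<open>dvdm g\<close> is membership in the ideal generated by $p$ and $g$.
\<close>
definition dvdm :: "int poly \<Rightarrow> int poly \<Rightarrow> bool"
  where "dvdm g a \<longleftrightarrow> (\<exists>h. [:int p:] dvd a - g * h)"

lemma dvdm_zero_iff: "dvdm 0 a \<longleftrightarrow> (\<forall>i. int p dvd coeff a i)"
  by (simp add: dvdm_def const_poly_dvd_iff)

lemma ideal_dvdm: "ideal_pred (dvdm g)"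
proof
  show "dvdm g 0" by (auto simp: dvdm_def intro: exI[of _ 0])
  show "dvdm g (a + b)" if "dvdm g a" "dvdm g b" for a b
  proof -
    from that obtain h k where "[:int p:] dvd a - g * h" "[:int p:] dvd b - g * k"
      by (auto simp: dvdm_def)
    then have "[:int p:] dvd (a - g * h) + (b - g * k)" by (rule dvd_add)
    then show ?thesis
      unfolding dvdm_def by (intro exI[of _ "h + k"]) (simp add: algebra_simps)
  qed
  show "dvdm g (a * b)" if "dvdm g a" for a b
  proof -
    from that obtain h where "[:int p:] dvd a - g * h"
      by (auto simp: dvdm_def)
    then have "[:int p:] dvd (a - g * h) * b" by (rule dvd_mult2)
    then show ?thesis
      unfolding dvdm_def by (intro exI[of _ "h * b"]) (simp add: algebra_simps)
  qed
qed

sublocale m: ideal_pred "dvdm g" for g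
  by (rule ideal_dvdm)

text \<open>Gauss's lemma: a prime of the integers remains prime as a constant polynomial.\<close>

lemma prime_zero: "prime_ideal_pred (dvdm 0)"
proof
  show "\<not> dvdm 0 1"
    using p_gt_1 by (auto simp: dvdm_zero_iff intro!: exI[of _ 0])
  have "prime_elem [:int p:]"
    using prime_p by (intro lift_prime_elem_poly) auto
  then show "dvdm 0 a \<or> dvdm 0 b" if "dvdm 0 (a * b)" for a b
    using that by (auto simp: dvdm_def prime_elem_dvd_mult_iff)
qed

sublocale z: prime_ideal_pred "dvdm 0"
  by (rule prime_zero)

lemma dvdm_self: "dvdm g (g * h)"
  by (auto simp: dvdm_def intro: exI[of _ h])

lemma dvdm_zeroD: "dvdm 0 a \<Longrightarrow> dvdm g a"
  by (auto simp: dvdm_def intro: exI[of _ 0])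

lemma dvdm_iff: "dvdm g a \<longleftrightarrow> (\<exists>h. dvdm 0 (a - g * h))"
  by (auto simp: dvdm_def)

lemma dvdm_trans:
  assumes "dvdm g h" "dvdm h a"
  shows "dvdm g a"
proof -
  obtain k where k: "dvdm 0 (a - h * k)" using assms(2) by (auto simp: dvdm_iff[of h])
  have "dvdm g (h * k)" using assms(1) by (rule m.mult)
  with dvdm_zeroD[OF k] show ?thesis using m.add by fastforce
qed

lemma dvdm_cong: "dvdm 0 (g - g') \<Longrightarrow> dvdm g a \<longleftrightarrow> dvdm g' a"
proof -
  have "dvdm g' a" if "dvdm 0 (g - g')" "dvdm g a" for g g'
  proof (rule dvdm_trans[OF _ that(2)])
    show "dvdm g' g"
      using m.add[OF dvdm_zeroD[OF that(1)], of g' g'] dvdm_self[of g' 1] by simp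
  qed
  moreover assume "dvdm 0 (g - g')"
  ultimately show ?thesis using m.cong_sym by blast
qed

lemma dvdm_p: "dvdm g (of_nat p)"
  by (rule dvdm_zeroD) (auto simp: dvdm_zero_iff of_nat_poly coeff_pCons split: nat.splits)

lemma dvdm_of_int: "int p dvd c \<Longrightarrow> dvdm g (of_int c)"
  by (rule dvdm_zeroD) (auto simp: dvdm_zero_iff of_int_poly coeff_pCons split: nat.splits)

section \<open>Canonical representatives modulo p\<close>

definition red :: "int poly \<Rightarrow> int poly"
  where "red = map_poly (\<lambda>c. c mod int p)"

lemma coeff_red: "coeff (red a) i = coeff a i mod int p"
  by (simp add: red_def coeff_map_poly)

lemma red_cong: "dvdm 0 (red a - a)" "dvdm 0 (a - red a)"
  by (auto simp: dvdm_zero_iff coeff_red mod_eq_dvd_iff[symmetric])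

lemma degree_red_le: "degree (red a) \<le> degree a"
  unfolding red_def by (rule map_poly_degree_leq)

definition Red :: "int poly set"
  where "Red = {a. \<forall>i. coeff a i \<in> {0..<int p}}"

text \<open>The remainders on division by a monic polynomial of degree \<open>r\<close>. The
  condition speaks of coefficients rather than of \<open>degree a < r\<close>, so that
  \<open>Low 0\<close> is {0}.\<close>

definition Low :: "nat \<Rightarrow> int poly set"
  where "Low r = {a \<in> Red. \<forall>i\<ge>r. coeff a i = 0}"

definition Mon :: "nat \<Rightarrow> int poly set"
  where "Mon r = {a \<in> Red. degree a = r \<and> coeff a r = 1}"

lemma red_in_Red: "red a \<in> Red"
  using p_gt_1 by (auto simp: Red_def coeff_red)

lemma Red_eqI:
  assumes "a \<in> Red" "b \<in> Red" "dvdm 0 (a - b)"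
  shows "a = b"
proof (rule poly_eqI)
  fix i
  have "coeff a i mod int p = coeff b i mod int p"
    using assms(3) by (simp add: dvdm_zero_iff mod_eq_dvd_iff)
  then show "coeff a i = coeff b i"
    using assms(1,2) by (simp add: Red_def)
qed

lemma red_eq: "a \<in> Red \<Longrightarrow> red a = a"
  by (rule Red_eqI[OF red_in_Red]) (auto intro: red_cong)

lemma red_eq_iff: "red a = red b \<longleftrightarrow> dvdm 0 (a - b)"
  by (auto simp: poly_eq_iff coeff_red dvdm_zero_iff mod_eq_dvd_iff)

lemma red_in_Low: "(\<And>i. i \<ge> r \<Longrightarrow> int p dvd coeff a i) \<Longrightarrow> red a \<in> Low r"
  using red_in_Red[of a] by (auto simp: Low_def coeff_red)

lemma Mon_subset: "a \<in> Mon r \<Longrightarrow> a \<in> Red"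
  by (simp add: Mon_def)

lemma MonD: "a \<in> Mon r \<Longrightarrow> degree a = r" "a \<in> Mon r \<Longrightarrow> lead_coeff a = 1"
  "a \<in> Mon r \<Longrightarrow> a \<noteq> 0"
  by (auto simp: Mon_def)

lemma Low_0: "Low 0 = {0}"
  using p_gt_1 by (auto simp: Low_def Red_def poly_eq_iff)

lemma Low_Suc: "Low (Suc r) = (\<lambda>(c, a). pCons c a) ` ({0..<int p} \<times> Low r)"
proof (intro equalityI subsetI)
  fix a assume a: "a \<in> Low (Suc r)"
  obtain c b where ab: "a = pCons c b" by (cases a)
  have "coeff a (Suc i) = coeff b i" "coeff a 0 = c" for i by (simp_all add: ab)
  moreover have "coeff a i \<in> {0..<int p}" "i \<ge> Suc r \<Longrightarrow> coeff a i = 0" for i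
    using a by (auto simp: Low_def Red_def)
  ultimately have "c \<in> {0..<int p}" "b \<in> Low r"
    unfolding Low_def Red_def mem_Collect_eq by (metis, metis Suc_le_mono)
  then show "a \<in> (\<lambda>(c, a). pCons c a) ` ({0..<int p} \<times> Low r)"
    using ab by auto
qed (auto simp: Low_def Red_def coeff_pCons split: nat.splits)

lemma card_Low: "finite (Low r) \<and> card (Low r) = p ^ r"
proof (induction r)
  case (Suc r)
  have "inj_on (\<lambda>(c, a). pCons c a) ({0..<int p} \<times> Low r)"
    by (auto simp: inj_on_def)
  then show ?case
    using Suc by (simp add: Low_Suc card_image card_cartesian_product)
qed (simp add: Low_0)

lemma Mon_eq_image: "Mon r = (\<lambda>a. monom 1 r + a) ` Low r"
proof (intro equalityI subsetI)
  fix a assume a: "a \<in> Mon r"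
  then have "a - monom 1 r \<in> Low r"
    using coeff_eq_0[of a] p_gt_1
    by (auto simp: Mon_def Low_def Red_def le_less)
  then show "a \<in> (\<lambda>a. monom 1 r + a) ` Low r"
    by (intro image_eqI[of _ _ "a - monom 1 r"]) auto
next
  fix a assume "a \<in> (\<lambda>a. monom 1 r + a) ` Low r"
  then obtain b where b: "b \<in> Low r" "a = monom 1 r + b" by auto
  have c: "coeff a r = 1" using b by (simp add: Low_def)
  have "degree a \<le> r"
    using b by (intro degree_le) (auto simp: Low_def)
  then have "degree a = r" using c le_degree[of a r] by simp
  moreover have "a \<in> Red"
    using b p_gt_1 by (auto simp: Red_def Low_def)
  ultimately show "a \<in> Mon r" using c by (simp add: Mon_def)
qed

lemma finite_Mon: "finite (Mon r)" and card_Mon: "card (Mon r) = p ^ r"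
  using card_Low[of r] by (auto simp: Mon_eq_image card_image)

lemma Mon_0: "Mon 0 = {1}"
  by (simp add: Mon_eq_image Low_0)

lemma red_in_Mon:
  assumes "int p dvd coeff a r - 1" and "\<And>i. i > r \<Longrightarrow> int p dvd coeff a i"
  shows "red a \<in> Mon r"
proof -
  have 1: "coeff (red a) r = 1"
    using assms(1) p_gt_1 mod_eq_dvd_iff[of "coeff a r" "int p" 1]
    by (simp add: coeff_red)
  have "degree (red a) \<le> r"
    using assms(2) by (intro degree_le) (auto simp: coeff_red)
  moreover have "degree (red a) \<ge> r"
    using 1 by (intro le_degree) simp
  ultimately show ?thesis
    using 1 red_in_Red by (simp add: Mon_def)
qed

lemma coeff_monic_mult:
  fixes g h :: "int poly"
  assumes "lead_coeff g = 1"
  shows "coeff (g * h) (degree g + degree h) = lead_coeff h"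
  using assms by (simp add: coeff_mult_degree_sum)

text \<open>The product of the monic \<open>g\<close> with a nonzero reduced \<open>red h\<close>
  has, at index \<open>degree g + degree (red h)\<close>, the leading coefficient of
  \<open>red h\<close>, which lies strictly between 0 and p. Hence only the zero multiple can vanish
  modulo p from index \<open>degree g\<close> on.\<close>

lemma monic_dvdm_low:
  assumes g: "lead_coeff g = 1" and dvd: "dvdm g b"
    and low: "\<And>i. i \<ge> degree g \<Longrightarrow> int p dvd coeff b i"
  shows "dvdm 0 b"
proof -
  obtain h where h: "dvdm 0 (b - g * h)" using dvd by (auto simp: dvdm_iff[of g])
  have "dvdm 0 (g * h - g * red h)"
    by (intro m.cong_mult) (auto intro: red_cong m.zero)
  with h have h': "dvdm 0 (b - g * red h)" by (rule m.cong_trans)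
  have "red h = 0"
  proof (rule ccontr)
    assume nz: "red h \<noteq> 0"
    let ?i = "degree g + degree (red h)"
    have "int p dvd coeff b ?i - coeff (g * red h) ?i"
      using h' by (simp add: dvdm_zero_iff)
    then have "int p dvd lead_coeff (red h)"
      using low[of ?i] coeff_monic_mult[OF g, of "red h"] by (simp add: dvd_diff_right_iff)
    then have "lead_coeff (red h) = 0"
      using red_in_Red[of h] zdvd_not_zless[of "lead_coeff (red h)" "int p"]
      unfolding Red_def by (metis (mono_tags, lifting) atLeastLessThan_iff mem_Collect_eq order_le_less)
    with nz show False by simp
  qed
  with h' show ?thesis by simp
qed

lemma monic_division:
  assumes g: "lead_coeff g = 1"
  obtains b where "b \<in> Low (degree g)" "dvdm g (a - b)"
proof -
  \<comment> \<open>Since \<open>g\<close> has leading coefficient 1, the pseudo-division is a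
    genuine division over the integers.\<close>
  obtain q r where qr: "pseudo_divmod a g = (q, r)" by force
  have g0: "g \<noteq> 0" using g by auto
  have a: "a = g * q + r" and r: "r = 0 \<or> degree r < degree g"
    using pseudo_divmod[OF g0 qr] g by auto
  have "red r \<in> Low (degree g)"
    using r by (intro red_in_Low) (auto simp: coeff_eq_0)
  moreover have "dvdm g (a - red r)"
    using m.add[OF dvdm_self dvdm_zeroD[OF red_cong(2)], of g q r] by (simp add: a algebra_simps)
  ultimately show ?thesis by (rule that)
qed

lemma Low_eqI:
  assumes "lead_coeff g = 1" "a \<in> Low (degree g)" "b \<in> Low (degree g)" "dvdm g (a - b)"
  shows "a = b"
proof (rule Red_eqI)
  show "dvdm 0 (a - b)"
    using assms by (intro monic_dvdm_low[OF assms(1,4)]) (simp add: Low_def)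
qed (use assms in \<open>simp_all add: Low_def\<close>)

lemma inverse_mod_p:
  assumes "\<not> int p dvd c"
  obtains w where "int p dvd w * c - 1" "\<not> int p dvd w"
proof -
  have "coprime c (int p)"
    using assms prime_p by (metis coprime_commute prime_imp_coprime prime_nat_int_transfer)
  then obtain w where "[c * w = 1] (mod int p)"
    using cong_solve_coprime_int by blast
  then have w: "int p dvd w * c - 1"
    by (simp add: cong_iff_dvd_diff mult.commute)
  moreover have "\<not> int p dvd w"
  proof
    assume "int p dvd w"
    then have "int p dvd w * c - (w * c - 1)" using w by (metis dvd_diff dvd_mult2)
    moreover have "w * c - (w * c - 1) = 1" by simp
    ultimately have "int p dvd 1" by (simp only:)
    then show False using p_gt_1 by simp
  qed
  ultimately show ?thesis by (rule that)
qed

text \<open>The degree \<open>k\<close> can lie below \<open>degree a\<close>, because top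
  coefficients of \<open>a\<close> may vanish modulo p; the degree bounds below work with
  \<open>k \<le> degree a\<close>.\<close>

lemma monicize:
  assumes "\<not> dvdm 0 a"
  obtains w k where "k \<le> degree a" "red (smult w a) \<in> Mon k" "\<not> int p dvd w"
proof -
  have nz: "red a \<noteq> 0"
    using assms red_cong(2)[of a] by auto
  define k where "k = degree (red a)"
  have "coeff (red a) k \<noteq> 0" using nz by (simp add: k_def)
  then have "\<not> int p dvd coeff a k" by (auto simp: coeff_red)
  then obtain w where w: "int p dvd w * coeff a k - 1" "\<not> int p dvd w"
    by (rule inverse_mod_p)
  have "int p dvd coeff a i" if "i > k" for i
    using that coeff_eq_0[of "red a" i] by (auto simp: k_def coeff_red)
  then have "red (smult w a) \<in> Mon k"
    using w by (intro red_in_Mon) auto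
  then show ?thesis
    using that w degree_red_le[of a] k_def by blast
qed

lemma dvdm_smult_iff:
  assumes "\<not> int p dvd w"
  shows "dvdm g (smult w a) \<longleftrightarrow> dvdm g a"
proof
  assume "dvdm g a"
  then show "dvdm g (smult w a)" using m.mult[of g a "[:w:]"] by simp
next
  assume d: "dvdm g (smult w a)"
  obtain v where v: "int p dvd v * w - 1" using inverse_mod_p[OF assms] by blast
  have "dvdm g (smult v (smult w a))" using m.mult[OF d, of "[:v:]"] by simp
  moreover have "dvdm g (smult v (smult w a) - a)"
    using m.mult[OF dvdm_of_int[OF v], of g a]
    by (simp add: of_int_poly smult_diff_left)
  ultimately show "dvdm g a" using m.cong_iff by blast
qed

lemma monic_quotient:
  assumes g: "g \<in> Mon k" and a: "a \<in> Mon l" and dvd: "dvdm g a"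
  obtains h where "h \<in> Mon (l - k)" "k \<le> l" "dvdm 0 (a - g * h)"
proof -
  obtain h0 where h0: "dvdm 0 (a - g * h0)" using dvd by (auto simp: dvdm_iff[of g])
  define h where "h = red h0"
  have "dvdm 0 (g * h0 - g * h)"
    unfolding h_def by (intro m.cong_mult) (auto intro: red_cong m.zero)
  with h0 have h: "dvdm 0 (a - g * h)" by (rule m.cong_trans)
  have hR: "h \<in> Red" by (simp add: h_def red_in_Red)
  have "\<not> dvdm 0 a"
    using a p_gt_1 by (auto simp: dvdm_zero_iff Mon_def intro!: exI[of _ l])
  then have hnz: "h \<noteq> 0" using h by auto
  let ?j = "degree h"
  have lead: "coeff (g * h) (k + ?j) = lead_coeff h"
    using coeff_monic_mult[of g h] g by (simp add: Mon_def)
  have cong: "int p dvd coeff a i - coeff (g * h) i" for i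
    using h by (simp add: dvdm_zero_iff)
  have lc: "lead_coeff h \<in> {0<..<int p}"
    using hR hnz by (auto simp: Red_def less_le)
  have 1: "k + ?j \<le> l"
  proof (rule ccontr)
    assume "\<not> k + ?j \<le> l"
    then have "coeff a (k + ?j) = 0" using a by (intro coeff_eq_0) (simp add: Mon_def)
    then have "int p dvd lead_coeff h" using cong[of "k + ?j"] lead by simp
    then show False using lc zdvd_not_zless by auto
  qed
  have 2: "l \<le> k + ?j"
  proof (rule ccontr)
    assume "\<not> l \<le> k + ?j"
    then have "degree (g * h) < l"
      using degree_mult_le[of g h] g by (simp add: Mon_def)
    then have "coeff (g * h) l = 0" by (rule coeff_eq_0)
    then show False using cong[of l] a p_gt_1 by (simp add: Mon_def)
  qed
  have "int p dvd 1 - lead_coeff h"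
    using cong[of l] lead 1 2 a by (simp add: Mon_def)
  then have "1 mod int p = lead_coeff h mod int p" by (simp add: mod_eq_dvd_iff)
  then have "lead_coeff h = 1" using lc p_gt_1 by simp
  then have "h \<in> Mon (l - k)" using hR 1 2 by (auto simp: Mon_def)
  with 1 2 h show ?thesis using that by auto
qed

lemma red_mult_Mon:
  assumes "g \<in> Mon k" "h \<in> Mon l"
  shows "red (g * h) \<in> Mon (k + l)"
proof (rule red_in_Mon)
  show "int p dvd coeff (g * h) (k + l) - 1"
    using assms coeff_monic_mult[of g h] by (simp add: Mon_def)
  show "int p dvd coeff (g * h) i" if "i > k + l" for i
    using that degree_mult_le[of g h] assms by (simp add: Mon_def coeff_eq_0)
qed

end

section \<open>Irreducible polynomials and unique factorisation\<close>

context prime_modulus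
begin

lemma Mon_not_zero: "g \<in> Mon r \<Longrightarrow> \<not> dvdm 0 g"
  using p_gt_1 by (auto simp: dvdm_zero_iff Mon_def intro!: exI[of _ r])

lemma Mon_dvdm_same_degree:
  assumes "g \<in> Mon r" "h \<in> Mon r" "dvdm g h"
  shows "g = h"
proof -
  obtain u where "u \<in> Mon (r - r)" "dvdm 0 (h - g * u)"
    using monic_quotient[OF assms] by blast
  then have "dvdm 0 (h - g)" by (simp add: Mon_0)
  then show ?thesis
    using Red_eqI Mon_subset assms(1,2) by blast
qed

definition Irr :: "nat \<Rightarrow> int poly set"
  where "Irr r = {P \<in> Mon r. 0 < r \<and> (\<forall>k g. 0 < k \<longrightarrow> k < r \<longrightarrow> g \<in> Mon k \<longrightarrow> \<not> dvdm g P)}"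

lemma IrrD: "P \<in> Irr r \<Longrightarrow> P \<in> Mon r" "P \<in> Irr r \<Longrightarrow> r > 0" "P \<in> Irr r \<Longrightarrow> degree P = r"
  "P \<in> Irr r \<Longrightarrow> lead_coeff P = 1"
  by (auto simp: Irr_def Mon_def)

lemma finite_Irr: "finite (Irr r)"
  using finite_Mon[of r] by (rule finite_subset[rotated]) (auto simp: Irr_def)

lemma Irr_1: "Irr 1 = Mon 1"
  by (auto simp: Irr_def)

lemma Low_not_dvdm:
  assumes "lead_coeff g = 1" "b \<in> Low (degree g)" "b \<noteq> 0"
  shows "\<not> dvdm g b"
proof -
  have "0 \<in> Low (degree g)" using p_gt_1 by (simp add: Low_def Red_def)
  then show ?thesis using Low_eqI[of g b 0] assms by auto
qed

lemma dvdm_Irr_one: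
  assumes "P \<in> Irr r"
  shows "\<not> dvdm P 1"
proof (rule Low_not_dvdm)
  show "1 \<in> Low (degree P)"
    using p_gt_1 IrrD(2,3)[OF assms] by (auto simp: Low_def Red_def coeff_eq_0)
qed (use IrrD(4)[OF assms] in auto)

text \<open>The ideal \<open>J\<close> generated by p, \<open>P\<close> and \<open>a\<close> is
  generated by p and its monic element \<open>g\<close> of least degree. As \<open>g\<close> divides
  the irreducible \<open>P\<close>, it is 1 or \<open>P\<close>, and in the second case
  \<open>P\<close> would divide \<open>a\<close>.\<close>

lemma Irr_bezout:
  assumes P: "P \<in> Irr r" and a: "\<not> dvdm P a"
  obtains s where "dvdm P (1 - s * a)"
proof -
  define J where "J x \<longleftrightarrow> (\<exists>s. dvdm P (x - s * a))" for x
  interpret J: ideal_pred J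
  proof
    show "J 0" unfolding J_def by (rule exI[of _ 0]) (simp add: m.zero)
  next
    fix x y assume "J x" "J y"
    then obtain s t where "dvdm P (x - s * a)" "dvdm P (y - t * a)" by (auto simp: J_def)
    then have "dvdm P ((x - s * a) + (y - t * a))" by (rule m.add)
    then show "J (x + y)"
      unfolding J_def by (intro exI[of _ "s + t"]) (simp add: algebra_simps)
  next
    fix x y assume "J x"
    then obtain s where "dvdm P (x - s * a)" by (auto simp: J_def)
    then have "dvdm P ((x - s * a) * y)" by (rule m.mult)
    then show "J (x * y)"
      unfolding J_def by (intro exI[of _ "s * y"]) (simp add: algebra_simps)
  qed
  have J_P: "J x" if "dvdm P x" for x
    unfolding J_def using that by (intro exI[of _ 0]) simp
  have J_a: "J a"
    unfolding J_def by (intro exI[of _ 1]) (simp add: m.zero)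
  define k where "k = (LEAST k. \<exists>g\<in>Mon k. J g)"
  have ex: "\<exists>g\<in>Mon r. J g"
    using J_P[of P] dvdm_self[of P 1] IrrD(1)[OF P] by auto
  obtain g where g: "g \<in> Mon k" "J g"
    using LeastI[of "\<lambda>k. \<exists>g\<in>Mon k. J g", OF ex] unfolding k_def by blast
  have kr: "k \<le> r"
    unfolding k_def by (rule Least_le[of "\<lambda>k. \<exists>g\<in>Mon k. J g", OF ex])
  have min: "\<not> J h" if "h \<in> Mon l" "l < k" for h l
    using not_less_Least[of l "\<lambda>k. \<exists>g\<in>Mon k. J g"] that unfolding k_def by blast
  have dvd: "dvdm g x" if x: "J x" for x
  proof -
    obtain b where b: "b \<in> Low (degree g)" "dvdm g (x - b)"
      using monic_division[of g x] g by (auto simp: Mon_def)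
    obtain h where h: "dvdm 0 (x - b - g * h)" using b(2) by (auto simp: dvdm_iff[of g])
    have "J (g * h)" using g(2) by (rule J.mult)
    then have "J (x - b)" using J.cong_iff[OF J_P[OF dvdm_zeroD[OF h]]] by simp
    then have Jb: "J b" using J.diff[OF x] by fastforce
    show ?thesis
    proof (cases "dvdm 0 b")
      case True
      then show ?thesis using m.add[OF b(2) dvdm_zeroD[OF True]] by simp
    next
      case False
      then obtain w l where w: "l \<le> degree b" "red (smult w b) \<in> Mon l"
        by (rule monicize)
      have "b \<noteq> 0" using False by (auto simp: m.zero)
      then have nz: "coeff b (degree b) \<noteq> 0" by simp
      have "coeff b i = 0" if "i \<ge> k" for i
        using b(1) MonD(1)[OF g(1)] that by (simp add: Low_def)
      then have "degree b < k"
        using nz not_less by blast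
      moreover have "J (smult w b)" using J.mult[OF Jb, of "[:w:]"] by simp
      then have "J (red (smult w b))"
        using J.cong_iff[OF J_P[OF dvdm_zeroD[OF red_cong(1)]]] by blast
      ultimately show ?thesis using min[OF w(2)] w(1) by simp
    qed
  qed
  have "dvdm g P" using dvd[OF J_P] dvdm_self[of P 1] by simp
  have "k = 0"
  proof (rule ccontr)
    assume "k \<noteq> 0"
    then have "k = r"
      using P g(1) \<open>dvdm g P\<close> kr by (auto simp: Irr_def le_less)
    then have "g = P"
      using Mon_dvdm_same_degree[of g r P] g(1) P \<open>dvdm g P\<close> by (simp add: IrrD)
    then show False using dvd[OF J_a] a by simp
  qed
  then have "J 1" using g by (simp add: Mon_0)
  then show ?thesis using that by (auto simp: J_def)
qed

lemma prime_Irr: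
  assumes P: "P \<in> Irr r"
  shows "prime_ideal_pred (dvdm P)"
proof
  show "\<not> dvdm P 1" using P by (rule dvdm_Irr_one)
  show "dvdm P a \<or> dvdm P b" if ab: "dvdm P (a * b)" for a b
  proof (cases "dvdm P a")
    case False
    then obtain s where s: "dvdm P (1 - s * a)" by (rule Irr_bezout[OF P])
    have "dvdm P ((1 - s * a) * b + s * (a * b))"
      using m.mult[OF s] m.mult_left[OF ab] by (rule m.add)
    then show ?thesis by (simp add: algebra_simps)
  qed simp
qed

lemma Irr_factor:
  assumes "g \<in> Mon l" "l > 0"
  obtains k P where "P \<in> Irr k" "dvdm P g"
proof -
  define Q where "Q k \<longleftrightarrow> k > 0 \<and> (\<exists>P\<in>Mon k. dvdm P g)" for k
  have "Q l" using assms dvdm_self[of g 1] by (auto simp: Q_def)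
  then have Q: "Q (LEAST k. Q k)" by (rule LeastI)
  have min: "\<not> Q k" if "k < (LEAST k. Q k)" for k using that by (rule not_less_Least)
  obtain P where P: "P \<in> Mon (LEAST k. Q k)" "dvdm P g" using Q by (auto simp: Q_def)
  have "\<not> dvdm h P" if "0 < k" "k < (LEAST k. Q k)" "h \<in> Mon k" for h k
    using min[of k] that dvdm_trans[OF _ P(2)] by (auto simp: Q_def)
  then have "P \<in> Irr (LEAST k. Q k)"
    using P Q by (auto simp: Irr_def Q_def)
  with P that show ?thesis by blast
qed

lemma Irr_dvdm_Irr:
  assumes "P \<in> Irr r" "Q \<in> Irr s" "dvdm P Q"
  shows "P = Q"
proof -
  have "r \<le> s"
    using monic_quotient[OF IrrD(1)[OF assms(1)] IrrD(1)[OF assms(2)] assms(3)] by blast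
  moreover have "\<not> r < s"
    using assms by (auto simp: Irr_def)
  ultimately have "r = s" by simp
  then show ?thesis
    using Mon_dvdm_same_degree assms IrrD by metis
qed

lemma dvdm_mult_cancel:
  assumes "\<not> dvdm 0 g" "dvdm (g * a) (g * b)"
  shows "dvdm a b"
proof -
  obtain h where "dvdm 0 (g * b - g * a * h)" using assms(2) by (auto simp: dvdm_iff[of "g * a"])
  then have "dvdm 0 (g * (b - a * h))" by (simp add: algebra_simps)
  then have "dvdm 0 (b - a * h)" using assms(1) z.prime by blast
  then show ?thesis by (auto simp: dvdm_iff[of a])
qed

lemma dvdm_mult_mono: "dvdm a b \<Longrightarrow> dvdm (g * a) (g * b)"
proof -
  assume "dvdm a b"
  then obtain h where "dvdm 0 (b - a * h)" by (auto simp: dvdm_iff[of a])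
  then have "dvdm 0 (g * (b - a * h))" by (rule m.mult_left)
  then show ?thesis
    unfolding dvdm_iff[of "g * a"] by (intro exI[of _ h]) (simp add: algebra_simps)
qed

lemma Irr_power_not_zero: "P \<in> Irr r \<Longrightarrow> \<not> dvdm 0 (P ^ j)"
  using z.prime_power Mon_not_zero IrrD(1) by blast

lemma Irr_power_dvdm_mult:
  assumes P: "P \<in> Irr r" and Q: "Q \<in> Irr s" and "P \<noteq> Q"
  shows "dvdm (P ^ j) (Q * h) \<longleftrightarrow> dvdm (P ^ j) h"
proof
  assume "dvdm (P ^ j) (Q * h)"
  then show "dvdm (P ^ j) h"
  proof (induction j)
    case 0
    then show ?case using dvdm_self[of 1 h] by simp
  next
    case (Suc j)
    interpret P: prime_ideal_pred "dvdm P" by (rule prime_Irr[OF P])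
    have "dvdm (P ^ j) (P ^ Suc j)" using dvdm_self[of "P ^ j" P] by (simp add: mult.commute)
    then have "dvdm (P ^ j) h" using Suc dvdm_trans by blast
    then obtain x where x: "dvdm 0 (h - P ^ j * x)" by (auto simp: dvdm_iff[of "P ^ j"])
    have "dvdm 0 (Q * h - Q * (P ^ j * x))"
      using m.mult_left[OF x, of Q] by (simp add: algebra_simps)
    then have "dvdm (P ^ Suc j) (Q * (P ^ j * x))"
      using Suc.prems m.cong_iff dvdm_zeroD by blast
    then have "dvdm (P ^ j * P) (P ^ j * (Q * x))" by (simp add: algebra_simps)
    then have "dvdm P (Q * x)" using dvdm_mult_cancel Irr_power_not_zero[OF P] by blast
    moreover have "\<not> dvdm P Q" using Irr_dvdm_Irr[OF P Q] assms(3) by blast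
    ultimately have "dvdm P x" using P.prime by blast
    then have "dvdm (P ^ j * P) (P ^ j * x)" by (rule dvdm_mult_mono)
    then show ?case
      using m.cong_iff[OF dvdm_zeroD[OF x]] by (simp add: mult.commute)
  qed
qed (rule m.mult_left)

lemma Irr_power_dvdm_degree:
  assumes P: "P \<in> Irr r" and h: "h \<in> Mon l" and "dvdm (P ^ j) h"
  shows "j * r \<le> l"
proof (rule ccontr)
  assume "\<not> j * r \<le> l"
  moreover have "degree (P ^ j) = j * r"
    using IrrD[OF P] by (subst degree_power_eq) auto
  moreover have "lead_coeff (P ^ j) = 1"
    using IrrD[OF P] by (simp add: lead_coeff_power)
  ultimately have "dvdm 0 h"
    using h assms(3) by (intro monic_dvdm_low[of "P ^ j" h]) (auto simp: Mon_def coeff_eq_0)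
  then show False using Mon_not_zero[OF h] by blast
qed

lemma Irr_power_dvdm_le_degree:
  assumes "P \<in> Irr r" "h \<in> Mon l" "dvdm (P ^ j) h"
  shows "j \<le> l"
proof -
  have "j * 1 \<le> j * r" using IrrD(2)[OF assms(1)] by (intro mult_le_mono) auto
  then show ?thesis using Irr_power_dvdm_degree[OF assms] by linarith
qed

definition Irrs :: "nat \<Rightarrow> int poly set"
  where "Irrs M = (\<Union>k\<in>{1..M}. Irr k)"

lemma finite_Irrs: "finite (Irrs M)"
  by (simp add: Irrs_def finite_Irr)

text \<open>Unique factorisation in its degree form: the cardinality is the multiplicity of
  \<open>P\<close> in \<open>g\<close>, which does not exceed \<open>l \<le> M\<close>. Splitting
  off one irreducible factor \<open>Q\<close> raises the multiplicity of \<open>Q\<close> by one and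
  changes no other.\<close>

theorem degree_eq_sum_Irr:
  assumes "g \<in> Mon l" "l \<le> M"
  shows "(\<Sum>P\<in>Irrs M. degree P * card {j \<in> {1..M}. dvdm (P ^ j) g}) = l"
  using assms
proof (induction l arbitrary: g rule: less_induct)
  case (less l)
  show ?case
  proof (cases "l = 0")
    case True
    then have g: "g = 1" using less.prems by (simp add: Mon_0)
    have no: "{j \<in> {1..M}. dvdm (P ^ j) g} = {}" if PM: "P \<in> Irrs M" for P
    proof -
      obtain k where P: "P \<in> Irr k" using PM unfolding Irrs_def by blast
      show ?thesis
        using Irr_power_dvdm_le_degree[OF P, of g 0] g by (auto simp: Mon_0)
    qed
    have "(\<Sum>P\<in>Irrs M. degree P * card {j \<in> {1..M}. dvdm (P ^ j) g}) = 0"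
      by (intro sum.neutral ballI) (simp only: no card.empty mult_0_right)
    then show ?thesis using True by simp
  next
    case False
    then obtain k Q where Q: "Q \<in> Irr k" "dvdm Q g"
      using less.prems Irr_factor[of g l] by (metis neq0_conv)
    then obtain h where h: "h \<in> Mon (l - k)" "k \<le> l" "dvdm 0 (g - Q * h)"
      using monic_quotient[OF IrrD(1) less.prems(1)] by blast
    have k: "k > 0" using IrrD Q by blast
    have dvd: "dvdm (P ^ j) g \<longleftrightarrow> dvdm (P ^ j) (Q * h)" for P j
      by (rule m.cong_iff[OF dvdm_zeroD[OF h(3)]])
    have other: "card {j \<in> {1..M}. dvdm (P ^ j) g} = card {j \<in> {1..M}. dvdm (P ^ j) h}"
      if "P \<in> Irrs M - {Q}" for P
      using that Q(1) by (auto simp: dvd Irrs_def Irr_power_dvdm_mult)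
    have set: "{j \<in> {1..M}. dvdm (Q ^ j) g} = insert 1 (Suc ` {j \<in> {1..M}. dvdm (Q ^ j) h})"
    proof (intro equalityI subsetI)
      fix j assume "j \<in> {j \<in> {1..M}. dvdm (Q ^ j) g}"
      then obtain i where i: "j = Suc i" "Suc i \<le> M" "dvdm (Q * Q ^ i) (Q * h)"
        by (cases j) (auto simp: dvd)
      then have "dvdm (Q ^ i) h"
        using dvdm_mult_cancel Mon_not_zero[OF IrrD(1)[OF Q(1)]] by blast
      then show "j \<in> insert 1 (Suc ` {j \<in> {1..M}. dvdm (Q ^ j) h})"
        using i by (cases "i = 0") auto
    next
      fix j assume "j \<in> insert 1 (Suc ` {j \<in> {1..M}. dvdm (Q ^ j) h})"
      then consider "j = 1" | i where "j = Suc i" "dvdm (Q ^ i) h" by auto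
      then show "j \<in> {j \<in> {1..M}. dvdm (Q ^ j) g}"
      proof cases
        case 1
        then show ?thesis using Q False less.prems by auto
      next
        case 2
        have "i \<le> l - k" using Irr_power_dvdm_le_degree[OF Q(1) h(1) 2(2)] .
        then have "Suc i \<le> M" using h(2) k less.prems by linarith
        then show ?thesis using 2 dvdm_mult_mono[of "Q ^ i" h Q] by (simp add: dvd)
      qed
    qed
    have same: "card {j \<in> {1..M}. dvdm (Q ^ j) g} = Suc (card {j \<in> {1..M}. dvdm (Q ^ j) h})"
      unfolding set by (subst card_insert_disjoint) (auto simp: card_image)
    have QM: "Q \<in> Irrs M" using Q(1) k h(2) less.prems(2) by (auto simp: Irrs_def)
    have rest: "(\<Sum>P\<in>Irrs M - {Q}. degree P * card {j \<in> {1..M}. dvdm (P ^ j) g})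
        = (\<Sum>P\<in>Irrs M - {Q}. degree P * card {j \<in> {1..M}. dvdm (P ^ j) h})"
      by (rule sum.cong[OF refl]) (simp only: other)
    have "(\<Sum>P\<in>Irrs M. degree P * card {j \<in> {1..M}. dvdm (P ^ j) g})
        = k + (\<Sum>P\<in>Irrs M. degree P * card {j \<in> {1..M}. dvdm (P ^ j) h})"
      unfolding sum.remove[OF finite_Irrs QM] same IrrD(3)[OF Q(1)] rest by simp
    also have "\<dots> = k + (l - k)"
      using less.IH[OF _ h(1)] k h(2) less.prems(2) by simp
    finally show ?thesis using h(2) by simp
  qed
qed

text \<open>Euler's argument in the field F_p[X]/(P), represented by \<open>Low r\<close>:
  multiplication by \<open>a\<close> permutes the nonzero remainders, and their product
  cancels.\<close>

lemma Irr_fermat: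
  assumes P: "P \<in> Irr r"
  shows "dvdm P (a ^ (p ^ r) - a)"
proof (cases "dvdm P a")
  case True
  have "p ^ r = Suc (p ^ r - 1)" using p_gt_1 by simp
  then have "dvdm P (a ^ (p ^ r))" using True m.mult by (metis power_Suc)
  then show ?thesis using True by (rule m.diff)
next
  case False
  interpret P: prime_ideal_pred "dvdm P" by (rule prime_Irr[OF P])
  note PD = IrrD[OF P]
  define U where "U = Low r - {0}"
  have finU: "finite U" and cardU: "card U = p ^ r - 1"
    using card_Low[of r] p_gt_1 by (auto simp: U_def Low_def Red_def card_Diff_subset)
  have "\<exists>c. c \<in> Low r \<and> dvdm P (a * b - c)" for b
    using monic_division[of P "a * b"] PD by metis
  then obtain f where f: "f b \<in> Low r" "dvdm P (a * b - f b)" for b by metis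
  have notU: "\<not> dvdm P b" if "b \<in> U" for b
    using that Low_not_dvdm[of P b] PD by (auto simp: U_def)
  have fU: "f b \<in> U" if b: "b \<in> U" for b
  proof -
    have "\<not> dvdm P (a * b)" using notU[OF b] False P.prime by blast
    then have "f b \<noteq> 0" using f(2)[of b] by auto
    then show ?thesis using f by (simp add: U_def)
  qed
  have "inj_on f U"
  proof (rule inj_onI)
    fix b c assume bc: "b \<in> U" "c \<in> U" "f b = f c"
    have "dvdm P (a * b - a * c)"
      using m.cong_trans[OF f(2)[of b] m.cong_sym[OF f(2)[of c, folded bc(3)]]] .
    then have "dvdm P (a * (b - c))" by (simp add: algebra_simps)
    then have "dvdm P (b - c)" using False P.prime by blast
    then show "b = c" using Low_eqI[of P b c] bc PD by (simp add: U_def)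
  qed
  then have "bij_betw f U U"
    using fU finU by (metis bij_betw_def endo_inj_surj image_subsetI)
  then have prod: "(\<Prod>b\<in>U. f b) = \<Prod>U"
    by (rule prod.reindex_bij_betw)
  have "dvdm P ((\<Prod>b\<in>U. a * b) - (\<Prod>b\<in>U. f b))"
    by (rule m.cong_prod) (rule f)
  then have "dvdm P ((a ^ (p ^ r - 1) - 1) * \<Prod>U)"
    by (simp add: prod prod.distrib cardU algebra_simps)
  moreover have "\<not> dvdm P (\<Prod>U)"
    using P.prime_prod[OF finU, of "\<lambda>x. x"] notU by blast
  ultimately have "dvdm P (a ^ (p ^ r - 1) - 1)" using P.prime by blast
  then have "dvdm P (a * (a ^ (p ^ r - 1) - 1))" by (rule m.mult_left)
  moreover have "a * (a ^ (p ^ r - 1) - 1) = a ^ (p ^ r) - a"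
    using p_gt_1 power_Suc[of a "p ^ r - 1"] by (simp add: right_diff_distrib del: power_Suc)
  ultimately show ?thesis by simp
qed

end

section \<open>Power sums of roots\<close>

text \<open>
  If $A = \prod_i (1 - x_i X)$, then the \<open>t\<close> with \<open>newton A t\<close> is the generating function of the
  power sums $\sum_i x_i^j$, $j \ge 1$.
\<close>
definition newton :: "'a::comm_ring_1 fps \<Rightarrow> 'a fps \<Rightarrow> bool"
  where "newton A t \<longleftrightarrow> - (fps_X * fps_deriv A) = A * t"

lemma newton_mult:
  assumes "newton A s" "newton B t"
  shows "newton (A * B) (s + t)"
proof -
  have "- (fps_X * fps_deriv (A * B)) = - (fps_X * fps_deriv A) * B + A * - (fps_X * fps_deriv B)"
    by (simp add: algebra_simps)
  also have "\<dots> = A * B * (s + t)"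
    using assms by (simp add: newton_def algebra_simps)
  finally show ?thesis by (simp add: newton_def)
qed

lemma newton_prod:
  "finite S \<Longrightarrow> (\<And>i. i \<in> S \<Longrightarrow> newton (A i) (t i)) \<Longrightarrow> newton (\<Prod>i\<in>S. A i) (\<Sum>i\<in>S. t i)"
  by (induction S rule: finite_induct) (simp_all add: newton_mult, simp add: newton_def)

lemma newton_linear: "newton (1 - fps_const x * fps_X) (Abs_fps (\<lambda>j. if j = 0 then 0 else x ^ j))"
  unfolding newton_def
proof (rule fps_ext)
  fix n
  let ?t = "Abs_fps (\<lambda>j. if j = 0 then 0 else x ^ j)"
  have "(1 - fps_const x * fps_X) * ?t = ?t - fps_const x * (fps_X * ?t)"
    by (simp add: algebra_simps)
  then show "(- (fps_X * fps_deriv (1 - fps_const x * fps_X))) $ n = ((1 - fps_const x * fps_X) * ?t) $ n"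
    by (cases n; cases "n - 1") auto
qed

lemma newton_iff: "newton A t \<longleftrightarrow> (\<forall>n. - (of_nat n * A $ n) = (A * t) $ n)"
proof -
  have "(- (fps_X * fps_deriv A)) $ n = - (of_nat n * A $ n)" for n
    by (cases n) auto
  then show ?thesis by (simp add: newton_def fps_eq_iff)
qed

lemma newton_nth:
  assumes "newton A t" "A $ 0 = 1"
  shows "t $ j = - (of_nat j * A $ j) - (\<Sum>i<j. t $ i * A $ (j - i))"
proof -
  have "- (of_nat j * A $ j) = (t * A) $ j"
    using assms(1) by (simp add: newton_iff mult.commute)
  also have "\<dots> = (\<Sum>i<Suc j. t $ i * A $ (j - i))"
    by (simp add: fps_mult_nth atLeast0AtMost lessThan_Suc_atMost)
  also have "\<dots> = (\<Sum>i<j. t $ i * A $ (j - i)) + t $ j"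
    using assms(2) by simp
  finally show ?thesis by (simp add: algebra_simps)
qed

lemma newton_unique:
  assumes "newton A s" "newton A t" "A $ 0 = 1"
  shows "s = t"
proof (rule fps_ext)
  fix n
  show "s $ n = t $ n"
  proof (induction n rule: less_induct)
    case (less n)
    then show ?case
      using newton_nth[OF assms(1,3), of n] newton_nth[OF assms(2,3), of n] by simp
  qed
qed

text \<open>The recursion \<open>newton_nth\<close> involves no division, so it respects
  congruences.\<close>

lemma (in ideal_pred) newton_cong:
  assumes "newton A s" "newton B t" "A $ 0 = 1" "B $ 0 = 1"
    and "\<And>i. I (A $ i - B $ i)"
  shows "I (s $ j - t $ j)"
proof (induction j rule: less_induct)
  case (less j)
  have "I ((- (of_nat j * A $ j) - (\<Sum>i<j. s $ i * A $ (j - i)))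
      - (- (of_nat j * B $ j) - (\<Sum>i<j. t $ i * B $ (j - i))))"
    using less assms(5) mult_left[OF assms(5)[of j], of "- of_nat j"]
    by (intro cong_diff cong_sum cong_mult) (auto simp: algebra_simps)
  then show ?case
    using newton_nth[OF assms(1,3), of j] newton_nth[OF assms(2,4), of j] by simp
qed

text \<open>The power sum of index d contains the coefficient of index d only through the term - d
  A_d; all other terms come from smaller indices.\<close>

lemma newton_shift:
  assumes "newton A s" "newton B t" "A $ 0 = 1" "B $ 0 = 1"
    and "\<And>i. i < d \<Longrightarrow> A $ i = B $ i" "B $ d = A $ d + c"
  shows "i < d \<Longrightarrow> s $ i = t $ i" and "t $ d = s $ d - of_nat d * c"
proof -
  show eq: "s $ i = t $ i" if "i < d" for i
    using that
  proof (induction i rule: less_induct)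
    case (less i)
    then show ?case
      using newton_nth[OF assms(1,3), of i] newton_nth[OF assms(2,4), of i] assms(5) by simp
  qed
  have "(\<Sum>i<d. s $ i * A $ (d - i)) = (\<Sum>i<d. t $ i * B $ (d - i))"
  proof (rule sum.cong)
    fix i assume i: "i \<in> {..<d}"
    show "s $ i * A $ (d - i) = t $ i * B $ (d - i)"
    \<comment> \<open>The term i = 0 contains the coefficients of index d, the only ones here that
      differ. It vanishes because a solution of \<open>newton\<close> has constant term 0.\<close>
    proof (cases "i = 0")
      case True
      then show ?thesis
        using newton_nth[OF assms(1,3), of 0] newton_nth[OF assms(2,4), of 0] by simp
    next
      case False
      then show ?thesis using i eq assms(5) by simp
    qed
  qed simp
  then have "t $ d = - (of_nat d * (A $ d + c)) - (\<Sum>i<d. s $ i * A $ (d - i))"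
    using newton_nth[OF assms(2,4), of d] assms(6) by simp
  also have "\<dots> = s $ d - of_nat d * c"
    unfolding newton_nth[OF assms(1,3), of d] by (simp add: algebra_simps)
  finally show "t $ d = s $ d - of_nat d * c" .
qed

lemma newton_of_int:
  assumes "newton A t"
  shows "newton (Abs_fps (\<lambda>i. of_int (A $ i))) (Abs_fps (\<lambda>i. of_int (t $ i)))"
  unfolding newton_iff
proof
  fix n
  have "- (of_nat n * A $ n) = (A * t) $ n"
    using assms by (simp add: newton_iff)
  then have "(of_int (- (of_nat n * A $ n)) :: 'a) = of_int ((A * t) $ n)"
    by (rule arg_cong)
  then show "- (of_nat n * Abs_fps (\<lambda>i. of_int (A $ i) :: 'a) $ n)
      = (Abs_fps (\<lambda>i. of_int (A $ i)) * Abs_fps (\<lambda>i. of_int (t $ i))) $ n"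
    by (simp add: fps_mult_nth)
qed

text \<open>Solving for the power sums divides by \<open>A\<close>, a unit because its constant term
  is 1, and by no integer; so the power sums of an integer polynomial are integers.\<close>

lemma newton_exists:
  fixes A :: "'a::comm_ring_1 fps"
  assumes "A $ 0 = 1"
  shows "newton A (- (fps_X * fps_deriv A) * fps_left_inverse A 1)"
proof -
  have 1: "fps_left_inverse A 1 * A = 1"
    using assms by (intro fps_left_inverse) simp
  have "A * (B * L) = B" if "L * A = 1" for B L
    using that by (metis mult.commute mult.left_commute mult.right_neutral)
  from this[OF 1] show ?thesis
    unfolding newton_def by (rule sym)
qed

text \<open>
  The coefficients of \<open>psum g\<close> are the power sums of the complex roots of a monic $g$. They are
  computed from the coefficients of $g$ alone, so that they make sense modulo $p$.
\<close>
definition psum :: "int poly \<Rightarrow> int fps"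
  where "psum g = (let A = fps_of_poly (reflect_poly g)
    in - (fps_X * fps_deriv A) * fps_left_inverse A 1)"

lemma newton_psum: "lead_coeff g = 1 \<Longrightarrow> newton (fps_of_poly (reflect_poly g)) (psum g)"
  unfolding psum_def Let_def by (rule newton_exists) simp

lemma psum_unique:
  "lead_coeff g = 1 \<Longrightarrow> newton (fps_of_poly (reflect_poly g)) t \<Longrightarrow> psum g = t"
  using newton_unique[OF newton_psum] by simp

lemma psum_mult:
  assumes "lead_coeff g = 1" "lead_coeff h = 1"
  shows "psum (g * h) = psum g + psum h"
  using assms newton_mult[OF newton_psum newton_psum, of g h]
  by (intro psum_unique) (simp_all add: lead_coeff_mult reflect_poly_mult fps_of_poly_mult)

lemma newton_reflect_prod:
  fixes x :: "'b \<Rightarrow> 'a::idom"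
  assumes "finite S"
  shows "newton (fps_of_poly (reflect_poly (\<Prod>i\<in>S. [:- x i, 1:])))
    (\<Sum>i\<in>S. Abs_fps (\<lambda>j. if j = 0 then 0 else x i ^ j))"
proof -
  have "reflect_poly [:- y, 1:] = [:1, - y:]" for y :: 'a
    by (rule poly_eqI) (auto simp: coeff_reflect_poly coeff_pCons split: nat.splits)
  moreover have "fps_of_poly [:1, - y:] = 1 - fps_const y * fps_X" for y :: 'a
    by (rule fps_ext) (auto simp: coeff_pCons split: nat.splits)
  ultimately show ?thesis
    using newton_prod[OF assms newton_linear, of x]
    by (simp only: reflect_poly_prod fps_of_poly_prod)
qed

lemma psum_linear: "j > 0 \<Longrightarrow> psum [:- c, 1:] $ j = c ^ j"
  using psum_unique[OF _ newton_reflect_prod[of "{()}" "\<lambda>_. c"]] by simp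

section \<open>Frobenius conjugates as the roots of an irreducible polynomial\<close>

context prime_modulus
begin

lemma psum_cong:
  assumes "lead_coeff g = 1" "lead_coeff h = 1" "degree g = degree h" "dvdm 0 (g - h)"
  shows "int p dvd psum g $ j - psum h $ j"
proof -
  interpret I: ideal_pred "\<lambda>c. int p dvd c" by standard auto
  show ?thesis
    using assms
    by (intro I.newton_cong[OF newton_psum newton_psum])
      (auto simp: coeff_reflect_poly dvdm_zero_iff)
qed

lemma pcompose_cong: "dvdm g (x - y) \<Longrightarrow> dvdm g (pcompose a x - pcompose a y)"
  by (induction a) (auto simp: pcompose_pCons m.zero intro!: m.cong_mult)

text \<open>Frobenius is additive and fixes constants, so it acts on a polynomial by acting on X
  alone.\<close>

lemma frobenius_pcompose: "dvdm g (a ^ (p ^ n) - pcompose a (monom 1 (p ^ n)))"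
proof (induction a)
  case 0
  then show ?case using p_gt_1 by (simp add: m.zero power_0_left)
next
  case (pCons c a)
  have eq: "pCons c a = of_int c + monom 1 1 * a"
    by (simp add: of_int_poly monom_Suc)
  have "dvdm g ((of_int c + monom 1 1 * a) ^ (p ^ n)
      - (of_int c ^ (p ^ n) + (monom 1 1 * a) ^ (p ^ n)))"
    by (rule m.frobenius_power_add[OF prime_p dvdm_p])
  moreover have "dvdm g ((of_int c ^ (p ^ n) + (monom 1 1 * a) ^ (p ^ n))
      - (of_int c + monom 1 (p ^ n) * pcompose a (monom 1 (p ^ n))))"
    using pCons.IH
    by (intro m.cong_add m.fermat_of_int[OF prime_p dvdm_p])
      (auto simp: power_mult_distrib monom_power m.zero intro!: m.cong_mult)
  ultimately have "dvdm g ((of_int c + monom 1 1 * a) ^ (p ^ n)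
      - (of_int c + monom 1 (p ^ n) * pcompose a (monom 1 (p ^ n))))"
    by (rule m.cong_trans)
  then show ?case
    unfolding eq[symmetric] by (simp add: pcompose_pCons of_int_poly)
qed

text \<open>If Frobenius to the power t fixed X modulo \<open>P\<close>, it would fix all p^r
  residues, too many roots for Y^(p^t) - Y. The polynomial \<open>?F\<close> is one in a second
  variable Y, with coefficients read modulo \<open>P\<close>.\<close>

lemma Irr_frobenius_distinct:
  assumes P: "P \<in> Irr r" and t: "0 < t" "t < r"
  shows "\<not> dvdm P (monom 1 (p ^ t) - monom 1 1)"
proof
  assume *: "dvdm P (monom 1 (p ^ t) - monom 1 1)"
  interpret P: prime_ideal_pred "dvdm P" by (rule prime_Irr[OF P])
  have "monom 1 1 = [:0, 1 :: int:]"
    by (rule poly_eqI) (simp add: coeff_pCons split: nat.splits)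
  then have fix_: "dvdm P (a ^ (p ^ t) - a)" for a
    using m.cong_trans[OF frobenius_pcompose pcompose_cong[OF *]] by simp
  let ?F = "monom 1 (p ^ t) - monom 1 1 :: int poly poly"
  have pt: "p ^ t > 1" using p_gt_1(2) t(1) by (rule one_less_power)
  have "card (Low r) \<le> degree ?F"
  proof (rule P.card_roots_le)
    show "\<not> dvdm P (coeff ?F (p ^ t))"
      using pt dvdm_Irr_one[OF P] by simp
    show "finite (Low r)" using card_Low by blast
    show "dvdm P (poly ?F a)" for a
      using fix_[of a] by (simp add: poly_monom)
    show "a = b" if "a \<in> Low r" "b \<in> Low r" "dvdm P (a - b)" for a b
      using Low_eqI[of P a b] that IrrD[OF P] by simp
  qed
  also have "\<dots> \<le> p ^ t"
    using pt by (intro degree_diff_le) (auto simp: degree_monom_eq)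
  also have "\<dots> < p ^ r" using t p_gt_1 by simp
  finally show False using card_Low[of r] by simp
qed

text \<open>Raising a coincidence to the power p^(r - j) turns X^(p^j) into X and leads back to
  \<open>Irr_frobenius_distinct\<close>.\<close>

lemma Irr_frobenius_inj:
  assumes P: "P \<in> Irr r" and ij: "i < j" "j < r"
  shows "\<not> dvdm P (monom 1 (p ^ i) - monom 1 (p ^ j))"
proof
  assume "dvdm P (monom 1 (p ^ i) - monom 1 (p ^ j))"
  then have "dvdm P (monom 1 (p ^ i) ^ (p ^ (r - j)) - monom 1 (p ^ j) ^ (p ^ (r - j)))"
    by (rule m.cong_power)
  then have "dvdm P (monom 1 (p ^ (i + (r - j))) - monom 1 (p ^ r))"
    using ij by (simp add: monom_power flip: power_add)
  moreover have "dvdm P (monom 1 (p ^ r) - monom 1 1)"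
    using Irr_fermat[OF P, of "monom 1 1"] by (simp add: monom_power)
  ultimately have *: "dvdm P (monom 1 (p ^ (i + (r - j))) - monom 1 1)"
    by (rule m.cong_trans)
  have "0 < i + (r - j)" "i + (r - j) < r" using ij by auto
  from Irr_frobenius_distinct[OF P this] * show False by (rule notE)
qed

text \<open>The class of X is a root of P(Y) in the field F_p[X]/(P), and so are its r distinct
  conjugates X^(p^i). Both P(Y) and the product over the conjugates are monic of degree r, so their
  difference has r roots but degree below r. The term \<open>map_poly (\<lambda>c. [:c:]) P\<close>
  is \<open>P\<close> in the second variable Y.\<close>

lemma Irr_eq_prod_frobenius:
  assumes P: "P \<in> Irr r"
  shows "dvdm P (coeff (map_poly (\<lambda>c. [:c:]) P) k - coeff (\<Prod>i<r. [:- monom 1 (p ^ i), 1:]) k)"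
proof (rule ccontr)
  interpret P: prime_ideal_pred "dvdm P" by (rule prime_Irr[OF P])
  let ?F = "map_poly (\<lambda>c. [:c:]) P" and ?G = "\<Prod>i<r. [:- monom 1 (p ^ i), 1:] :: int poly poly"
  let ?x = "\<lambda>i. monom 1 (p ^ i) :: int poly"
  assume "\<not> dvdm P (coeff ?F k - coeff ?G k)"
  then have nz: "\<not> dvdm P (coeff (?F - ?G) k)" by simp
  have dF: "degree ?F = r" "coeff ?F r = 1"
    using IrrD[OF P] by (auto simp: degree_map_poly coeff_map_poly)
  have "degree ?G = (\<Sum>i<r. degree [:- ?x i, 1:])"
    by (rule degree_prod_eq_sum_degree) auto
  then have dG: "degree ?G = r" by simp
  moreover have "lead_coeff ?G = 1"
    by (simp add: lead_coeff_prod)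
  ultimately have "coeff (?F - ?G) r = 0" using dF by simp
  moreover have "degree (?F - ?G) \<le> r" using dF dG by (intro degree_diff_le) auto
  ultimately have deg: "degree (?F - ?G) < r"
    using IrrD(2)[OF P] leading_coeff_0_iff[of "?F - ?G"]
    by (cases "degree (?F - ?G) = r") auto
  have "card (?x ` {..<r}) \<le> degree (?F - ?G)"
  proof (rule P.card_roots_le[OF nz])
    show "finite (?x ` {..<r})" by simp
  next
    fix a assume "a \<in> ?x ` {..<r}"
    then obtain i where i: "i < r" "a = ?x i" by auto
    have "dvdm P (P ^ (p ^ i) - pcompose P (?x i))" by (rule frobenius_pcompose)
    moreover have "dvdm P (P ^ (p ^ i))"
      using dvdm_self[of P "P ^ (p ^ i - 1)"] p_gt_1 by (simp flip: power_Suc)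
    ultimately have "dvdm P (pcompose P (?x i))" using m.cong_iff by blast
    moreover have "poly ?G a = 0"
      using i by (auto simp: poly_prod prod_zero_iff)
    ultimately show "dvdm P (poly (?F - ?G) a)"
      using i by (simp add: pcompose_altdef)
  next
    fix a b assume ab: "a \<in> ?x ` {..<r}" "b \<in> ?x ` {..<r}" "dvdm P (a - b)"
    then show "a = b"
      using Irr_frobenius_inj[OF P] m.cong_sym[OF ab(3)]
      by (auto, metis linorder_neqE_nat)
  qed
  moreover have "inj_on ?x {..<r}"
    using p_gt_1 by (auto simp: inj_on_def monom_eq_iff')
  ultimately show False using deg by (simp add: card_image)
qed

text \<open>The right-hand sum is the trace of X^j from F_p[X]/(P) to F_p. Newton's identities for
  the two products of \<open>Irr_eq_prod_frobenius\<close> agree modulo \<open>P\<close>.\<close>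

lemma psum_Irr:
  assumes P: "P \<in> Irr r" and j: "j > 0"
  shows "dvdm P (of_int (psum P $ j) - (\<Sum>i<r. monom 1 (j * p ^ i)))"
proof -
  let ?F = "map_poly (\<lambda>c. [:c:]) P" and ?G = "\<Prod>i<r. [:- monom 1 (p ^ i), 1:] :: int poly poly"
  let ?t = "\<Sum>i<r. Abs_fps (\<lambda>j. if j = 0 then 0 else monom 1 (p ^ i) ^ j) :: int poly fps"
  note PD = IrrD[OF P]
  have dF: "degree ?F = r" using PD by (simp add: degree_map_poly)
  have "degree ?G = (\<Sum>i<r. degree [:- monom 1 (p ^ i), 1 :: int poly:])"
    by (rule degree_prod_eq_sum_degree) auto
  then have dG: "degree ?G = r" by simp
  have lG: "lead_coeff ?G = 1" by (simp add: lead_coeff_prod)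
  have eq: "Abs_fps (\<lambda>i. of_int (fps_of_poly (reflect_poly P) $ i)) = fps_of_poly (reflect_poly ?F)"
    by (rule fps_ext) (simp add: coeff_reflect_poly dF PD coeff_map_poly of_int_poly)
  have "newton (Abs_fps (\<lambda>i. of_int (fps_of_poly (reflect_poly P) $ i) :: int poly))
      (Abs_fps (\<lambda>i. of_int (psum P $ i)))"
    by (rule newton_of_int[OF newton_psum[OF PD(4)]])
  then have nF: "newton (fps_of_poly (reflect_poly ?F)) (Abs_fps (\<lambda>i. of_int (psum P $ i)))"
    by (simp only: eq)
  have nG: "newton (fps_of_poly (reflect_poly ?G)) ?t"
    by (rule newton_reflect_prod) simp
  have "dvdm P (Abs_fps (\<lambda>i. of_int (psum P $ i)) $ j - ?t $ j)"
  proof (rule m.newton_cong[OF nF nG])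
    show "fps_of_poly (reflect_poly ?F) $ 0 = 1" using PD by (simp add: dF coeff_map_poly)
    show "fps_of_poly (reflect_poly ?G) $ 0 = 1" using lG by simp
    show "dvdm P (fps_of_poly (reflect_poly ?F) $ i - fps_of_poly (reflect_poly ?G) $ i)" for i
      using Irr_eq_prod_frobenius[OF P] by (simp add: coeff_reflect_poly dF dG m.zero)
  qed
  then show ?thesis
    using j by (simp add: fps_sum_nth monom_power mult.commute)
qed

end

context prime_modulus
begin

text \<open>This replaces counting the zeros of \<open>a\<close> in the field with p^r elements:
  every irreducible divisor of degree r stands for r conjugate zeros.\<close>

lemma Irr_divisors_card_le:
  assumes S: "S \<subseteq> Irr r" and nz: "\<not> dvdm 0 a" and dvd: "\<And>P. P \<in> S \<Longrightarrow> dvdm P a"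
  shows "r * card S \<le> degree a"
proof (cases "r = 0")
  case False
  obtain w k where w: "k \<le> degree a" "red (smult w a) \<in> Mon k" "\<not> int p dvd w"
    using nz by (rule monicize)
  let ?g = "red (smult w a)"
  let ?M = "k + r"
  have SM: "S \<subseteq> Irrs ?M"
    unfolding Irrs_def using S False by (intro subsetI UN_I[of r]) auto
  have finS: "finite S" using S finite_Irr finite_subset by blast
  have deg: "degree P * card {j \<in> {1..?M}. dvdm (P ^ j) ?g} \<ge> r" if P: "P \<in> S" for P
  proof -
    have "dvdm P (smult w a)" using dvd[OF P] dvdm_smult_iff[OF w(3)] by blast
    then have "dvdm P ?g" using m.cong_iff[OF dvdm_zeroD[OF red_cong(1)]] by blast
    then have "1 \<in> {j \<in> {1..?M}. dvdm (P ^ j) ?g}" using False by auto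
    then have "1 \<le> card {j \<in> {1..?M}. dvdm (P ^ j) ?g}"
      using card_mono[of "{j \<in> {1..?M}. dvdm (P ^ j) ?g}" "{1}"] by simp
    moreover have "degree P = r" using P S IrrD by blast
    ultimately show ?thesis by (metis mult_le_mono2 mult.right_neutral)
  qed
  have "r * card S = (\<Sum>P\<in>S. r)" by simp
  also have "\<dots> \<le> (\<Sum>P\<in>S. degree P * card {j \<in> {1..?M}. dvdm (P ^ j) ?g})"
    by (rule sum_mono) (rule deg)
  also have "\<dots> \<le> (\<Sum>P\<in>Irrs ?M. degree P * card {j \<in> {1..?M}. dvdm (P ^ j) ?g})"
    by (rule sum_mono2[OF finite_Irrs SM]) simp
  also have "\<dots> = k" using w(2) by (rule degree_eq_sum_Irr) simp
  finally show ?thesis using w(1) by simp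
qed simp

end

section \<open>Stepanov's auxiliary polynomial\<close>

text \<open>Named after the curve y^p - y = f(x). The condition \<open>d < p\<close> makes d
  invertible modulo p, on which both the vanishing of \<open>\<sigma>\<close> and the distinct
  exponents in \<open>stepanov\<close> rest. A constant term of f would only multiply the character
  sum by a root of unity.\<close>

locale artin_schreier = prime_modulus +
  fixes f :: "int poly" and d :: nat
  assumes degree_f: "degree f = d" and d: "0 < d" "d < p"
    and lead_f: "\<not> int p dvd coeff f d" and f_0: "coeff f 0 = 0"
begin

text \<open>The sum of f over the roots of \<open>g\<close>, as f has no constant term. For
  irreducible \<open>g\<close> it is the trace of f(X) down to F_p.\<close>

definition tr :: "int poly \<Rightarrow> int"
  where "tr g = (\<Sum>j=1..d. coeff f j * psum g $ j)"

lemma tr_Irr: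
  assumes P: "P \<in> Irr r"
  shows "dvdm P (of_int (tr P) - (\<Sum>i<r. f ^ (p ^ i)))"
proof -
  have expand: "pcompose f (monom 1 (p ^ i)) = (\<Sum>j=1..d. of_int (coeff f j) * monom 1 (j * p ^ i))" for i
  proof -
    have "pcompose f (monom 1 (p ^ i)) = (\<Sum>j\<le>d. of_int (coeff f j) * monom 1 (j * p ^ i))"
      by (simp add: pcompose_altdef poly_altdef degree_map_poly degree_f coeff_map_poly
          monom_power of_int_poly mult.commute)
    also have "{..d} = insert 0 {1..d}" by auto
    finally show ?thesis by (simp add: f_0)
  qed
  have "dvdm P ((\<Sum>j=1..d. of_int (coeff f j) * of_int (psum P $ j))
      - (\<Sum>j=1..d. of_int (coeff f j) * (\<Sum>i<r. monom 1 (j * p ^ i))))"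
    using psum_Irr[OF P] by (intro m.cong_sum m.cong_mult) (auto simp: m.zero)
  moreover have "(\<Sum>j=1..d. of_int (coeff f j) * (\<Sum>i<r. monom 1 (j * p ^ i)))
      = (\<Sum>i<r. pcompose f (monom 1 (p ^ i)))"
    unfolding expand sum_distrib_left by (rule sum.swap)
  moreover have "dvdm P ((\<Sum>i<r. pcompose f (monom 1 (p ^ i))) - (\<Sum>i<r. f ^ (p ^ i)))"
    by (rule m.cong_sum) (rule m.cong_sym[OF frobenius_pcompose])
  ultimately show ?thesis
    using m.cong_trans by (simp add: tr_def)
qed

text \<open>Half of a trace: with q = p^\<mu>, the trace of f from the field with q^2 elements to
  F_p is Z + Z^q.\<close>

definition Z :: "nat \<Rightarrow> int poly"
  where "Z \<mu> = (\<Sum>i<\<mu>. f ^ (p ^ i))"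

lemma degree_Z: "degree (Z (Suc n)) = d * p ^ n" and lead_Z: "\<not> int p dvd lead_coeff (Z (Suc n))"
proof -
  have deg_pow: "degree (f ^ k) = d * k" for k
    using degree_power_eq[of f k] degree_f d by (cases "f = 0") auto
  have low: "degree (\<Sum>i<n. f ^ (p ^ i)) < d * p ^ n"
  proof (cases "n = 0")
    case False
    have "degree (\<Sum>i<n. f ^ (p ^ i)) \<le> d * p ^ (n - 1)"
    proof (rule degree_sum_le)
      fix i assume "i \<in> {..<n}"
      then have "p ^ i \<le> p ^ (n - 1)" using p_gt_1 by (intro power_increasing) auto
      then show "degree (f ^ p ^ i) \<le> d * p ^ (n - 1)" by (simp add: deg_pow)
    qed simp
    also have "\<dots> < d * p ^ n" using d p_gt_1 False by simp
    finally show ?thesis .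
  qed (use d in simp)
  have Z: "Z (Suc n) = (\<Sum>i<n. f ^ (p ^ i)) + f ^ (p ^ n)"
    by (simp add: Z_def)
  show "degree (Z (Suc n)) = d * p ^ n"
    unfolding Z using low by (subst degree_add_eq_right) (simp_all add: deg_pow)
  have "lead_coeff (Z (Suc n)) = lead_coeff (f ^ (p ^ n))"
    unfolding Z using low by (intro lead_coeff_add_le) (simp add: deg_pow)
  then show "\<not> int p dvd lead_coeff (Z (Suc n))"
    using lead_f prime_p degree_f prime_dvd_power[of "int p" "lead_coeff f" "p ^ n"]
    by (auto simp: lead_coeff_power)
qed

lemma Z_trace:
  assumes P: "P \<in> Irr (2 * \<mu>)" and c: "int p dvd tr P - c"
  shows "dvdm P (Z \<mu> ^ (p ^ \<mu>) - (of_int c - Z \<mu>))"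
proof -
  have "dvdm P (Z \<mu> ^ (p ^ \<mu>) - (\<Sum>i<\<mu>. (f ^ (p ^ i)) ^ (p ^ \<mu>)))"
    unfolding Z_def by (rule m.frobenius_sum[OF prime_p dvdm_p])
  moreover have "(\<Sum>i<\<mu>. (f ^ (p ^ i)) ^ (p ^ \<mu>)) = (\<Sum>i=\<mu>..<2*\<mu>. f ^ (p ^ i))"
    by (rule sum.reindex_bij_witness[of _ "\<lambda>i. i - \<mu>" "\<lambda>i. i + \<mu>"])
      (auto simp: power_add simp flip: power_mult)
  moreover have "(\<Sum>i<2*\<mu>. f ^ (p ^ i)) = Z \<mu> + (\<Sum>i=\<mu>..<2*\<mu>. f ^ (p ^ i))"
    unfolding Z_def by (simp add: lessThan_atLeast0 sum.atLeastLessThan_concat)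
  ultimately have 1: "dvdm P (Z \<mu> ^ (p ^ \<mu>) - ((\<Sum>i<2*\<mu>. f ^ (p ^ i)) - Z \<mu>))"
    by simp
  have "dvdm P ((\<Sum>i<2*\<mu>. f ^ (p ^ i)) - of_int c)"
    using m.cong_trans[OF m.cong_sym[OF tr_Irr[OF P]], of "of_int c"] dvdm_of_int[OF c] by simp
  then have "dvdm P (((\<Sum>i<2*\<mu>. f ^ (p ^ i)) - Z \<mu>) - (of_int c - Z \<mu>))"
    by simp
  with 1 show ?thesis by (rule m.cong_trans)
qed

text \<open>
  Let $q = p^\mu$. Modulo an irreducible $P$ of degree $2\mu$ with trace $c$ one has $X^{q^2} = X$ and
  $Z^q = c - Z$. So the $q$-th power of $\Psi = \sum w_{ikl} X^i X^{kq} Z^l$ is congruent to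
  $W = \sum w_{ikl} X^{iq} X^k (c - Z)^l$, and more unknowns $w_{ikl}$ than coefficients of $W$ allow
  $W = 0$. The exponents $i + kq + l \deg Z$ are distinct, so $\Psi \ne 0$.
\<close>
theorem stepanov:
  assumes "\<mu> > 0"
  shows "2 * \<mu> * card {P \<in> Irr (2 * \<mu>). int p dvd tr P - c} \<le> p ^ (2 * \<mu> - 1) + (2 * d + 1) * p ^ \<mu>"
proof -
  define b where "b = p ^ (\<mu> - 1)"
  define q where "q = p ^ \<mu>"
  \<comment> \<open>There are b K p = K q unknowns against D coefficients, and D is about (b + d) q,
    which dictates K. The degree of \<open>\<Psi>\<close> then stays near b q = q^2 / p, the
    expected share of one trace value.\<close>
  define K where "K = b + d + 1"
  define D where "D = (b - 1) * q + K + (p - 1) * (d * b)"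
  define T where "T = {..<b} \<times> {..<K} \<times> {..<p}"
  have q: "q = p * b" using assms by (simp add: q_def b_def flip: power_Suc)
  have bpos: "b \<ge> 1" using p_gt_1 by (simp add: b_def)
  have pq: "p \<le> q" unfolding q using bpos by simp
  have degZ: "degree (Z \<mu>) = d * b"
    using degree_Z[of "\<mu> - 1"] assms by (simp add: b_def)
  have leadZ: "\<not> int p dvd lead_coeff (Z \<mu>)"
    using lead_Z[of "\<mu> - 1"] assms by simp
  have finT: "finite T" by (simp add: T_def)
  define W where "W v = (\<Sum>(i, k, l)\<in>T. of_int (v (i, k, l)) * (monom 1 (i * q + k) * (of_int c - Z \<mu>) ^ l))"
    for v :: "nat \<times> nat \<times> nat \<Rightarrow> int"
  define V where "V = PiE T (\<lambda>_. {0..<int p})"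
  have W_Low: "red (W v) \<in> Low D" for v
  proof -
    have "degree (W v) < D"
      unfolding W_def
    proof (rule degree_sum_less)
      show "0 < D" by (simp add: D_def K_def)
      fix t assume t: "t \<in> T"
      obtain i k l where ikl: "t = (i, k, l)" by (cases t)
      have le: "i \<le> b - 1" "k < K" "l \<le> p - 1" using t by (auto simp: T_def ikl)
      have "degree (of_int c - Z \<mu>) \<le> d * b"
        using degZ by (intro degree_diff_le) (auto simp: of_int_poly)
      then have "degree ((of_int c - Z \<mu>) ^ l) \<le> l * (d * b)"
        using degree_power_le[of "of_int c - Z \<mu>" l] by (metis mult.commute mult_le_mono2 order_trans)
      also have "\<dots> \<le> (p - 1) * (d * b)" using le by (intro mult_le_mono1)
      finally have 1: "degree ((of_int c - Z \<mu>) ^ l) \<le> (p - 1) * (d * b)" .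
      have 2: "i * q \<le> (b - 1) * q" using le by (intro mult_le_mono1)
      have "degree (of_int (v t) * (monom 1 (i * q + k) * (of_int c - Z \<mu>) ^ l))
          \<le> 0 + ((i * q + k) + degree ((of_int c - Z \<mu>) ^ l))"
        by (intro order_trans[OF degree_mult_le] add_mono degree_monom_le) (auto simp: of_int_poly)
      also have "\<dots> < D" unfolding D_def using 1 2 le(2) by linarith
      finally show "degree (case t of (i, k, l) \<Rightarrow> of_int (v (i, k, l)) *
          (monom 1 (i * q + k) * (of_int c - Z \<mu>) ^ l)) < D" by (simp add: ikl)
    qed
    then show ?thesis by (intro red_in_Low) (simp add: coeff_eq_0)
  qed
  have "D < b * K * p"
  proof -
    have "D + 2 * q + d * b = (b - 1) * q + 2 * q + K + ((p - 1) * (d * b) + d * b)"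
      by (simp add: D_def)
    also have "(b - 1) * q + 2 * q = b * q + q"
      using bpos by (cases b) auto
    also have "(p - 1) * (d * b) + d * b = d * q"
      unfolding q using p_gt_1 by (cases p) (auto simp: algebra_simps)
    also have "b * q + q + K + d * q = K * q + K" by (simp add: K_def algebra_simps)
    finally have eq: "D + 2 * q + d * b = K * q + K" .
    have "b \<le> q" unfolding q using p_gt_1 by simp
    moreover have "d + 1 \<le> q" using d pq by simp
    moreover have "d * b > 0" using d bpos by simp
    ultimately have "K < 2 * q + d * b" unfolding K_def by linarith
    then have "D < K * q" using eq by linarith
    then show ?thesis by (simp add: q algebra_simps)
  qed
  \<comment> \<open>Pigeonhole: p^(b K p) choices of coefficients have at most p^D reduced values of
    \<open>W\<close>, so two of them collide, and their difference \<open>w\<close> is a solution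
    that is nonzero modulo p.\<close>
  then have "card (Low D) < card V"
    using p_gt_1 card_Low[of D] finT
    by (simp add: V_def card_PiE T_def card_cartesian_product mult.assoc)
  then have "\<not> inj_on (\<lambda>v. red (W v)) V"
    using W_Low card_Low[of D] card_inj_on_le[of "\<lambda>v. red (W v)" V "Low D"] by fastforce
  then obtain v v' where v: "v \<in> V" "v' \<in> V" "v \<noteq> v'" "red (W v) = red (W v')"
    by (auto simp: inj_on_def)
  define w where "w t = v t - v' t" for t
  have "W w = W v - W v'"
    unfolding W_def w_def sum_subtractf[symmetric]
    by (rule sum.cong) (auto simp: algebra_simps)
  then have W0: "dvdm 0 (W w)" using v(4) by (simp add: red_eq_iff)
  obtain t1 where "t1 \<in> T" "v t1 \<noteq> v' t1"
    using v(1-3) unfolding V_def by (metis PiE_ext)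
  moreover have "\<bar>w t1\<bar> < int p"
    using v(1,2) \<open>t1 \<in> T\<close> unfolding V_def w_def by (auto dest!: PiE_mem[of _ _ _ t1])
  ultimately have t1: "t1 \<in> T" "\<not> int p dvd w t1"
    using zdvd_not_zless[of "\<bar>w t1\<bar>" "int p"] by (auto simp: w_def)
  define e where "e = (\<lambda>(i, k, l). i + k * q + l * (d * b))"
  define B where "B = (\<lambda>(i, k, l). monom 1 (i + k * q) * Z \<mu> ^ l)"
  define \<Psi> where "\<Psi> = (\<Sum>t\<in>T. of_int (w t) * B t)"
  have Z0: "Z \<mu> \<noteq> 0" using leadZ by auto
  have degB: "degree (B t) = e t" for t
    using Z0 degZ by (auto simp: B_def e_def split_beta degree_mult_eq degree_power_eq degree_monom_eq)
  have leadB: "lead_coeff (B t) = lead_coeff (Z \<mu>) ^ snd (snd t)" for t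
    unfolding B_def split_beta lead_coeff_mult lead_coeff_power by (simp add: degree_monom_eq)
  \<comment> \<open>As q = p b and deg Z = d b, reduction modulo b recovers i; after division by b,
    reduction modulo p recovers l, because p does not divide d.\<close>
  have inj: "inj_on e T"
  proof (rule inj_onI, clarsimp simp: T_def e_def)
    fix i k l i' k' l'
    assume i: "i < b" "i' < b" and l: "l < p" "l' < p"
      and "i + k * q + l * (d * b) = i' + k' * q + l' * (d * b)"
    then have eq: "i + b * (k * p + l * d) = i' + b * (k' * p + l' * d)"
      by (simp add: q algebra_simps)
    then have "(i + b * (k * p + l * d)) mod b = (i' + b * (k' * p + l' * d)) mod b" by simp
    then have ii: "i = i'" using i by simp
    with eq bpos have eq2: "k * p + l * d = k' * p + l' * d" by simp
    then have "int p dvd (int l - int l') * int d"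
      by (intro dvdI[of _ _ "int k' - int k"])
        (simp add: algebra_simps flip: of_nat_mult of_nat_add)
    moreover have "\<not> int p dvd int d"
      using d by (simp add: nat_dvd_not_less)
    ultimately have "int p dvd int l - int l'"
      using prime_p by (simp add: prime_dvd_mult_iff)
    then have "int l mod int p = int l' mod int p" by (simp add: mod_eq_dvd_iff)
    then have "l = l'" using l by simp
    with eq2 p_gt_1 ii show "i = i' \<and> k = k' \<and> l = l'" by simp
  qed
  have "\<not> dvdm 0 \<Psi>"
  proof -
    \<comment> \<open>Terms whose coefficient is divisible by p disappear. Among the remaining ones
      the degrees \<open>e t\<close> are distinct, so the leading term of the largest degree has
      nothing to cancel against.\<close>
    define T' where "T' = {t \<in> T. \<not> int p dvd w t}"
    have finT': "finite (e ` T')" using finT by (simp add: T'_def)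
    have "T' \<noteq> {}" using t1 unfolding T'_def by blast
    then have "Max (e ` T') \<in> e ` T'" using finT' by (intro Max_in) auto
    then obtain t0 where t0_in: "t0 \<in> T'" and t0_eq: "Max (e ` T') = e t0" by (rule imageE)
    have t0_max: "e t \<le> e t0" if "t \<in> T'" for t
      unfolding t0_eq[symmetric] using finT' that by (intro Max_ge) auto
    note t0 = t0_in t0_max

    have "int p dvd coeff (of_int (w t) * B t) (e t0)" if t: "t \<in> T - {t0}" for t
    proof (cases "t \<in> T'")
      case True
      have "e t \<noteq> e t0" using inj t t0(1) by (auto simp: inj_on_def T'_def)
      then have "e t < e t0" using t0(2)[OF True] by simp
      then show ?thesis by (simp add: of_int_poly coeff_eq_0 degB)
    next
      case False
      then have "int p dvd w t" using t by (simp add: T'_def)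
      then show ?thesis by (simp add: of_int_poly)
    qed
    then have "int p dvd (\<Sum>t\<in>T - {t0}. coeff (of_int (w t) * B t) (e t0))"
      by (rule dvd_sum)
    moreover have "coeff \<Psi> (e t0) = coeff (of_int (w t0) * B t0) (e t0)
        + (\<Sum>t\<in>T - {t0}. coeff (of_int (w t) * B t) (e t0))"
      unfolding \<Psi>_def coeff_sum using finT t0(1) by (intro sum.remove) (auto simp: T'_def)
    moreover have "coeff (of_int (w t0) * B t0) (e t0) = w t0 * lead_coeff (Z \<mu>) ^ snd (snd t0)"
      using leadB[of t0] degB[of t0] by (simp add: of_int_poly)
    moreover have "\<not> int p dvd w t0 * lead_coeff (Z \<mu>) ^ snd (snd t0)"
      using t0(1) leadZ prime_p prime_dvd_power[of "int p" "lead_coeff (Z \<mu>)"]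
      by (auto simp: T'_def prime_dvd_mult_iff)
    ultimately have "\<not> int p dvd coeff \<Psi> (e t0)"
      by (simp add: dvd_add_left_iff)
    then show ?thesis by (auto simp: dvdm_zero_iff)
  qed
  moreover have "dvdm P \<Psi>" if P: "P \<in> {P \<in> Irr (2 * \<mu>). int p dvd tr P - c}" for P
  proof -
    interpret P: prime_ideal_pred "dvdm P" using P by (intro prime_Irr) auto
    have Q: "dvdm P (monom 1 (q * q) - monom 1 1)"
      using Irr_fermat[of P "2 * \<mu>" "monom 1 1"] P
      by (simp add: monom_power q_def mult_2 power_add)
    have Zq: "dvdm P (Z \<mu> ^ q - (of_int c - Z \<mu>))"
      unfolding q_def using P by (intro Z_trace) auto
    have "dvdm P (\<Psi> ^ q - (\<Sum>t\<in>T. (of_int (w t) * B t) ^ q))"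
      unfolding \<Psi>_def q_def by (rule m.frobenius_sum[OF prime_p dvdm_p])
    moreover have "dvdm P ((\<Sum>t\<in>T. (of_int (w t) * B t) ^ q) - W w)"
      unfolding W_def
    proof (rule m.cong_sum)
      fix t assume "t \<in> T"
      obtain i k l where t: "t = (i, k, l)" by (cases t)
      have B': "(B t) ^ q = monom 1 (i * q) * monom 1 (q * q) ^ k * (Z \<mu> ^ q) ^ l"
        unfolding B_def t
        by (simp add: power_mult_distrib monom_power mult_monom algebra_simps flip: power_mult)
      have "dvdm P ((of_int (w t)) ^ q * (monom 1 (i * q) * monom 1 (q * q) ^ k * (Z \<mu> ^ q) ^ l)
          - of_int (w t) * (monom 1 (i * q) * monom 1 1 ^ k * (of_int c - Z \<mu>) ^ l))"
        using Q Zq m.fermat_of_int[OF prime_p dvdm_p, of P "w t" \<mu>]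
        by (intro m.cong_mult m.cong_power) (auto simp: m.zero q_def)
      moreover have "monom 1 (i * q) * monom 1 1 ^ k = (monom 1 (i * q + k) :: int poly)"
        by (simp add: monom_power mult_monom)
      ultimately show "dvdm P ((of_int (w t) * B t) ^ q
          - (case t of (i, k, l) \<Rightarrow> of_int (w (i, k, l)) * (monom 1 (i * q + k) * (of_int c - Z \<mu>) ^ l)))"
        by (simp only: power_mult_distrib[of "of_int (w t)"] B') (simp add: t)
    qed
    ultimately have "dvdm P (\<Psi> ^ q - W w)" by (rule m.cong_trans)
    then have "dvdm P (\<Psi> ^ q)"
      using m.cong_iff dvdm_zeroD[OF W0] by blast
    then show ?thesis by (rule P.prime_power)
  qed
  ultimately have "2 * \<mu> * card {P \<in> Irr (2 * \<mu>). int p dvd tr P - c} \<le> degree \<Psi>"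
    by (intro Irr_divisors_card_le) auto
  also have "degree \<Psi> \<le> b + (b + d) * q + d * q"
    unfolding \<Psi>_def
  proof (rule degree_sum_le[OF finT])
    fix t assume t: "t \<in> T"
    obtain i k l where ikl: "t = (i, k, l)" by (cases t)
    have "i \<le> b" "k \<le> b + d" "l \<le> p" using t by (auto simp: T_def ikl K_def)
    then have "i \<le> b" "k * q \<le> (b + d) * q" "l * (d * b) \<le> p * (d * b)"
      by (auto intro: mult_le_mono1)
    moreover have "p * (d * b) = d * q" by (simp add: q)
    ultimately have "i + k * q + l * (d * b) \<le> b + (b + d) * q + d * q"
      by linarith
    then have "e t \<le> b + (b + d) * q + d * q"
      by (simp add: e_def ikl)
    moreover have "degree (of_int (w t) * B t) \<le> 0 + e t"
      by (intro order_trans[OF degree_mult_le] add_mono) (auto simp: of_int_poly degB)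
    ultimately show "degree (of_int (w t) * B t) \<le> b + (b + d) * q + d * q" by simp
  qed
  also have "\<dots> \<le> b * q + (2 * d + 1) * q"
    using p_gt_1 by (simp add: q algebra_simps)
  also have "b * q = p ^ (2 * \<mu> - 1)"
    using assms by (simp add: b_def q_def mult_2 flip: power_add)
  finally show ?thesis by (simp add: q_def)
qed

end

section \<open>The L-function of a character\<close>

definition e_mod :: "nat \<Rightarrow> int \<Rightarrow> complex"
  where "e_mod n a = cis (2 * pi * (real_of_int a / real n))"

lemma e_mod_0 [simp]: "e_mod n 0 = 1"
  by (simp add: e_mod_def)

lemma norm_e_mod [simp]: "norm (e_mod n a) = 1"
  by (simp add: e_mod_def)

lemma e_mod_add: "e_mod n (a + b) = e_mod n a * e_mod n b"
  by (simp add: e_mod_def cis_mult add_divide_distrib distrib_left)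

lemma e_mod_sum: "e_mod n (\<Sum>x\<in>A. f x) = (\<Prod>x\<in>A. e_mod n (f x))"
  by (induction A rule: infinite_finite_induct) (auto simp: e_mod_add)

lemma e_mod_power: "e_mod n a ^ k = e_mod n (int k * a)"
  by (simp add: e_mod_def DeMoivre field_simps)

lemma e_mod_eq_1_iff:
  assumes "n > 0"
  shows "e_mod n a = 1 \<longleftrightarrow> int n dvd a"
proof
  assume "e_mod n a = 1"
  then have "cos (2 * pi * (real_of_int a / real n)) = 1"
    unfolding e_mod_def by (metis cis.sel(1) one_complex.sel(1))
  then obtain k :: int where "2 * pi * (real_of_int a / real n) = real_of_int k * 2 * pi"
    by (auto simp: cos_one_2pi_int)
  then have "real_of_int a = real_of_int (k * int n)"
    using assms by (simp add: field_simps)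
  then have "a = k * int n" by (simp only: of_int_eq_iff)
  then show "int n dvd a" by simp
next
  assume "int n dvd a"
  then obtain k where "a = int n * k" by blast
  then have "e_mod n a = cis (2 * pi * real_of_int k)"
    using assms by (simp add: e_mod_def)
  then show "e_mod n a = 1" by (simp add: cis_multiple_2pi)
qed

lemma e_mod_cong:
  assumes "n > 0" "int n dvd a - b"
  shows "e_mod n a = e_mod n b"
  using e_mod_add[of n "a - b" b] e_mod_eq_1_iff[OF assms(1), of "a - b"] assms(2) by simp

lemma sum_e_mod:
  assumes "n > 0"
  shows "(\<Sum>x\<in>{0..<int n}. e_mod n (a * x)) = (if int n dvd a then of_nat n else 0)"
proof (cases "int n dvd a")
  case True
  then have "e_mod n (a * x) = 1" for x
    using e_mod_eq_1_iff[OF assms] by simp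
  then show ?thesis using True by simp
next
  case False
  then have ne: "e_mod n a \<noteq> 1" using e_mod_eq_1_iff[OF assms] by simp
  have "(\<Sum>x\<in>{0..<int n}. e_mod n (a * x)) = (\<Sum>k<n. e_mod n a ^ k)"
    by (rule sum.reindex_bij_witness[of _ int nat]) (auto simp: e_mod_power mult.commute)
  also have "\<dots> = (e_mod n a ^ n - 1) / (e_mod n a - 1)"
    using ne by (rule geometric_sum)
  also have "e_mod n a ^ n = 1"
    unfolding e_mod_power using e_mod_eq_1_iff[OF assms] by simp
  finally show ?thesis using False by simp
qed

text \<open>Combining the power sums with the coefficients of a polynomial that vanishes at all other values isolates a single $z_n^k$.\<close>
lemma bounded_power_sums_imp_norm_le_1:
  fixes z :: "nat \<Rightarrow> complex"
  assumes bound: "\<And>k. k > 0 \<Longrightarrow> norm (\<Sum>i<N. z i ^ k) \<le> C" and n: "n < N"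
  shows "norm (z n) \<le> 1"
proof (rule ccontr)
  assume gt: "\<not> norm (z n) \<le> 1"
  define A where "A = z ` {..<N} - {z n}"
  define Q where "Q = (\<Prod>a\<in>A. [:- a, 1:])"
  define c where "c = (\<Sum>i | i < N \<and> z i = z n. 1 :: complex) * poly Q (z n)"
  define M where "M = (\<Sum>t\<le>degree Q. norm (coeff Q t) * C)"
  have finA: "finite A" by (simp add: A_def)
  have "poly Q (z n) \<noteq> 0"
    using finA by (auto simp: Q_def poly_prod A_def)
  moreover have "{i. i < N \<and> z i = z n} \<noteq> {}" using n by auto
  ultimately have c: "c \<noteq> 0" by (simp add: c_def)
  have le: "norm c * norm (z n) ^ k \<le> M" if k: "k > 0" for k
  proof -
    have root: "poly Q (z i) = 0" if "i < N" "z i \<noteq> z n" for i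
      using that finA by (auto simp: Q_def poly_prod A_def)
    have "(\<Sum>t\<le>degree Q. coeff Q t * (\<Sum>i<N. z i ^ (k + t))) = (\<Sum>i<N. z i ^ k * poly Q (z i))"
      unfolding poly_altdef sum_distrib_left by (subst sum.swap) (simp add: power_add ac_simps)
    also have "\<dots> = (\<Sum>i | i < N \<and> z i = z n. z i ^ k * poly Q (z i))"
      using root by (intro sum.mono_neutral_right) auto
    also have "\<dots> = c * z n ^ k"
      by (simp add: c_def)
    finally have "norm (c * z n ^ k) = norm (\<Sum>t\<le>degree Q. coeff Q t * (\<Sum>i<N. z i ^ (k + t)))"
      by simp
    also have "\<dots> \<le> M"
      unfolding M_def using k by (intro sum_norm_le) (auto simp: norm_mult intro!: mult_left_mono bound)
    finally show ?thesis by (simp add: norm_mult norm_power)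
  qed
  obtain k where k: "M / norm c < norm (z n) ^ k"
    using real_arch_pow[of "norm (z n)"] gt by auto
  also have "\<dots> \<le> norm (z n) ^ Suc k"
    using gt by (intro power_increasing) auto
  finally have "M < norm c * norm (z n) ^ Suc k"
    using c by (simp add: field_simps)
  then show False using le[of "Suc k"] by simp
qed

section \<open>Characters of monic polynomials and their L-functions\<close>

context prime_modulus
begin

lemma red_monic: "lead_coeff g = 1 \<Longrightarrow> red g \<in> Mon (degree g)"
  by (rule red_in_Mon) (auto simp: coeff_eq_0)

end

locale monic_character = prime_modulus +
  fixes \<chi> :: "int poly \<Rightarrow> complex"
  assumes \<chi>_mult: "lead_coeff g = 1 \<Longrightarrow> lead_coeff h = 1 \<Longrightarrow> \<chi> (g * h) = \<chi> g * \<chi> h"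
    and \<chi>_cong: "lead_coeff g = 1 \<Longrightarrow> lead_coeff h = 1 \<Longrightarrow> degree g = degree h
      \<Longrightarrow> dvdm 0 (g - h) \<Longrightarrow> \<chi> g = \<chi> h"
    and \<chi>_norm: "norm (\<chi> g) = 1"
begin

lemma \<chi>_one: "\<chi> 1 = 1"
  using \<chi>_mult[of 1 1] \<chi>_norm[of 1] by auto

lemma \<chi>_power: "lead_coeff g = 1 \<Longrightarrow> \<chi> (g ^ n) = \<chi> g ^ n"
  by (induction n) (simp_all add: \<chi>_one \<chi>_mult lead_coeff_power)

lemma \<chi>_red: "lead_coeff g = 1 \<Longrightarrow> \<chi> (red g) = \<chi> g"
  using red_monic[of g] by (intro \<chi>_cong red_cong) (auto simp: Mon_def)

text \<open>The coefficient of index n of the L-function of \<open>\<chi>\<close>.\<close>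

definition \<sigma> :: "nat \<Rightarrow> complex"
  where "\<sigma> n = (\<Sum>g\<in>Mon n. \<chi> g)"

text \<open>
  Grouping the elements of the field with $p^r$ elements by their minimal polynomials, \<open>S r\<close> is the
  complete character sum over that field.
\<close>
definition S :: "nat \<Rightarrow> complex"
  where "S r = (\<Sum>P\<in>Irrs r. \<Sum>j\<in>{1..r}. if j * degree P = r then of_nat (degree P) * \<chi> P ^ j else 0)"

lemma \<sigma>_0: "\<sigma> 0 = 1"
  by (simp add: \<sigma>_def Mon_0 \<chi>_one)

lemma S_0: "S 0 = 0"
  by (simp add: S_def Irrs_def)

lemma IrrsD:
  assumes "P \<in> Irrs M"
  shows "P \<in> Irr (degree P)" "0 < degree P" "degree P \<le> M"
  using assms by (auto simp: Irrs_def IrrD)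

lemma Irr_in_Irrs: "P \<in> Irr k \<Longrightarrow> k \<le> M \<Longrightarrow> P \<in> Irrs M"
  unfolding Irrs_def using IrrD(2)[of P k] by (intro UN_I[of k]) auto

lemma Irrs_mono: "k \<le> M \<Longrightarrow> Irrs k \<subseteq> Irrs M"
  unfolding Irrs_def by (intro UN_mono) auto

text \<open>A common index range M for all r lets the sums in \<open>\<sigma>_recurrence\<close> be
  interchanged; the additional pairs have \<open>j * degree P > r\<close>.\<close>

lemma S_eq:
  assumes "r \<le> M" "0 < r"
  shows "S r = (\<Sum>P\<in>Irrs M. \<Sum>j\<in>{1..M}. if j * degree P = r then of_nat (degree P) * \<chi> P ^ j else 0)"
    (is "_ = (\<Sum>P\<in>_. \<Sum>j\<in>_. ?f P j)")
proof -
  have "S r = (\<Sum>P\<in>Irrs M. \<Sum>j\<in>{1..r}. ?f P j)"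
    unfolding S_def
  proof (rule sum.mono_neutral_left)
    show "Irrs r \<subseteq> Irrs M" using assms(1) by (rule Irrs_mono)
    show "\<forall>P\<in>Irrs M - Irrs r. (\<Sum>j\<in>{1..r}. ?f P j) = 0"
    proof
      fix P assume P: "P \<in> Irrs M - Irrs r"
      then have *: "P \<in> Irr (degree P)" "0 < degree P" using IrrsD[of P M] by auto
      have "degree P > r"
        using P Irr_in_Irrs[OF *(1), of r] by (cases "degree P > r") auto
      then have "?f P j = 0" if "j \<in> {1..r}" for j
        using that by (auto simp: mult_eq_if)
      then show "(\<Sum>j\<in>{1..r}. ?f P j) = 0" by (intro sum.neutral) blast
    qed
  qed (rule finite_Irrs)
  also have "\<dots> = (\<Sum>P\<in>Irrs M. \<Sum>j\<in>{1..M}. ?f P j)"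
  proof (intro sum.cong[OF refl] sum.mono_neutral_left)
    fix P assume P: "P \<in> Irrs M"
    show "\<forall>j\<in>{1..M} - {1..r}. ?f P j = 0"
    proof
      fix j assume "j \<in> {1..M} - {1..r}"
      then have "j > r" by auto
      moreover have "j * 1 \<le> j * degree P"
        using IrrsD[OF P] by (intro mult_le_mono2) auto
      ultimately show "?f P j = 0" by auto
    qed
  qed (use assms(1) in auto)
  finally show ?thesis .
qed

text \<open>Multiplication by \<open>P ^ j\<close>, followed by reduction, maps the monic
  polynomials of degree n - j k bijectively onto the multiples of \<open>P ^ j\<close>.\<close>

lemma sum_\<chi>_multiples:
  assumes P: "P \<in> Irr k"
  shows "(\<Sum>g\<in>{g \<in> Mon n. dvdm (P ^ j) g}. \<chi> g) = (if j * k \<le> n then \<chi> P ^ j * \<sigma> (n - j * k) else 0)"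
proof (cases "j * k \<le> n")
  case False
  then have "{g \<in> Mon n. dvdm (P ^ j) g} = {}"
    using Irr_power_dvdm_degree[OF P] by auto
  then show ?thesis using False by (metis (no_types, lifting) sum.empty)
next
  case True
  note PD = IrrD[OF P]
  define Q where "Q = red (P ^ j)"
  have lP: "lead_coeff (P ^ j) = 1" using PD by (simp add: lead_coeff_power)
  moreover have "P \<noteq> 0" using PD by auto
  ultimately have Q: "Q \<in> Mon (j * k)"
    using red_monic[of "P ^ j"] PD by (simp add: Q_def degree_power_eq)
  have dvd: "dvdm (P ^ j) g \<longleftrightarrow> dvdm Q g" for g
    unfolding Q_def by (rule dvdm_cong[OF red_cong(2)])
  have \<chi>Q: "\<chi> Q = \<chi> P ^ j" using \<chi>_red[OF lP] \<chi>_power PD by (simp add: Q_def)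
  have QM: "red (Q * h) \<in> Mon n" "\<chi> (red (Q * h)) = \<chi> P ^ j * \<chi> h" if "h \<in> Mon (n - j * k)" for h
  proof -
    show "red (Q * h) \<in> Mon n" using red_mult_Mon[OF Q that] True by simp
    have "lead_coeff (Q * h) = 1"
      unfolding lead_coeff_mult MonD(2)[OF Q] MonD(2)[OF that] by simp
    then show "\<chi> (red (Q * h)) = \<chi> P ^ j * \<chi> h"
      using \<chi>_red[of "Q * h"] \<chi>_mult[OF MonD(2)[OF Q] MonD(2)[OF that]] by (simp add: \<chi>Q)
  qed
  have "bij_betw (\<lambda>h. red (Q * h)) (Mon (n - j * k)) {g \<in> Mon n. dvdm (P ^ j) g}"
  proof (rule bij_betwI')
    fix h h' assume h: "h \<in> Mon (n - j * k)" "h' \<in> Mon (n - j * k)"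
    show "red (Q * h) = red (Q * h') \<longleftrightarrow> h = h'"
    proof
      assume "red (Q * h) = red (Q * h')"
      then have "dvdm 0 (Q * (h - h'))" by (simp add: red_eq_iff algebra_simps)
      then have "dvdm 0 (h - h')" using z.prime Mon_not_zero[OF Q] by blast
      then show "h = h'" using Red_eqI Mon_subset h by blast
    qed simp
  next
    fix h assume h: "h \<in> Mon (n - j * k)"
    have "dvdm Q (red (Q * h))"
      using m.cong_iff[OF dvdm_zeroD[OF red_cong(1)]] dvdm_self by blast
    then show "red (Q * h) \<in> {g \<in> Mon n. dvdm (P ^ j) g}"
      using QM h by (simp add: dvd)
  next
    fix g assume g: "g \<in> {g \<in> Mon n. dvdm (P ^ j) g}"
    then obtain h where h: "h \<in> Mon (n - j * k)" "dvdm 0 (g - Q * h)"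
      using monic_quotient[OF Q, of g n] by (auto simp: dvd)
    then have "red g = red (Q * h)" by (simp add: red_eq_iff)
    then have "g = red (Q * h)" using g red_eq Mon_subset by fastforce
    then show "\<exists>h\<in>Mon (n - j * k). g = red (Q * h)" using h by blast
  qed
  then have "(\<Sum>g\<in>{g \<in> Mon n. dvdm (P ^ j) g}. \<chi> g) = (\<Sum>h\<in>Mon (n - j * k). \<chi> (red (Q * h)))"
    by (rule sum.reindex_bij_betw[symmetric])
  also have "\<dots> = (\<Sum>h\<in>Mon (n - j * k). \<chi> P ^ j * \<chi> h)"
    using QM by (intro sum.cong) auto
  finally show ?thesis using True by (simp add: \<sigma>_def sum_distrib_left)
qed

text \<open>The logarithmic derivative of the Euler product, obtained without the product: n = deg g
  is the sum of deg P over all pairs (P, j) with P^j dividing g, and for each pair the multiples of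
  P^j are summed first.\<close>

theorem \<sigma>_recurrence: "of_nat n * \<sigma> n = (\<Sum>r=1..n. S r * \<sigma> (n - r))"
proof -
  let ?t = "\<lambda>P j r. if j * degree P = r then of_nat (degree P) * \<chi> P ^ j else 0"
  have card: "(of_nat (card {j \<in> {1..n}. Q j}) :: complex) = (\<Sum>j\<in>{1..n}. if Q j then 1 else 0)" for Q
    by (simp add: sum.If_cases Int_def)
  have "of_nat n * \<sigma> n = (\<Sum>g\<in>Mon n. \<chi> g * of_nat n)"
    by (simp add: \<sigma>_def sum_distrib_left mult.commute)
  also have "\<dots> = (\<Sum>g\<in>Mon n. \<chi> g *
      of_nat (\<Sum>P\<in>Irrs n. degree P * card {j \<in> {1..n}. dvdm (P ^ j) g}))"
    by (intro sum.cong refl) (subst degree_eq_sum_Irr, auto)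
  also have "\<dots> = (\<Sum>g\<in>Mon n. \<Sum>P\<in>Irrs n. \<Sum>j\<in>{1..n}.
      of_nat (degree P) * (if dvdm (P ^ j) g then \<chi> g else 0))"
    unfolding of_nat_sum of_nat_mult card sum_distrib_left
    by (intro sum.cong refl) auto
  also have "\<dots> = (\<Sum>P\<in>Irrs n. \<Sum>j\<in>{1..n}. \<Sum>g\<in>Mon n.
      of_nat (degree P) * (if dvdm (P ^ j) g then \<chi> g else 0))"
    by (subst sum.swap, intro sum.cong refl, subst sum.swap) simp
  also have "\<dots> = (\<Sum>P\<in>Irrs n. \<Sum>j\<in>{1..n}. \<Sum>r=1..n. ?t P j r * \<sigma> (n - r))"
  proof (intro sum.cong refl)
    fix P j assume P: "P \<in> Irrs n" and j: "j \<in> {1..n}"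
    have "(\<Sum>g\<in>Mon n. of_nat (degree P) * (if dvdm (P ^ j) g then \<chi> g else 0))
        = of_nat (degree P) * (\<Sum>g\<in>{g \<in> Mon n. dvdm (P ^ j) g}. \<chi> g)"
      by (simp add: sum_distrib_left sum.inter_filter[OF finite_Mon])
    also have "\<dots> = (if j * degree P \<le> n then of_nat (degree P) * \<chi> P ^ j * \<sigma> (n - j * degree P) else 0)"
      by (subst sum_\<chi>_multiples[OF IrrsD(1)[OF P]]) simp
    also have "\<dots> = (\<Sum>r=1..n. if r = j * degree P then of_nat (degree P) * \<chi> P ^ j * \<sigma> (n - r) else 0)"
      using j IrrsD(2)[OF P] by (subst sum.delta) auto
    also have "\<dots> = (\<Sum>r=1..n. ?t P j r * \<sigma> (n - r))"
      by (intro sum.cong refl) auto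
    finally show "(\<Sum>g\<in>Mon n. of_nat (degree P) * (if dvdm (P ^ j) g then \<chi> g else 0))
        = (\<Sum>r=1..n. ?t P j r * \<sigma> (n - r))" .
  qed
  also have "\<dots> = (\<Sum>r=1..n. \<Sum>P\<in>Irrs n. \<Sum>j\<in>{1..n}. ?t P j r * \<sigma> (n - r))"
    by (subst (2) sum.swap, subst sum.swap, rule refl)
  also have "\<dots> = (\<Sum>r=1..n. S r * \<sigma> (n - r))"
    unfolding sum_distrib_right[symmetric]
    by (intro sum.cong refl arg_cong2[where f = "(*)"] S_eq[symmetric]) auto
  finally show ?thesis .
qed

lemma S_1: "S 1 = (\<Sum>P\<in>Mon 1. \<chi> P)"
proof -
  have "Irrs 1 = Mon 1" using Irr_1 by (simp add: Irrs_def)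
  then show ?thesis by (simp add: S_def MonD)
qed

text \<open>The L-function is now a polynomial of degree below d with constant term 1, hence a
  product of factors 1 - z_i X. The recurrence says that - S solves Newton's identity for it, and
  that solution is unique.\<close>

lemma S_power_sums:
  assumes vanish: "\<And>n. n \<ge> d \<Longrightarrow> \<sigma> n = 0" and d: "d > 0"
  obtains N z where "N < d" "\<And>r. r > 0 \<Longrightarrow> S r = - (\<Sum>i<N. z i ^ r)"
proof -
  define L where "L = (\<Sum>n<d. monom (\<sigma> n) n)"
  have coeff_L: "coeff L n = \<sigma> n" for n
    using vanish[of n] by (simp add: L_def coeff_sum)
  have nz: "coeff L 0 \<noteq> 0" by (simp add: coeff_L \<sigma>_0)
  let ?Q = "reflect_poly L"
  have lead: "lead_coeff ?Q = 1"
    using nz by (simp add: coeff_L \<sigma>_0 coeff_reflect_poly degree_reflect_poly_eq)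
  obtain z where "smult (lead_coeff ?Q) (\<Prod>i<degree ?Q. [:- z i, 1:]) = ?Q"
    by (rule complex_poly_decompose')
  then have z: "(\<Prod>i<degree ?Q. [:- z i, 1:]) = ?Q"
    by (simp only: lead smult_1_left)
  have "newton (fps_of_poly (reflect_poly (\<Prod>i<degree ?Q. [:- z i, 1:])))
    (\<Sum>i<degree ?Q. Abs_fps (\<lambda>j. if j = 0 then 0 else z i ^ j))"
    by (rule newton_reflect_prod) simp
  then have 1: "newton (fps_of_poly L) (\<Sum>i<degree ?Q. Abs_fps (\<lambda>j. if j = 0 then 0 else z i ^ j))"
    using nz unfolding z by simp
  have 2: "newton (fps_of_poly L) (Abs_fps (\<lambda>r. - S r))"
    unfolding newton_iff
  proof
    fix n
    have "(fps_of_poly L * Abs_fps (\<lambda>r. - S r)) $ n = (Abs_fps (\<lambda>r. - S r) * fps_of_poly L) $ n"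
      by (simp add: mult.commute)
    also have "\<dots> = - (\<Sum>r=0..n. S r * \<sigma> (n - r))"
      by (simp add: fps_mult_nth coeff_L sum_negf)
    also have "(\<Sum>r=0..n. S r * \<sigma> (n - r)) = (\<Sum>r=1..n. S r * \<sigma> (n - r))"
      by (subst sum.atLeast_Suc_atMost) (auto simp: S_0)
    finally show "- (of_nat n * fps_of_poly L $ n) = (fps_of_poly L * Abs_fps (\<lambda>r. - S r)) $ n"
      by (simp add: coeff_L \<sigma>_recurrence)
  qed
  have "Abs_fps (\<lambda>r. - S r) = (\<Sum>i<degree ?Q. Abs_fps (\<lambda>j. if j = 0 then 0 else z i ^ j))"
    by (rule newton_unique[OF 2 1]) (simp add: coeff_L \<sigma>_0)
  then have eq: "- S r = (\<Sum>i<degree ?Q. Abs_fps (\<lambda>j. if j = 0 then 0 else z i ^ j)) $ r" for r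
    by (metis fps_nth_Abs_fps)
  have "S r = - (\<Sum>i<degree ?Q. z i ^ r)" if "r > 0" for r
    using eq[THEN minus_equation_iff[THEN iffD1], of r] that by (simp add: fps_sum_nth)
  moreover have "degree L < d"
    unfolding L_def using d by (intro degree_sum_less) (auto intro: le_less_trans[OF degree_monom_le])
  then have "degree ?Q < d" using degree_reflect_poly_le[of L] by simp
  ultimately show ?thesis using that by blast
qed

end

section \<open>The number of irreducible polynomials, from the trivial character\<close>

context prime_modulus
begin

lemma trivial_character: "monic_character p (\<lambda>_. 1)"
  by unfold_locales auto

interpretation one: monic_character p "\<lambda>_. 1"
  by (rule trivial_character)

text \<open>With p^k inserted for the smaller indices, the recurrence becomes r p^r = (r - 1) p^r +
  S r.\<close>

lemma trivial_S: "r > 0 \<Longrightarrow> one.S r = of_nat (p ^ r)"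
proof (induction r rule: less_induct)
  case (less r)
  have \<sigma>: "one.\<sigma> n = of_nat (p ^ n)" for n
    by (simp add: one.\<sigma>_def card_Mon)
  have "of_nat r * of_nat (p ^ r) = (\<Sum>k=1..r. one.S k * of_nat (p ^ (r - k)))"
    using one.\<sigma>_recurrence[of r] by (simp add: \<sigma>)
  also have "\<dots> = (\<Sum>k=1..<r. one.S k * of_nat (p ^ (r - k))) + one.S r"
    using less.prems sum.last_plus[of 1 r "\<lambda>k. one.S k * of_nat (p ^ (r - k))"]
    by (simp add: atLeastLessThanSuc_atLeastAtMost[symmetric])
  also have "(\<Sum>k=1..<r. one.S k * of_nat (p ^ (r - k))) = (\<Sum>k=1..<r. of_nat (p ^ r))"
    using less.IH by (intro sum.cong refl) (simp flip: power_add)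
  also have "\<dots> = of_nat (r - 1) * of_nat (p ^ r)" by simp
  finally show ?case using less.prems by (cases r) (simp_all add: algebra_simps)
qed

text \<open>The field with p^r elements counted by degree: r times \<open>card (Irr r)\<close>
  elements have degree r, and the double sum counts those in proper subfields.\<close>

lemma sum_degree_Irr:
  assumes "r > 0"
  shows "r * card (Irr r) + (\<Sum>P\<in>Irrs r. \<Sum>j\<in>{2..r}. if j * degree P = r then degree P else 0) = p ^ r"
proof -
  have "(of_nat (p ^ r) :: complex) = of_nat (\<Sum>P\<in>Irrs r. \<Sum>j\<in>{1..r}. if j * degree P = r then degree P else 0)"
    unfolding trivial_S[OF assms, symmetric] one.S_def of_nat_sum by (intro sum.cong refl) simp
  then have "p ^ r = (\<Sum>P\<in>Irrs r. \<Sum>j\<in>{1..r}. if j * degree P = r then degree P else 0)"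
    by (simp only: of_nat_eq_iff)
  also have "\<dots> = (\<Sum>P\<in>Irrs r. (if degree P = r then degree P else 0)
      + (\<Sum>j\<in>{2..r}. if j * degree P = r then degree P else 0))"
    using assms by (intro sum.cong refl) (simp add: sum.atLeast_Suc_atMost numeral_2_eq_2)
  also have "\<dots> = (\<Sum>P\<in>Irrs r. if degree P = r then degree P else 0)
      + (\<Sum>P\<in>Irrs r. \<Sum>j\<in>{2..r}. if j * degree P = r then degree P else 0)"
    by (rule sum.distrib)
  also have "(\<Sum>P\<in>Irrs r. if degree P = r then degree P else 0) = (\<Sum>P\<in>{P \<in> Irrs r. degree P = r}. degree P)"
    by (rule sum.inter_filter[OF finite_Irrs, symmetric])
  also have "{P \<in> Irrs r. degree P = r} = Irr r"
    using one.IrrsD one.Irr_in_Irrs[of _ r r] IrrD(3)[of _ r] by auto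
  also have "(\<Sum>P\<in>Irr r. degree P) = r * card (Irr r)"
    by (simp add: IrrD)
  finally show ?thesis by simp
qed

text \<open>From j >= 2 and \<open>j * degree P = 2 * \<mu>\<close> it follows that
  \<open>degree P \<le> \<mu>\<close>, and j is determined by \<open>P\<close>. Degree k contributes
  at most p^k, and the geometric sum is at most twice its last term.\<close>

lemma sum_proper_power_Irr_le:
  "(\<Sum>P\<in>Irrs (2 * \<mu>). \<Sum>j\<in>{2..2 * \<mu>}. if j * degree P = 2 * \<mu> then degree P else 0) \<le> 2 * p ^ \<mu>"
proof -
  let ?g = "\<lambda>P. \<Sum>j\<in>{2..2 * \<mu>}. if j * degree P = 2 * \<mu> then degree P else 0"
  have "(\<Sum>P\<in>Irrs (2 * \<mu>). ?g P) = (\<Sum>P\<in>Irrs \<mu>. ?g P)"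
  proof (rule sum.mono_neutral_right[OF finite_Irrs])
    show "Irrs \<mu> \<subseteq> Irrs (2 * \<mu>)" by (rule one.Irrs_mono) simp
    show "\<forall>P\<in>Irrs (2 * \<mu>) - Irrs \<mu>. ?g P = 0"
    proof
      fix P assume P: "P \<in> Irrs (2 * \<mu>) - Irrs \<mu>"
      then have *: "P \<in> Irr (degree P)" "0 < degree P" using one.IrrsD[of P "2 * \<mu>"] by auto
      have "degree P > \<mu>"
        using P one.Irr_in_Irrs[OF *(1), of \<mu>] by (cases "degree P > \<mu>") auto
      then have "j * degree P \<noteq> 2 * \<mu>" if "j \<ge> 2" for j
        using mult_le_mono1[OF that, of "degree P"] by linarith
      then show "?g P = 0" by simp
    qed
  qed
  also have "\<dots> \<le> (\<Sum>P\<in>Irrs \<mu>. degree P)"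
  proof (rule sum_mono)
    fix P assume "P \<in> Irrs \<mu>"
    then have "degree P > 0" using one.IrrsD by blast
    show "?g P \<le> degree P"
    proof (cases "\<exists>j. j * degree P = 2 * \<mu>")
      case True
      then obtain j0 where j0: "2 * \<mu> = j0 * degree P" by metis
      have "?g P = (\<Sum>j\<in>{2..2 * \<mu>}. if j = j0 then degree P else 0)"
        using \<open>degree P > 0\<close> unfolding j0 by (intro sum.cong refl) simp
      then show ?thesis by simp
    qed simp
  qed
  also have "\<dots> = (\<Sum>k\<in>{1..\<mu>}. \<Sum>P\<in>Irr k. degree P)"
    unfolding Irrs_def using IrrD(3) by (intro sum.UNION_disjoint) (auto simp: finite_Irr)
  also have "\<dots> \<le> (\<Sum>k\<in>{1..\<mu>}. p ^ k)"
  proof (rule sum_mono)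
    fix k assume "k \<in> {1..\<mu>}"
    then have "k * card (Irr k) \<le> p ^ k" using sum_degree_Irr[of k] by simp
    then show "(\<Sum>P\<in>Irr k. degree P) \<le> p ^ k" by (simp add: IrrD mult.commute)
  qed
  also have "\<dots> \<le> 2 * p ^ \<mu>"
  proof (induction \<mu>)
    case (Suc n)
    have "2 * p ^ n \<le> p * p ^ n" using p_gt_1 by (intro mult_le_mono1) auto
    moreover have "(\<Sum>k\<in>{1..Suc n}. p ^ k) = (\<Sum>k\<in>{1..n}. p ^ k) + p * p ^ n" by simp
    ultimately show ?case using Suc unfolding power_Suc by linarith
  qed simp
  finally show ?thesis .
qed

end

section \<open>The bound of Weil\<close>

lemma dvd_poly_diff:
  fixes f :: "'a::comm_ring_1 poly"
  assumes "n dvd x - y"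
  shows "n dvd poly f x - poly f y"
proof (induction f)
  case (pCons a f)
  have "x * poly f x - y * poly f y = (x - y) * poly f x + y * (poly f x - poly f y)"
    by (simp add: algebra_simps)
  then show ?case using assms pCons by simp
qed simp

context monic_character
begin

text \<open>The terms with j >= 2 belong to elements of proper subfields. Each has modulus
  \<open>degree P\<close>, and \<open>sum_degree_Irr\<close> gives their total weight.\<close>

lemma norm_S_minus_Irr_le:
  assumes "r > 0"
  shows "norm (S r - of_nat r * (\<Sum>P\<in>Irr r. \<chi> P)) \<le> real (p ^ r) - real (r * card (Irr r))"
proof -
  let ?t = "\<lambda>P j. if j * degree P = r then of_nat (degree P) * \<chi> P ^ j else 0"
  let ?u = "\<lambda>P j. if j * degree P = r then degree P else 0"
  have "S r = (\<Sum>P\<in>Irrs r. (if degree P = r then of_nat (degree P) * \<chi> P else 0) + (\<Sum>j\<in>{2..r}. ?t P j))"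
    unfolding S_def using assms
    by (intro sum.cong refl) (simp add: sum.atLeast_Suc_atMost numeral_2_eq_2)
  also have "\<dots> = (\<Sum>P\<in>{P \<in> Irrs r. degree P = r}. of_nat (degree P) * \<chi> P)
      + (\<Sum>P\<in>Irrs r. \<Sum>j\<in>{2..r}. ?t P j)"
    by (simp only: sum.distrib sum.inter_filter[OF finite_Irrs])
  also have "{P \<in> Irrs r. degree P = r} = Irr r"
    using IrrsD Irr_in_Irrs[of _ r r] IrrD(3)[of _ r] by auto
  also have "(\<Sum>P\<in>Irr r. of_nat (degree P) * \<chi> P) = of_nat r * (\<Sum>P\<in>Irr r. \<chi> P)"
    by (simp add: sum_distrib_left IrrD)
  finally have "norm (S r - of_nat r * (\<Sum>P\<in>Irr r. \<chi> P)) = norm (\<Sum>P\<in>Irrs r. \<Sum>j\<in>{2..r}. ?t P j)"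
    by simp
  also have "\<dots> \<le> (\<Sum>P\<in>Irrs r. \<Sum>j\<in>{2..r}. real (?u P j))"
    by (intro sum_norm_le) (auto simp: norm_mult norm_power \<chi>_norm)
  also have "\<dots> = real (\<Sum>P\<in>Irrs r. \<Sum>j\<in>{2..r}. ?u P j)"
    by simp
  also have "\<dots> = real (p ^ r) - real (r * card (Irr r))"
    using sum_degree_Irr[OF assms] by linarith
  finally show ?thesis .
qed

end

context artin_schreier
begin

definition \<chi> :: "int poly \<Rightarrow> complex"
  where "\<chi> g = e_mod p (tr g)"

lemma tr_cong:
  assumes "\<And>j. 1 \<le> j \<Longrightarrow> j \<le> d \<Longrightarrow> int p dvd psum g $ j - psum h $ j"
  shows "int p dvd tr g - tr h"
  unfolding tr_def sum_subtractf[symmetric] right_diff_distrib[symmetric]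
  using assms by (intro dvd_sum dvd_mult) auto

lemma monic_character_\<chi>: "monic_character p \<chi>"
proof
  show "\<chi> (g * h) = \<chi> g * \<chi> h" if "lead_coeff g = 1" "lead_coeff h = 1" for g h
    unfolding \<chi>_def e_mod_add[symmetric]
    by (simp add: tr_def psum_mult[OF that] distrib_left sum.distrib)
  show "\<chi> g = \<chi> h" if "lead_coeff g = 1" "lead_coeff h = 1" "degree g = degree h" "dvdm 0 (g - h)" for g h
    unfolding \<chi>_def using p_gt_1 psum_cong[OF that] by (intro e_mod_cong tr_cong) auto
  show "norm (\<chi> g) = 1" for g by (simp add: \<chi>_def)
qed

sublocale monic_character p \<chi>
  by (rule monic_character_\<chi>)

text \<open>Reversal moves the added X^(n - d) to index d. By \<open>newton_shift\<close> the power
  sums below d are unchanged, and that of index d drops by d.\<close>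

lemma \<chi>_shift:
  assumes g: "g \<in> Mon n" and n: "n \<ge> d"
  shows "\<chi> (red (g + monom 1 (n - d))) = \<chi> g * e_mod p (- (int d * coeff f d))"
    and "red (g + monom 1 (n - d)) \<in> Mon n"
proof -
  let ?h = "g + monom 1 (n - d)"
  have deg: "degree ?h = n"
  proof (cases "n = 0")
    case False
    have "degree (monom 1 (n - d) :: int poly) < degree g"
      using False d n MonD(1)[OF g] by (simp add: degree_monom_eq)
    then show ?thesis using MonD(1)[OF g] by (simp add: degree_add_eq_left)
  qed (use d n in simp)
  have lead: "lead_coeff ?h = 1"
    using deg d n MonD(1,2)[OF g] by simp
  show "red ?h \<in> Mon n"
    using red_monic[OF lead] deg by simp
  have refl: "coeff (reflect_poly ?h) i = coeff (reflect_poly g) i + (if i = d then 1 else 0)" for i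
    using n by (auto simp: coeff_reflect_poly deg MonD(1)[OF g])
  have ps: "psum g $ i = psum ?h $ i" if "i < d" for i
    using that by (intro newton_shift(1)[OF newton_psum[OF MonD(2)[OF g]] newton_psum[OF lead], of d 1])
      (use MonD(2)[OF g] lead refl in auto)
  have pd: "psum ?h $ d = psum g $ d - int d * 1"
    using newton_shift(2)[OF newton_psum[OF MonD(2)[OF g]] newton_psum[OF lead], of d 1]
      MonD(2)[OF g] lead refl by simp
  have "{1..d} = insert d {1..<d}" using d by auto
  then have "tr ?h = tr g + - (int d * coeff f d)"
    using ps pd by (simp add: tr_def right_diff_distrib)
  then show "\<chi> (red ?h) = \<chi> g * e_mod p (- (int d * coeff f d))"
    using \<chi>_red[OF lead] unfolding \<chi>_def by (simp only: e_mod_add)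
qed

text \<open>Adding $X^{n-d}$ permutes the monic polynomials of degree $n$ and multiplies \<open>\<chi>\<close> by a fixed nontrivial root of unity.\<close>
lemma \<sigma>_vanishes:
  assumes "n \<ge> d"
  shows "\<sigma> n = 0"
proof -
  let ?F = "\<lambda>g. red (g + monom 1 (n - d))"
  have "inj_on ?F (Mon n)"
  proof (rule inj_onI)
    fix g h assume gh: "g \<in> Mon n" "h \<in> Mon n" "?F g = ?F h"
    then have "dvdm 0 (g - h)" by (simp add: red_eq_iff)
    then show "g = h" using gh Red_eqI Mon_subset by blast
  qed
  then have "bij_betw ?F (Mon n) (Mon n)"
    using \<chi>_shift(2)[OF _ assms] finite_Mon
    by (simp add: bij_betw_def endo_inj_surj image_subset_iff)
  then have "\<sigma> n = (\<Sum>g\<in>Mon n. \<chi> (?F g))"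
    unfolding \<sigma>_def by (rule sum.reindex_bij_betw[symmetric])
  also have "\<dots> = \<sigma> n * e_mod p (- (int d * coeff f d))"
    unfolding \<sigma>_def sum_distrib_right using \<chi>_shift(1)[OF _ assms] by (intro sum.cong) auto
  finally have "\<sigma> n = 0 \<or> e_mod p (- (int d * coeff f d)) = 1" by auto
  moreover have "\<not> int p dvd int d * coeff f d"
    using d lead_f prime_p by (auto simp: prime_dvd_mult_iff nat_dvd_not_less)
  ultimately show ?thesis using e_mod_eq_1_iff[OF p_gt_1(3)] by auto
qed

text \<open>Stepanov's bound \<open>U\<close> is one-sided, but the p trace classes together have at
  least p^(2 mu) - 2 p^mu elements, so the deficits \<open>U - A c\<close> have a small sum.
  Replacing \<open>A c\<close> by \<open>A c - U\<close> changes nothing, because the p-th roots of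
  unity sum to zero.\<close>

lemma norm_S_even_le:
  assumes "\<mu> > 0"
  shows "norm (S (2 * \<mu>)) \<le> real ((2 * d + 1) * p + 4) * real (p ^ \<mu>)"
proof -
  define U where "U = real (p ^ (2 * \<mu> - 1) + (2 * d + 1) * p ^ \<mu>)"
  define I where "I = Irr (2 * \<mu>)"
  define A where "A c = real (2 * \<mu> * card {P \<in> I. int p dvd tr P - c})" for c
  have finI: "finite I" by (simp add: I_def finite_Irr)
  have fib: "{P \<in> I. tr P mod int p = c} = {P \<in> I. int p dvd tr P - c}" if "c \<in> {0..<int p}" for c
    using that mod_eq_dvd_iff[of _ "int p" c] by auto
  have part: "(\<Sum>P\<in>I. h P) = (\<Sum>c\<in>{0..<int p}. \<Sum>P\<in>{P \<in> I. int p dvd tr P - c}. h P)"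
    for h :: "int poly \<Rightarrow> complex"
  proof -
    have "(\<lambda>P. tr P mod int p) ` I \<subseteq> {0..<int p}" using p_gt_1 by auto
    then have "(\<Sum>P\<in>I. h P) = (\<Sum>c\<in>{0..<int p}. \<Sum>P\<in>{P \<in> I. tr P mod int p = c}. h P)"
      using finI by (intro sum.group[symmetric]) auto
    then show ?thesis using fib by simp
  qed
  have sumA: "(\<Sum>c\<in>{0..<int p}. A c) = real (2 * \<mu> * card I)"
  proof -
    have "complex_of_real (\<Sum>c\<in>{0..<int p}. A c) = of_nat (2 * \<mu>) * (\<Sum>P\<in>I. 1)"
      unfolding part by (simp add: A_def sum_distrib_left)
    also have "\<dots> = complex_of_real (real (2 * \<mu> * card I))" by simp
    finally show ?thesis by (simp only: of_real_eq_iff)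
  qed
  have le: "A c \<le> U" for c
    using stepanov[OF assms, of c] unfolding A_def U_def I_def by (simp only: of_nat_le_iff)
  have "of_nat (2 * \<mu>) * (\<Sum>P\<in>I. \<chi> P) = (\<Sum>c\<in>{0..<int p}. of_real (A c) * e_mod p c)"
  proof -
    have "(\<Sum>P\<in>{P \<in> I. int p dvd tr P - c}. \<chi> P) = of_nat (card {P \<in> I. int p dvd tr P - c}) * e_mod p c" for c
    proof -
      have "\<chi> P = e_mod p c" if "P \<in> {P \<in> I. int p dvd tr P - c}" for P
        unfolding \<chi>_def using that p_gt_1 by (intro e_mod_cong) auto
      then show ?thesis by simp
    qed
    then show ?thesis
      unfolding part by (subst sum_distrib_left, intro sum.cong refl) (simp add: A_def)
  qed
  also have "\<dots> = (\<Sum>c\<in>{0..<int p}. of_real (A c - U) * e_mod p c) + of_real U * (\<Sum>c\<in>{0..<int p}. e_mod p c)"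
    by (simp add: sum_distrib_left algebra_simps flip: sum.distrib)
  also have "(\<Sum>c\<in>{0..<int p}. e_mod p c) = 0"
    using sum_e_mod[of p 1] p_gt_1 by simp
  finally have "norm (of_nat (2 * \<mu>) * (\<Sum>P\<in>I. \<chi> P)) = norm (\<Sum>c\<in>{0..<int p}. of_real (A c - U) * e_mod p c)"
    by simp
  also have "\<dots> \<le> (\<Sum>c\<in>{0..<int p}. U - A c)"
  proof (rule sum_norm_le)
    fix c
    have "norm (of_real (A c - U) * e_mod p c) = \<bar>A c - U\<bar>"
      by (simp only: norm_mult norm_of_real norm_e_mod mult_1_right)
    then show "norm (of_real (A c - U) * e_mod p c) \<le> U - A c" using le[of c] by linarith
  qed
  also have "\<dots> = real p * U - real (2 * \<mu> * card I)"
    by (simp add: sum_subtractf sumA)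
  finally have 1: "norm (of_nat (2 * \<mu>) * (\<Sum>P\<in>I. \<chi> P)) \<le> real p * U - real (2 * \<mu> * card I)" .
  have 2: "norm (S (2 * \<mu>) - of_nat (2 * \<mu>) * (\<Sum>P\<in>I. \<chi> P)) \<le> real (p ^ (2 * \<mu>)) - real (2 * \<mu> * card I)"
    unfolding I_def using assms by (intro norm_S_minus_Irr_le) simp
  have 3: "real (p ^ (2 * \<mu>)) - real (2 * \<mu> * card I) \<le> 2 * real (p ^ \<mu>)"
  proof -
    have "p ^ (2 * \<mu>) \<le> 2 * \<mu> * card I + 2 * p ^ \<mu>"
      using sum_degree_Irr[of "2 * \<mu>"] sum_proper_power_Irr_le[of \<mu>] assms unfolding I_def by linarith
    then have "real (p ^ (2 * \<mu>)) \<le> real (2 * \<mu> * card I + 2 * p ^ \<mu>)" by (simp only: of_nat_le_iff)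
    then show ?thesis by simp
  qed
  have 4: "real p * U = real (p ^ (2 * \<mu>)) + real ((2 * d + 1) * p) * real (p ^ \<mu>)"
  proof -
    have "p * p ^ (2 * \<mu> - 1) = p ^ (2 * \<mu>)" using assms by (simp flip: power_Suc)
    then have "p * (p ^ (2 * \<mu> - 1) + (2 * d + 1) * p ^ \<mu>) = p ^ (2 * \<mu>) + (2 * d + 1) * p * p ^ \<mu>"
      by (simp add: algebra_simps)
    then show ?thesis unfolding U_def by (metis of_nat_add of_nat_mult)
  qed
  have "norm (S (2 * \<mu>)) \<le> norm (S (2 * \<mu>) - of_nat (2 * \<mu>) * (\<Sum>P\<in>I. \<chi> P))
      + norm (of_nat (2 * \<mu>) * (\<Sum>P\<in>I. \<chi> P))"
    by (metis add.commute norm_triangle_sub)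
  also have "\<dots> \<le> 4 * real (p ^ \<mu>) + real ((2 * d + 1) * p) * real (p ^ \<mu>)"
    using 1 2 3 4 by linarith
  also have "\<dots> = real ((2 * d + 1) * p + 4) * real (p ^ \<mu>)"
    by (simp add: algebra_simps)
  finally show ?thesis .
qed

lemma S_1_eq: "S 1 = (\<Sum>x\<in>{0..<int p}. e_mod p (poly f x))"
proof -
  have "Mon 1 = (\<lambda>c. [:c, 1:]) ` {0..<int p}"
    by (auto simp: Mon_eq_image Low_Suc Low_0 monom_Suc image_iff)
  then have "S 1 = (\<Sum>c\<in>{0..<int p}. \<chi> [:c, 1:])"
    unfolding S_1 by (simp add: sum.reindex inj_on_def o_def)
  also have "\<dots> = (\<Sum>c\<in>{0..<int p}. e_mod p (poly f (- c)))"
  proof (intro sum.cong refl)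
    fix c
    have "{..d} = insert 0 {1..d}" by auto
    then have "poly f (- c) = (\<Sum>j=1..d. coeff f j * (- c) ^ j)"
      by (simp add: poly_altdef degree_f f_0)
    also have "\<dots> = tr [:c, 1:]"
      unfolding tr_def using psum_linear[of _ "- c"] by (intro sum.cong refl) auto
    finally show "\<chi> [:c, 1:] = e_mod p (poly f (- c))" by (simp add: \<chi>_def)
  qed
  also have "\<dots> = (\<Sum>x\<in>{0..<int p}. e_mod p (poly f x))"
  proof (rule sum.reindex_bij_witness[of _ "\<lambda>x. (- x) mod int p" "\<lambda>x. (- x) mod int p"])
    fix c assume c: "c \<in> {0..<int p}"
    show "- (- c mod int p) mod int p = c" using c by (simp add: mod_minus_eq)
    show "- c mod int p \<in> {0..<int p}" using p_gt_1 by simp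
    have "int p dvd (- c mod int p) - (- c)" by (rule mod_eq_dvd_iff[THEN iffD1]) simp
    then show "e_mod p (poly f (- c mod int p)) = e_mod p (poly f (- c))"
      using p_gt_1 by (intro e_mod_cong dvd_poly_diff)
  qed (use p_gt_1 in \<open>auto simp: mod_minus_eq\<close>)
  finally show ?thesis .
qed

text \<open>The factor (2 d + 1) p + 4 does not depend on \<open>\<mu>\<close>. So the numbers z_i^2
  / p have bounded power sums and modulus at most 1. The sum in question, \<open>S 1\<close>, is
  minus the sum of at most d - 1 of the z_i.\<close>

theorem weil: "norm (\<Sum>x\<in>{0..<int p}. e_mod p (poly f x)) \<le> real (d - 1) * sqrt (real p)"
proof -
  obtain N z where N: "N < d" and z: "\<And>r. r > 0 \<Longrightarrow> S r = - (\<Sum>i<N. z i ^ r)"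
    using S_power_sums[OF \<sigma>_vanishes d(1)] by blast
  have "norm (z n) \<le> sqrt (real p)" if n: "n < N" for n
  proof -
    have "norm ((z n)\<^sup>2 / of_nat p) \<le> 1"
    proof (rule bounded_power_sums_imp_norm_le_1[OF _ n])
      fix k :: nat assume k: "k > 0"
      have "(\<Sum>i<N. ((z i)\<^sup>2 / of_nat p) ^ k) = (\<Sum>i<N. z i ^ (2 * k)) / of_nat p ^ k"
        by (simp add: power_divide sum_divide_distrib power_mult)
      also have "\<dots> = - S (2 * k) / of_nat p ^ k"
        using z[of "2 * k"] k by simp
      finally have "norm (\<Sum>i<N. ((z i)\<^sup>2 / of_nat p) ^ k) = norm (S (2 * k)) / real p ^ k"
        by (simp add: norm_divide norm_power)
      also have "\<dots> \<le> real ((2 * d + 1) * p + 4)"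
        using norm_S_even_le[OF k] p_gt_1 by (simp add: divide_le_eq)
      finally show "norm (\<Sum>i<N. ((z i)\<^sup>2 / of_nat p) ^ k) \<le> real ((2 * d + 1) * p + 4)" .
    qed
    then have "(norm (z n))\<^sup>2 \<le> real p"
      using p_gt_1 by (simp add: norm_divide norm_power divide_le_eq)
    then show ?thesis by (rule real_le_rsqrt)
  qed
  then have "norm (S 1) \<le> (\<Sum>i<N. sqrt (real p))"
    using z[of 1] by (simp only: zero_less_one norm_minus_cancel power_one_right)
      (intro sum_norm_le, simp)
  also have "\<dots> \<le> real (d - 1) * sqrt (real p)"
    using N by (auto intro!: mult_right_mono)
  finally show ?thesis by (simp only: S_1_eq)
qed

end

section \<open>Prime power moduli\<close>

lemma sum_periodic_shift:
  fixes g :: "int \<Rightarrow> complex"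
  assumes N: "N > 0" and per: "\<And>x. g (x mod N) = g x"
  shows "(\<Sum>x\<in>{0..<N}. g (x + t)) = (\<Sum>x\<in>{0..<N}. g x)"
proof (rule sum.reindex_bij_witness[of _ "\<lambda>x. (x - t) mod N" "\<lambda>x. (x + t) mod N"])
  fix x assume "x \<in> {0..<N}"
  then show "((x + t) mod N - t) mod N = x" "((x - t) mod N + t) mod N = x"
    by (simp_all add: mod_diff_left_eq mod_add_left_eq)
  show "g ((x + t) mod N) = g (x + t)" by (rule per)
qed (use N in auto)

lemma sum_residue_blocks:
  fixes g :: "int \<Rightarrow> complex"
  assumes "M > 0"
  shows "(\<Sum>x\<in>{0..<M * N}. g x) = (\<Sum>r\<in>{0..<M}. \<Sum>y\<in>{0..<N}. g (r + M * y))"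
  unfolding sum.cartesian_product
proof (rule sum.reindex_bij_witness[of _ "\<lambda>(r, y). r + M * y" "\<lambda>x. (x mod M, x div M)"])
  fix x assume "x \<in> {0..<M * N}"
  then have x: "0 \<le> x" "x < M * N" by auto
  have "x div M < N"
  proof (rule ccontr)
    assume "\<not> x div M < N"
    then have "M * N \<le> M * (x div M)" using assms by (intro mult_left_mono) auto
    also have "\<dots> = x - x mod M" by (simp add: minus_mod_eq_mult_div)
    also have "\<dots> \<le> x" using assms by simp
    finally show False using x by simp
  qed
  then show "(x mod M, x div M) \<in> {0..<M} \<times> {0..<N}"
    using assms x by (auto simp: pos_imp_zdiv_nonneg_iff)
next
  fix a assume a: "a \<in> {0..<M} \<times> {0..<N}"
  obtain r y where ry: "a = (r, y)" by (cases a)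
  have "r + M * y < M * (y + 1)" using a by (simp add: ry algebra_simps)
  also have "\<dots> \<le> M * N" using a assms by (intro mult_left_mono) (auto simp: ry)
  finally show "(case a of (r, y) \<Rightarrow> r + M * y) \<in> {0..<M * N}"
    using a assms by (simp add: ry)
qed (use assms in auto)

lemma sum_periodic_repeat:
  fixes g :: "int \<Rightarrow> complex"
  assumes N: "N > 0" and per: "\<And>x. g (x mod N) = g x"
  shows "(\<Sum>x\<in>{0..<N * int K}. g x) = of_nat K * (\<Sum>x\<in>{0..<N}. g x)"
proof -
  have "g (r + N * y) = g r" if "r \<in> {0..<N}" for r y
    using per[of "r + N * y"] per[of r] by simp
  then have "(\<Sum>x\<in>{0..<N * int K}. g x) = (\<Sum>r\<in>{0..<N}. \<Sum>y\<in>{0..<int K}. g r)"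
    unfolding sum_residue_blocks[OF N] by (intro sum.cong refl) auto
  then show ?thesis by (simp add: sum_distrib_left)
qed

definition expsum :: "nat \<Rightarrow> int poly \<Rightarrow> complex"
  where "expsum n F = (\<Sum>x\<in>{0..<int n}. e_mod n (poly F x))"

lemma e_mod_poly_periodic:
  assumes "n > 0" "int n dvd N"
  shows "e_mod n (poly F (x mod N)) = e_mod n (poly F x)"
proof (rule e_mod_cong[OF assms(1) dvd_poly_diff])
  have "N dvd x mod N - x" by (rule mod_eq_dvd_iff[THEN iffD1]) simp
  with assms(2) show "int n dvd x mod N - x" by (rule dvd_trans)
qed

lemma e_mod_mult_cancel:
  assumes "k > 0"
  shows "e_mod (k * n) (int k * a) = e_mod n a"
  using assms by (simp add: e_mod_def)

lemma sum_e_mod_poly_multiple: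
  assumes "h > 0"
  shows "(\<Sum>x\<in>{0..<int (h * K)}. e_mod h (poly F x)) = of_nat K * expsum h F"
  unfolding expsum_def of_nat_mult
  by (rule sum_periodic_repeat) (use assms e_mod_poly_periodic[OF assms] in auto)

lemma poly_taylor_2:
  fixes c :: "int poly"
  shows "h * h dvd poly c (u + h) - poly c u - h * poly (pderiv c) u"
proof (induction c)
  case (pCons a c)
  have "h dvd poly c (u + h) - poly c u" by (rule dvd_poly_diff) simp
  then have "h * h dvd h * (poly c (u + h) - poly c u)" by (intro mult_dvd_mono) auto
  then have *: "h * h dvd u * (poly c (u + h) - poly c u - h * poly (pderiv c) u)
      + h * (poly c (u + h) - poly c u)"
    by (rule dvd_add[OF dvd_mult[OF pCons.IH]])
  have "poly (pCons a c) (u + h) - poly (pCons a c) u - h * poly (pderiv (pCons a c)) u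
      = u * (poly c (u + h) - poly c u - h * poly (pderiv c) u) + h * (poly c (u + h) - poly c u)"
    by (simp add: pderiv_pCons algebra_simps)
  with * show ?case by (simp only:)
qed simp

text \<open>For D = d the claim is d - 1 <= q^(1/2 - 1/d), and q >= 2.1^(2 d) makes the right-hand
  side at least 2.1^(d - 2) >= 2^(d - 2) >= d - 1. The case d < D follows because q >= 1.\<close>

lemma weil_numeric:
  fixes q :: real
  assumes d: "d \<ge> 1" "d \<le> D" and q: "q \<ge> 4.41 ^ D"
  shows "real (d - 1) * sqrt q \<le> q powr (1 - 1 / real D)"
proof -
  have "1 \<le> (4.41::real) ^ D" by (rule one_le_power) simp
  then have q1: "q \<ge> 1" using q by linarith
  have mono: "q powr (1 - 1 / real d) \<le> q powr (1 - 1 / real D)"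
    using d q1 by (intro powr_mono) (auto simp: field_simps)
  have "real (d - 1) * sqrt q \<le> q powr (1 - 1 / real d)"
  proof (cases "d = 1")
    case False
    define k where "k = d - 2"
    have k: "d = k + 2" using False d(1) by (simp add: k_def)
    have "(4.41::real) ^ d \<le> 4.41 ^ D" using d(2) by (rule power_increasing) simp
    with q have qd: "4.41 ^ d \<le> q" by linarith
    have "real (d - 1) = 1 + real k * 1" by (simp add: k)
    also have "\<dots> \<le> (1 + 1) ^ k" by (rule Bernoulli_inequality) simp
    also have "\<dots> \<le> (2.1::real) ^ k" by (intro power_mono) auto
    also have "(2.1::real) ^ k = 2.1 powr real k" by (rule powr_realpow[symmetric]) simp
    also have "real k = 2 * (real d * (1 / 2 - 1 / real d))" by (simp add: k field_simps)
    also have "(2.1::real) powr \<dots> = (2.1 powr 2) powr (real d * (1 / 2 - 1 / real d))"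
      by (rule powr_powr[symmetric])
    also have "(2.1::real) powr 2 = 4.41" by (simp add: powr_numeral power2_eq_square)
    also have "(4.41::real) powr (real d * (1 / 2 - 1 / real d)) = (4.41 powr real d) powr (1 / 2 - 1 / real d)"
      by (rule powr_powr[symmetric])
    also have "(4.41::real) powr real d = 4.41 ^ d" by (rule powr_realpow) simp
    also have "(4.41 ^ d) powr (1 / 2 - 1 / real d) \<le> q powr (1 / 2 - 1 / real d)"
      using qd k by (intro powr_mono2) (auto simp: field_simps)
    finally have "real (d - 1) * sqrt q \<le> q powr (1 / 2 - 1 / real d) * q powr (1 / 2)"
      using q1 by (simp add: powr_half_sqrt mult_right_mono)
    also have "\<dots> = q powr (1 - 1 / real d)" by (simp flip: powr_add)
    finally show ?thesis .
  qed simp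
  with mono show ?thesis by linarith
qed

text \<open>A branch with parameter s is allotted the share (s - 1)/(D - 1) of the total bound. The
  inverse share is 1 + t <= e^t <= 4.41^t, and t <= 2 (D - s)/s because s <= 2 (s - 1); with m >= 2
  this is at most q^(m (1/s - 1/D)).\<close>

lemma branch_numeric:
  fixes q :: real
  assumes s: "2 \<le> s" "s \<le> D" and m: "m \<ge> 2" and q: "q \<ge> 4.41 ^ D"
  shows "q powr (real m * (1 - 1 / real s)) * real (D - 1) \<le> q powr (real m * (1 - 1 / real D)) * real (s - 1)"
proof -
  define t where "t = (real D - real s) / (real s - 1)"
  have "0 < (4.41::real) ^ D" by simp
  then have q0: "q > 0" using q by linarith
  have D: "real D > 0" "real s > 1" using s by auto
  have t0: "t \<ge> 0" using s by (simp add: t_def)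
  have "1 + t \<le> exp t" by (rule exp_ge_add_one_self)
  also have "\<dots> = exp 1 powr t" by (simp add: powr_def)
  also have "\<dots> \<le> 4.41 powr t"
    using exp_le t0 by (intro powr_mono2) auto
  also have "\<dots> \<le> 4.41 powr (real m * ((real D - real s) / real s))"
  proof (rule powr_mono)
    have "t \<le> 2 * ((real D - real s) / real s)"
    proof -
      have "(real D - real s) * real s \<le> (real D - real s) * (2 * (real s - 1))"
        using s by (intro mult_left_mono) auto
      then show ?thesis using D by (simp add: t_def field_simps)
    qed
    also have "\<dots> \<le> real m * ((real D - real s) / real s)"
      using m s by (intro mult_right_mono) auto
    finally show "t \<le> real m * ((real D - real s) / real s)" .
  qed simp
  also have "\<dots> = (4.41 ^ D) powr (real m * (1 / real s - 1 / real D))"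
  proof -
    have "real m * ((real D - real s) / real s) = real D * (real m * (1 / real s - 1 / real D))"
      using D by (simp add: field_simps)
    then have "(4.41::real) powr (real m * ((real D - real s) / real s))
        = (4.41 powr real D) powr (real m * (1 / real s - 1 / real D))"
      by (simp only: powr_powr)
    also have "(4.41::real) powr real D = 4.41 ^ D" by (rule powr_realpow) simp
    finally show ?thesis .
  qed
  also have "(4.41 ^ D) powr (real m * (1 / real s - 1 / real D)) \<le> q powr (real m * (1 / real s - 1 / real D))"
    using q s by (intro powr_mono2 mult_nonneg_nonneg) (auto simp: frac_le)
  finally have "q powr (real m * (1 - 1 / real s)) * (1 + t)
      \<le> q powr (real m * (1 - 1 / real s)) * q powr (real m * (1 / real s - 1 / real D))"
    by (intro mult_left_mono) auto
  also have "\<dots> = q powr (real m * (1 - 1 / real D))"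
    by (simp add: algebra_simps flip: powr_add)
  finally have "q powr (real m * (1 - 1 / real s)) * (1 + t) * (real s - 1)
      \<le> q powr (real m * (1 - 1 / real D)) * (real s - 1)"
    using D by (intro mult_right_mono) auto
  moreover have "(1 + t) * (real s - 1) = real D - 1"
    using D by (simp add: t_def field_simps)
  ultimately show ?thesis using s by (simp add: of_nat_diff mult.assoc)
qed

section \<open>Weil's bound under a degree bound modulo p, and root multiplicities\<close>

context prime_modulus
begin

lemma weil_degree_bound:
  assumes D: "D \<ge> 1" "real p \<ge> 4.41 ^ D"
    and high: "\<And>i. i > D \<Longrightarrow> int p dvd coeff F i" and nonconst: "i0 \<ge> 1" "\<not> int p dvd coeff F i0"
  shows "norm (expsum p F) \<le> real p powr (1 - 1 / real D)"
proof -
  define f where "f = red F - [:coeff (red F) 0:]"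
  have cf: "coeff f i = (if i = 0 then 0 else coeff F i mod int p)" for i
    by (simp add: f_def coeff_red coeff_pCons split: nat.splits)
  define d where "d = degree f"
  have "coeff f i0 \<noteq> 0" using nonconst by (auto simp: cf)
  then have "i0 \<le> d" unfolding d_def by (rule le_degree)
  then have d1: "d \<ge> 1" using nonconst by simp
  have dD: "d \<le> D" unfolding d_def using high by (intro degree_le) (auto simp: cf)
  have fnz: "coeff f d \<noteq> 0" using d1 unfolding d_def by (cases "f = 0") auto
  \<comment> \<open>Bernoulli's inequality turns the lower bound on p into D < p, as
    \<open>artin_schreier\<close> requires.\<close>
  have "1 + real D * 3 \<le> (1 + 3) ^ D" by (rule Bernoulli_inequality) simp
  also have "\<dots> \<le> 4.41 ^ D" by (rule power_mono) auto
  finally have "real D < real p" using D(2) by linarith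
  then have Dp: "D < p" by simp
  interpret artin_schreier p f d
  proof
    show "degree f = d" by (simp add: d_def)
    show "0 < d" "d < p" using d1 dD Dp by auto
    show "\<not> int p dvd coeff f d" using fnz d1 by (auto simp: cf dvd_eq_mod_eq_0)
    show "coeff f 0 = 0" by (simp add: cf)
  qed
  have "e_mod p (poly F x) = e_mod p (coeff (red F) 0) * e_mod p (poly f x)" for x
  proof -
    have "int p dvd poly F x - poly (red F) x"
    proof -
      obtain h where "F - red F = [:int p:] * h" using red_cong(2)[of F] by (auto simp: dvdm_def)
      then have "poly F x - poly (red F) x = int p * poly h x"
        by (metis poly_diff poly_mult poly_pCons poly_0 mult_zero_right add_0_right)
      then show ?thesis by simp
    qed
    then have "e_mod p (poly F x) = e_mod p (poly (red F) x)" using p_gt_1 by (intro e_mod_cong) auto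
    also have "poly (red F) x = coeff (red F) 0 + poly f x" by (simp add: f_def)
    finally show ?thesis by (simp add: e_mod_add)
  qed
  then have "expsum p F = e_mod p (coeff (red F) 0) * (\<Sum>x\<in>{0..<int p}. e_mod p (poly f x))"
    by (simp add: expsum_def sum_distrib_left)
  then have "norm (expsum p F) \<le> real (d - 1) * sqrt (real p)"
    using weil by (simp add: norm_mult)
  also have "\<dots> \<le> real p powr (1 - 1 / real D)"
    using d1 dD D(2) by (rule weil_numeric)
  finally show ?thesis .
qed

lemma dvdm_monom:
  assumes "\<And>j. j < n \<Longrightarrow> int p dvd coeff a j"
  shows "dvdm (monom 1 n) a"
proof -
  have "dvdm 0 (a - monom 1 n * poly_shift n a)"
    using assms by (auto simp: dvdm_zero_iff coeff_monom_mult coeff_poly_shift)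
  then show ?thesis by (auto simp: dvdm_iff[of "monom 1 n"])
qed

lemma dvdm_zero_pcompose: "dvdm 0 a \<Longrightarrow> dvdm 0 (pcompose a b)"
  by (auto simp: dvdm_def dvd_def pcompose_smult)

lemma dvdm_pcompose:
  assumes "dvdm g a"
  shows "dvdm (pcompose g b) (pcompose a b)"
proof -
  obtain h where "dvdm 0 (a - g * h)" using assms by (auto simp: dvdm_iff[of g])
  then have "dvdm 0 (pcompose a b - pcompose g b * pcompose h b)"
    using dvdm_zero_pcompose[of _ b] by (fastforce simp: pcompose_diff pcompose_mult)
  then show ?thesis by (auto simp: dvdm_iff[of "pcompose g b"])
qed

text \<open>The degree formula restricted to linear factors: distinct residues give distinct
  irreducible polynomials, and \<open>v \<mu>\<close> is at most the multiplicity of its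
  factor.\<close>

lemma sum_linear_multiplicity_le:
  assumes G: "\<not> dvdm 0 G" and dvd: "\<And>\<mu>. \<mu> \<in> {0..<int p} \<Longrightarrow> dvdm ([:- \<mu>, 1:] ^ v \<mu>) G"
  shows "(\<Sum>\<mu>\<in>{0..<int p}. v \<mu>) \<le> degree G"
proof -
  obtain w k where w: "k \<le> degree G" "red (smult w G) \<in> Mon k" "\<not> int p dvd w"
    using G by (rule monicize)
  let ?g = "red (smult w G)" and ?P = "\<lambda>\<mu>. red [:- \<mu>, 1:]"
  have PI: "?P \<mu> \<in> Irr 1" for \<mu>
    unfolding Irr_1 using red_monic[of "[:- \<mu>, 1:]"] by simp
  define M where "M = Suc k"
  have dvdP: "dvdm (?P \<mu> ^ j) ?g" if "\<mu> \<in> {0..<int p}" "j \<le> v \<mu>" for \<mu> j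
  proof -
    have "dvdm ([:- \<mu>, 1:] ^ j) G"
      using dvd[OF that(1)] dvdm_trans dvdm_self[of "[:- \<mu>, 1:] ^ j" "[:- \<mu>, 1:] ^ (v \<mu> - j)"] that(2)
      by (metis le_add_diff_inverse power_add)
    then have "dvdm (?P \<mu> ^ j) G"
      using dvdm_cong[OF m.cong_power[OF red_cong(1)]] by blast
    then have "dvdm (?P \<mu> ^ j) (smult w G)" using dvdm_smult_iff[OF w(3)] by blast
    then show ?thesis using m.cong_iff[OF dvdm_zeroD[OF red_cong(1)]] by blast
  qed
  have inj: "inj_on ?P {0..<int p}"
  proof (rule inj_onI)
    fix a b assume ab: "a \<in> {0..<int p}" "b \<in> {0..<int p}" "?P a = ?P b"
    then have "int p dvd coeff ([:- a, 1:] - [:- b, 1:]) 0"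
      unfolding red_eq_iff dvdm_zero_iff by blast
    then have "b mod int p = a mod int p" by (simp add: mod_eq_dvd_iff)
    then show "a = b" using ab by simp
  qed
  have "v \<mu> \<le> card {j \<in> {1..M}. dvdm (?P \<mu> ^ j) ?g}" if \<mu>: "\<mu> \<in> {0..<int p}" for \<mu>
  proof -
    have "v \<mu> \<le> k"
      using Irr_power_dvdm_le_degree[OF PI w(2) dvdP[OF \<mu> le_refl]] .
    then have "{1..v \<mu>} \<subseteq> {j \<in> {1..M}. dvdm (?P \<mu> ^ j) ?g}"
      using dvdP[OF \<mu>] by (auto simp: M_def)
    from card_mono[OF _ this] show ?thesis by simp
  qed
  then have "(\<Sum>\<mu>\<in>{0..<int p}. v \<mu>) \<le> (\<Sum>\<mu>\<in>{0..<int p}. card {j \<in> {1..M}. dvdm (?P \<mu> ^ j) ?g})"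
    by (rule sum_mono)
  also have "\<dots> = (\<Sum>P\<in>?P ` {0..<int p}. degree P * card {j \<in> {1..M}. dvdm (P ^ j) ?g})"
    using IrrD(3)[OF PI] by (simp add: sum.reindex[OF inj])
  also have "\<dots> \<le> (\<Sum>P\<in>Irrs M. degree P * card {j \<in> {1..M}. dvdm (P ^ j) ?g})"
    using PI by (intro sum_mono2[OF finite_Irrs]) (auto simp: Irrs_def M_def intro!: bexI[of _ 1])
  also have "\<dots> = k" using w(2) by (rule degree_eq_sum_Irr) (simp add: M_def)
  finally show ?thesis using w(1) by simp
qed

end

section \<open>Branching over the residue classes modulo p\<close>

context prime_modulus
begin

text \<open>Shifting y by p^(m - 2) changes c(p y) by p^(m - 1) c_1 modulo p^m, since the quadratic
  Taylor terms are divisible by p^(2 m - 2). The sum is thereby multiplied by a nontrivial p-th root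
  of unity.\<close>

lemma nonroot_branch_zero:
  assumes m: "m \<ge> 2" and c: "\<not> int p dvd coeff c 1"
  shows "(\<Sum>y\<in>{0..<int (p ^ (m - 1))}. e_mod (p ^ m) (poly c (int p * y))) = 0"
proof -
  define N where "N = int (p ^ (m - 1))"
  define t where "t = int (p ^ (m - 2))"
  define g where "g y = e_mod (p ^ m) (poly c (int p * y))" for y
  have pm: "p ^ m > 0" using p_gt_1 by simp
  have N: "int (p ^ m) = int p * N" "N = int p * t" "N > 0"
    using m p_gt_1 by (auto simp: N_def t_def simp flip: power_Suc)
  have per: "g (y mod N) = g y" for y
  proof -
    have "N dvd y mod N - y" by (rule mod_eq_dvd_iff[THEN iffD1]) simp
    then have "int p * N dvd int p * (y mod N - y)" by (intro mult_dvd_mono) auto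
    then have "int (p ^ m) dvd int p * (y mod N) - int p * y" by (simp only: N(1) right_diff_distrib)
    then show ?thesis unfolding g_def by (intro e_mod_cong[OF pm] dvd_poly_diff)
  qed
  define \<zeta> where "\<zeta> = e_mod p (coeff c 1)"
  have \<zeta>: "\<zeta> = e_mod (p ^ m) (N * coeff c 1)"
  proof -
    have "p ^ m = p ^ (m - 1) * p" using m by (simp flip: power_Suc2)
    then show ?thesis
      unfolding \<zeta>_def N_def using p_gt_1 by (simp only: e_mod_mult_cancel[of "p ^ (m - 1)"] zero_less_power)
  qed
  have step: "g (y + t) = g y * \<zeta>" for y
  proof -
    let ?u = "int p * y"
    have "N * N = int (p ^ m) * t" using N by (simp add: algebra_simps)
    then have "int (p ^ m) dvd N * N" by simp
    then have 1: "int (p ^ m) dvd poly c (?u + N) - poly c ?u - N * poly (pderiv c) ?u"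
      using poly_taylor_2[of N c ?u] by (rule dvd_trans)
    have "int p dvd poly (pderiv c) ?u - poly (pderiv c) 0"
      by (rule dvd_poly_diff) simp
    moreover have "poly (pderiv c) 0 = coeff c 1" by (simp add: poly_0_coeff_0 coeff_pderiv)
    ultimately have "N * int p dvd N * (poly (pderiv c) ?u - coeff c 1)" by (intro mult_dvd_mono) auto
    then have "int (p ^ m) dvd N * (poly (pderiv c) ?u - coeff c 1)" by (simp only: N(1) mult.commute)
    with 1 have "int (p ^ m) dvd (poly c (?u + N) - poly c ?u - N * poly (pderiv c) ?u)
        + N * (poly (pderiv c) ?u - coeff c 1)" by (rule dvd_add)
    moreover have "\<dots> = poly c (?u + N) - (poly c ?u + N * coeff c 1)" by (simp add: algebra_simps)
    ultimately have "int (p ^ m) dvd poly c (?u + N) - (poly c ?u + N * coeff c 1)" by (simp only:)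
    then have "e_mod (p ^ m) (poly c (?u + N)) = e_mod (p ^ m) (poly c ?u + N * coeff c 1)"
      by (rule e_mod_cong[OF pm])
    then show ?thesis by (simp add: g_def \<zeta> e_mod_add N(2) distrib_left)
  qed
  have "(\<Sum>y\<in>{0..<N}. g y) = (\<Sum>y\<in>{0..<N}. g (y + t))"
    by (rule sum_periodic_shift[of N g t, OF N(3) per, symmetric])
  also have "\<dots> = (\<Sum>y\<in>{0..<N}. g y) * \<zeta>" by (simp add: step sum_distrib_right)
  finally have "(\<Sum>y\<in>{0..<N}. g y) = 0 \<or> \<zeta> = 1" by auto
  moreover have "\<zeta> \<noteq> 1" using c e_mod_eq_1_iff[OF p_gt_1(3)] by (simp add: \<zeta>_def)
  ultimately show ?thesis by (simp add: g_def N_def)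
qed

text \<open>
  On the residue class of a root $\mu$ of $F'$ modulo $p$ write $F(\mu + p y) - F(\mu) = p^\sigma g(y)$ with
  $\sigma$ maximal. Then $2 \le \sigma \le s$ and $g$ modulo $p$ has degree at most $s$, where $s - 1$ is the
  multiplicity of $\mu$.
\<close>
lemma root_branch_bound:
  assumes m: "m \<ge> 1" and s: "s \<ge> 2" "\<not> int p dvd coeff c s"
    and low: "\<And>j. 1 \<le> j \<Longrightarrow> j < s \<Longrightarrow> int p dvd coeff c j"
    and IH: "\<And>k g i. k < m \<Longrightarrow> (\<And>i. i > s \<Longrightarrow> int p dvd coeff g i) \<Longrightarrow> i \<ge> 1
      \<Longrightarrow> \<not> int p dvd coeff g i \<Longrightarrow> norm (expsum (p ^ k) g) \<le> real p powr (real k * (1 - 1 / real s))"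
  shows "norm (\<Sum>y\<in>{0..<int (p ^ (m - 1))}. e_mod (p ^ m) (poly c (int p * y)))
    \<le> real p powr (real m * (1 - 1 / real s))"
proof -
  define G where "G = pcompose c [:0, int p:] - [:coeff c 0:]"
  have cG: "coeff G j = (if j = 0 then 0 else int p ^ j * coeff c j)" for j
    by (simp add: G_def coeff_pcompose_linear coeff_pCons split: nat.splits)
  define Q where "Q k \<longleftrightarrow> (\<forall>j. int p ^ k dvd coeff G j)" for k
  \<comment> \<open>Index 1 owes its second factor p to \<open>low\<close>, applicable because s >=
    2.\<close>
  have Q2: "Q 2"
    unfolding Q_def
  proof
    fix j :: nat
    consider "j = 0" | "j = 1" | "j \<ge> 2" by linarith
    then show "int p ^ 2 dvd coeff G j"
    proof cases
      case 2
      then show ?thesis using low[of 1] s by (simp add: cG power2_eq_square)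
    next
      case 3
      then have "int p ^ 2 dvd int p ^ j" by (rule le_imp_power_dvd)
      then show ?thesis by (simp add: cG)
    qed (simp add: cG)
  qed
  have Qs: "k \<le> s" if "Q k" for k
  proof (rule ccontr)
    assume "\<not> k \<le> s"
    then have "int p ^ Suc s dvd int p ^ k" by (intro le_imp_power_dvd) auto
    also have "\<dots> dvd int p ^ s * coeff c s" using that s unfolding Q_def by (metis cG not_numeral_le_zero)
    finally have "int p ^ s * int p dvd int p ^ s * coeff c s" by (simp add: mult.commute)
    then show False using s p_gt_1 by simp
  qed
  define \<sigma> where "\<sigma> = (GREATEST k. Q k)"
  have Q\<sigma>: "Q \<sigma>" unfolding \<sigma>_def using Q2 Qs by (rule GreatestI_nat)
  have \<sigma>2: "2 \<le> \<sigma>" unfolding \<sigma>_def using Q2 Qs by (rule Greatest_le_nat)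
  have notQ: "\<not> Q (Suc \<sigma>)"
    using Greatest_le_nat[of Q "Suc \<sigma>" s] Qs unfolding \<sigma>_def by auto
  have \<sigma>s: "\<sigma> \<le> s" by (rule Qs[OF Q\<sigma>])
  have "[:int p ^ \<sigma>:] dvd G" using Q\<sigma> by (simp add: Q_def const_poly_dvd_iff)
  then obtain g where g: "G = smult (int p ^ \<sigma>) g" by (auto simp: dvd_def)
  have "\<exists>j. \<not> int p dvd coeff g j"
  proof (rule ccontr)
    assume "\<not> ?thesis"
    then have "Q (Suc \<sigma>)" by (auto simp: Q_def g intro!: mult_dvd_mono simp: mult.commute)
    with notQ show False by simp
  qed
  then obtain i where i: "\<not> int p dvd coeff g i" by auto
  have "int p ^ \<sigma> * coeff g 0 = 0" using cG[of 0] by (simp add: g)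
  then have "coeff g 0 = 0" using p_gt_1 by simp
  then have i1: "i \<ge> 1" using i by (cases i) auto
  have high: "int p dvd coeff g j" if "j > s" for j
  proof -
    have "int p ^ \<sigma> * coeff g j = int p ^ j * coeff c j" using cG[of j] that by (simp add: g)
    also have "int p ^ j = int p ^ \<sigma> * (int p * int p ^ (j - Suc \<sigma>))"
      using that \<sigma>s by (simp flip: power_Suc power_add)
    finally have "coeff g j = int p * int p ^ (j - Suc \<sigma>) * coeff c j"
      using p_gt_1 by (simp add: mult.assoc)
    then show ?thesis by simp
  qed
  have poly_c: "poly c (int p * y) = coeff c 0 + int p ^ \<sigma> * poly g y" for y
  proof -
    have "poly G y = poly c (int p * y) - coeff c 0"
      by (simp add: G_def poly_pcompose mult.commute)
    then show ?thesis by (simp add: g)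
  qed
  let ?I = "\<Sum>y\<in>{0..<int (p ^ (m - 1))}. e_mod (p ^ m) (int p ^ \<sigma> * poly g y)"
  have eq: "(\<Sum>y\<in>{0..<int (p ^ (m - 1))}. e_mod (p ^ m) (poly c (int p * y))) = e_mod (p ^ m) (coeff c 0) * ?I"
    by (simp add: poly_c e_mod_add sum_distrib_left)
  have p0: "real p > 1" using p_gt_1 by simp
  have "norm ?I \<le> real p powr (real m * (1 - 1 / real s))"
  proof (cases "\<sigma> \<le> m")
    case True
    define k where "k = m - \<sigma>"
    have m_eq: "m = \<sigma> + k" using True by (simp add: k_def)
    have "e_mod (p ^ m) (int p ^ \<sigma> * a) = e_mod (p ^ k) a" for a
      using e_mod_mult_cancel[of "p ^ \<sigma>" "p ^ k" a] p_gt_1 by (simp add: m_eq power_add)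
    moreover have "p ^ (m - 1) = p ^ k * p ^ (\<sigma> - 1)"
      using \<sigma>2 by (simp add: m_eq add.commute flip: power_add)
    ultimately have "?I = of_nat (p ^ (\<sigma> - 1)) * expsum (p ^ k) g"
      using sum_e_mod_poly_multiple[of "p ^ k" g "p ^ (\<sigma> - 1)"] p_gt_1 by simp
    then have "norm ?I = real p ^ (\<sigma> - 1) * norm (expsum (p ^ k) g)"
      by (simp add: norm_mult norm_power)
    also have "\<dots> \<le> real p ^ (\<sigma> - 1) * real p powr (real k * (1 - 1 / real s))"
      using IH[OF _ high i1 i, of k] \<sigma>2 m_eq by (intro mult_left_mono) auto
    also have "\<dots> = real p powr (real (\<sigma> - 1) + real k * (1 - 1 / real s))"
      using p0 by (simp add: powr_add powr_realpow)
    also have "\<dots> \<le> real p powr (real m * (1 - 1 / real s))"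
    proof (rule powr_mono)
      \<comment> \<open>Raising the modulus from p^k to p^m multiplies the sum by only p^(\<sigma> -
        1), and \<sigma> <= s lets this loss fit into the exponent.\<close>
      have "real \<sigma> / real s \<le> 1" using \<sigma>s s by simp
      then show "real (\<sigma> - 1) + real k * (1 - 1 / real s) \<le> real m * (1 - 1 / real s)"
        using \<sigma>2 by (simp add: m_eq of_nat_diff algebra_simps)
    qed (use p0 in simp)
    finally show ?thesis .
  next
    case False
    \<comment> \<open>Here m < \<sigma> <= s, so the trivial bound p^(m - 1) is already good
      enough.\<close>
    have "norm ?I \<le> (\<Sum>y\<in>{0..<int (p ^ (m - 1))}. 1)" by (intro sum_norm_le) simp
    also have "\<dots> = real p powr real (m - 1)" using p0 by (simp add: powr_realpow)
    also have "\<dots> \<le> real p powr (real m * (1 - 1 / real s))"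
    proof (rule powr_mono)
      have "real m / real s \<le> 1" using \<sigma>s s False by simp
      then show "real (m - 1) \<le> real m * (1 - 1 / real s)"
        using m by (simp add: of_nat_diff algebra_simps)
    qed (use p0 in simp)
    finally show ?thesis .
  qed
  then show ?thesis by (simp only: eq norm_mult norm_e_mod mult_1_left)
qed

lemma pcompose_shift_inverse: "pcompose (pcompose F [:a, 1:]) [:- a, 1:] = (F :: int poly)"
  by (simp add: pcompose_pCons flip: pcompose_assoc)

lemma pcompose_shift_nonconst:
  assumes "i \<ge> 1" "\<not> int p dvd coeff F i"
  shows "\<exists>j. 1 \<le> j \<and> \<not> int p dvd coeff (pcompose F [:a, 1:]) j"
proof (rule ccontr)
  let ?c = "pcompose F [:a, 1:]"
  assume "\<not> ?thesis"
  then have "dvdm 0 (?c - [:coeff ?c 0:])"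
    by (auto simp: dvdm_zero_iff coeff_pCons split: nat.splits)
  then have "dvdm 0 (pcompose (?c - [:coeff ?c 0:]) [:- a, 1:])"
    by (rule dvdm_zero_pcompose)
  then have "int p dvd coeff (F - [:coeff ?c 0:]) i"
    by (simp add: dvdm_zero_iff pcompose_diff pcompose_shift_inverse pcompose_const)
  then show False using assms by (cases i) auto
qed

text \<open>The induction generalises \<open>D\<close> and \<open>F\<close>, because a branch leads
  to another polynomial with its own degree bound s. The shares (s - 1)/(D - 1) of the branches add
  up to at most 1: s - 1 is a root multiplicity of F' modulo p, and F' has degree at most D - 1
  there.\<close>

theorem prime_power_bound:
  assumes "D \<ge> 1" "real p \<ge> 4.41 ^ D" "\<And>i. i > D \<Longrightarrow> int p dvd coeff F i"
    and "i0 \<ge> 1" "\<not> int p dvd coeff F i0"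
  shows "norm (expsum (p ^ m) F) \<le> real p powr (real m * (1 - 1 / real D))"
  using assms
proof (induction m arbitrary: D F i0 rule: less_induct)
  case (less m)
  note D = less.prems(1,2) and high = less.prems(3) and i0 = less.prems(4,5)
  consider "m = 0" | "m = 1" | "m \<ge> 2" by linarith
  then show ?case
  proof cases
    case 1
    moreover have "{0..<1 :: int} = {0}" by auto
    ultimately show ?thesis using p_gt_1 by (simp add: expsum_def)
  next
    case 2
    then show ?thesis using weil_degree_bound[OF D high i0] by simp
  next
    case 3
    have i0D: "i0 \<le> D" using high i0 not_less by blast
    have "1 + real D * 3 \<le> (1 + 3) ^ D" by (rule Bernoulli_inequality) simp
    also have "\<dots> \<le> 4.41 ^ D" by (rule power_mono) auto
    finally have "real D < real p" using D(2) by linarith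
    then have Dp: "D < p" by simp
    define c where "c \<mu> = pcompose F [:\<mu>, 1:]" for \<mu>
    define I where "I \<mu> = (\<Sum>y\<in>{0..<int (p ^ (m - 1))}. e_mod (p ^ m) (poly (c \<mu>) (int p * y)))" for \<mu>
    \<comment> \<open>The first positive index at which F(\<mu> + Y) has a coefficient prime to p;
      it is 1 precisely when \<mu> is not a root of F' modulo p.\<close>
    define s where "s \<mu> = (LEAST j. 1 \<le> j \<and> \<not> int p dvd coeff (c \<mu>) j)" for \<mu>
    have pm: "int (p ^ m) = int p * int (p ^ (m - 1))"
      using 3 by (simp flip: power_Suc)
    have split: "expsum (p ^ m) F = (\<Sum>\<mu>\<in>{0..<int p}. I \<mu>)"
      unfolding expsum_def pm I_def c_def using p_gt_1
      by (subst sum_residue_blocks) (simp_all add: poly_pcompose mult.commute add.commute)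
    have chigh: "int p dvd coeff (c \<mu>) j" if "j > D" for \<mu> j
    proof -
      have "degree (red F) \<le> D"
        using high by (intro degree_le) (auto simp: coeff_red)
      then have "degree (pcompose (red F) [:\<mu>, 1:]) \<le> D"
        using degree_pcompose_le[of "red F" "[:\<mu>, 1:]"] by simp
      then have "coeff (pcompose (red F) [:\<mu>, 1:]) j = 0"
        using that by (intro coeff_eq_0) simp
      moreover have "dvdm 0 (pcompose (F - red F) [:\<mu>, 1:])"
        by (rule dvdm_zero_pcompose[OF red_cong(2)])
      then have "int p dvd coeff (c \<mu>) j - coeff (pcompose (red F) [:\<mu>, 1:]) j"
        by (simp add: dvdm_zero_iff pcompose_diff c_def)
      ultimately show ?thesis by simp
    qed
    have ex: "\<exists>j. 1 \<le> j \<and> \<not> int p dvd coeff (c \<mu>) j" for \<mu>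
      unfolding c_def using i0 by (rule pcompose_shift_nonconst)
    have s: "1 \<le> s \<mu>" "\<not> int p dvd coeff (c \<mu>) (s \<mu>)" for \<mu>
      using LeastI_ex[OF ex[of \<mu>]] unfolding s_def by auto
    have slow: "int p dvd coeff (c \<mu>) j" if "1 \<le> j" "j < s \<mu>" for \<mu> j
      using not_less_Least[of j "\<lambda>j. 1 \<le> j \<and> \<not> int p dvd coeff (c \<mu>) j"] that unfolding s_def by blast
    have sD: "s \<mu> \<le> D" for \<mu> using chigh s(2) not_less by blast
    have I1: "I \<mu> = 0" if "s \<mu> = 1" for \<mu>
      unfolding I_def using 3 s(2)[of \<mu>] that by (intro nonroot_branch_zero) auto
    have I2: "norm (I \<mu>) \<le> real p powr (real m * (1 - 1 / real (s \<mu>)))" if "2 \<le> s \<mu>" for \<mu>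
      unfolding I_def
    proof (rule root_branch_bound[OF _ that s(2) slow])
      fix k g i
      assume g: "k < m" "\<And>i. i > s \<mu> \<Longrightarrow> int p dvd coeff g i" "1 \<le> i" "\<not> int p dvd coeff g i"
      have "(4.41::real) ^ s \<mu> \<le> 4.41 ^ D" using sD by (intro power_increasing) auto
      then have "real p \<ge> 4.41 ^ s \<mu>" using D(2) by linarith
      then show "norm (expsum (p ^ k) g) \<le> real p powr (real k * (1 - 1 / real (s \<mu>)))"
        using less.IH[OF g(1), of "s \<mu>" g i] g s by blast
    qed (use 3 in auto)
    define v where "v \<mu> = s \<mu> - 1" for \<mu>
    have "(\<Sum>\<mu>\<in>{0..<int p}. v \<mu>) \<le> degree (pderiv (red F))"
    proof (rule sum_linear_multiplicity_le)
      \<comment> \<open>Since i0 <= D < p, differentiation does not kill the coefficient of index i0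
        modulo p.\<close>
      have "\<not> int p dvd int i0 * coeff F i0"
        using i0 i0D Dp prime_p by (auto simp: prime_dvd_mult_iff nat_dvd_not_less)
      then have "\<not> int p dvd coeff (pderiv (red F)) (i0 - 1)"
        using i0 by (simp add: coeff_pderiv coeff_red dvd_eq_mod_eq_0 mod_mult_right_eq)
      then show "\<not> dvdm 0 (pderiv (red F))" by (auto simp: dvdm_zero_iff)
    next
      fix \<mu>
      have "dvdm (monom 1 (v \<mu>)) (pderiv (c \<mu>))"
        using slow[of _ \<mu>] by (intro dvdm_monom) (auto simp: coeff_pderiv v_def)
      then have "dvdm (pcompose (monom 1 (v \<mu>)) [:- \<mu>, 1:]) (pcompose (pderiv (c \<mu>)) [:- \<mu>, 1:])"
        by (rule dvdm_pcompose)
      moreover have "pcompose (pderiv (c \<mu>)) [:- \<mu>, 1:] = pderiv F"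
        by (simp add: c_def pderiv_pcompose pderiv_pCons pcompose_shift_inverse)
      moreover have "pcompose (monom 1 n) [:- \<mu>, 1:] = [:- \<mu>, 1:] ^ n" for n
        by (induction n) (simp_all add: monom_Suc pcompose_pCons pcompose_1)
      ultimately have "dvdm ([:- \<mu>, 1:] ^ v \<mu>) (pderiv F)" by simp
      moreover have "dvdm 0 (pderiv F - pderiv (red F))"
        using red_cong(2)[of F] by (auto simp: dvdm_zero_iff coeff_pderiv simp flip: right_diff_distrib)
      ultimately show "dvdm ([:- \<mu>, 1:] ^ v \<mu>) (pderiv (red F))"
        using m.cong_iff dvdm_zeroD by blast
    qed
    also have "\<dots> \<le> D - 1"
    proof -
      have "degree (red F) \<le> D" using high by (intro degree_le) (auto simp: coeff_red)
      then show ?thesis by (simp add: degree_pderiv)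
    qed
    finally have sumv: "(\<Sum>\<mu>\<in>{0..<int p}. v \<mu>) \<le> D - 1" .
    let ?B = "real p powr (real m * (1 - 1 / real D))"
    \<comment> \<open>The factor D - 1 is multiplied out, as it may be 0; for D = 1 every branch
      vanishes.\<close>
    have branch: "norm (I \<mu>) * real (D - 1) \<le> ?B * real (v \<mu>)" for \<mu>
    proof (cases "s \<mu> = 1")
      case False
      then have s2: "2 \<le> s \<mu>" using s(1)[of \<mu>] by linarith
      have "norm (I \<mu>) * real (D - 1) \<le> real p powr (real m * (1 - 1 / real (s \<mu>))) * real (D - 1)"
        using I2[OF s2] by (rule mult_right_mono) simp
      also have "\<dots> \<le> ?B * real (s \<mu> - 1)"
        using s2 sD 3 D(2) by (rule branch_numeric)
      finally show ?thesis by (simp add: v_def)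
    qed (simp add: I1)
    show ?thesis
    proof (cases "D = 1")
      case True
      then have "s \<mu> = 1" for \<mu> using s(1)[of \<mu>] sD[of \<mu>] by linarith
      then show ?thesis by (simp add: split I1)
    next
      case False
      have "norm (expsum (p ^ m) F) * real (D - 1) \<le> (\<Sum>\<mu>\<in>{0..<int p}. norm (I \<mu>)) * real (D - 1)"
        unfolding split by (intro mult_right_mono sum_norm_le) auto
      also have "\<dots> \<le> (\<Sum>\<mu>\<in>{0..<int p}. ?B * real (v \<mu>))"
        unfolding sum_distrib_right by (intro sum_mono branch)
      also have "\<dots> = ?B * real (\<Sum>\<mu>\<in>{0..<int p}. v \<mu>)"
        by (simp add: sum_distrib_left)
      also have "\<dots> \<le> ?B * real (D - 1)"
        using sumv by (intro mult_left_mono of_nat_mono) auto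
      finally show ?thesis using False D(1) by simp
    qed
  qed
qed

end

section \<open>Subset sums\<close>

lemma subsets_card_0: "finite A \<Longrightarrow> {S. S \<subseteq> A \<and> card S = 0} = {{}}"
  by (auto simp: card_eq_0_iff dest: finite_subset)

text \<open>The elementary symmetric functions are, up to sign, the coefficients of the product of
  all 1 - z_x X; the identity is \<open>newton\<close> for this product, with the signs moved
  across.\<close>

lemma elementary_symmetric_newton:
  fixes z :: "'b \<Rightarrow> 'a::comm_ring_1"
  assumes "finite A"
  shows "of_nat k * (\<Sum>S | S \<subseteq> A \<and> card S = k. \<Prod>x\<in>S. z x)
    = (\<Sum>i=1..k. (- 1) ^ (i + 1) * (\<Sum>x\<in>A. z x ^ i) * (\<Sum>S | S \<subseteq> A \<and> card S = k - i. \<Prod>x\<in>S. z x))"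
proof -
  let ?e = "\<lambda>A k. \<Sum>S | S \<subseteq> A \<and> card S = k. \<Prod>x\<in>S. z x"
  have split: "?e (insert a B) (Suc k) = ?e B (Suc k) + z a * ?e B k" if aB: "finite B" "a \<notin> B" for a B k
  proof -
    let ?X = "{S. S \<subseteq> B \<and> card S = Suc k}" and ?Y = "{S. S \<subseteq> B \<and> card S = k}"
    have fin: "finite ?X" "finite ?Y" using aB by auto
    have "{S. S \<subseteq> insert a B \<and> card S = Suc k} = ?X \<union> insert a ` ?Y"
    proof (intro equalityI subsetI)
      fix S assume S: "S \<in> {S. S \<subseteq> insert a B \<and> card S = Suc k}"
      show "S \<in> ?X \<union> insert a ` ?Y"
      proof (cases "a \<in> S")
        case True
        have "finite S" using S aB finite_subset by blast
        then have "S - {a} \<in> ?Y" using S True by (auto simp: card_Diff_singleton)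
        moreover have "S = insert a (S - {a})" using True by auto
        ultimately show ?thesis by blast
      qed (use S in auto)
    next
      fix S assume "S \<in> ?X \<union> insert a ` ?Y"
      then consider "S \<in> ?X" | T where "T \<in> ?Y" "S = insert a T" by blast
      then show "S \<in> {S. S \<subseteq> insert a B \<and> card S = Suc k}"
      proof cases
        case 2
        then have "finite T" "a \<notin> T" using aB finite_subset by auto
        then show ?thesis using 2 by auto
      qed auto
    qed
    then have "?e (insert a B) (Suc k) = ?e B (Suc k) + (\<Sum>S\<in>insert a ` ?Y. \<Prod>x\<in>S. z x)"
      using fin aB by (subst sum.union_disjoint[symmetric]) auto
    also have "(\<Sum>S\<in>insert a ` ?Y. \<Prod>x\<in>S. z x) = (\<Sum>T\<in>?Y. \<Prod>x\<in>insert a T. z x)"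
      using aB by (subst sum.reindex) (auto simp: inj_on_def)
    also have "\<dots> = (\<Sum>T\<in>?Y. z a * (\<Prod>x\<in>T. z x))"
    proof (intro sum.cong refl)
      fix T assume "T \<in> ?Y"
      then have "finite T" "a \<notin> T" using aB finite_subset by auto
      then show "(\<Prod>x\<in>insert a T. z x) = z a * (\<Prod>x\<in>T. z x)" by simp
    qed
    finally show ?thesis by (simp add: sum_distrib_left)
  qed
  have e0: "?e B 0 = 1" if "finite B" for B
    by (simp only: subsets_card_0[OF that]) simp
  have "newton (Abs_fps (\<lambda>k. (- 1) ^ k * ?e A k))
      (\<Sum>x\<in>A. Abs_fps (\<lambda>j. if j = 0 then 0 else z x ^ j))"
  proof -
    have "Abs_fps (\<lambda>k. (- 1) ^ k * ?e A k) = (\<Prod>x\<in>A. 1 - fps_const (z x) * fps_X)"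
      using assms
    proof (induction A rule: finite_induct)
      case empty
      have "{S :: 'b set. S = {} \<and> card S = k} = (if k = 0 then {{}} else {})" for k
        by auto
      then show ?case by (intro fps_ext) auto
    next
      case (insert a B)
      have "Abs_fps (\<lambda>k. (- 1) ^ k * ?e (insert a B) k)
          = (1 - fps_const (z a) * fps_X) * Abs_fps (\<lambda>k. (- 1) ^ k * ?e B k)"
      proof (rule fps_ext)
        fix n
        let ?F = "Abs_fps (\<lambda>k. (- 1) ^ k * ?e B k)"
        have "(1 - fps_const (z a) * fps_X) * ?F = ?F - fps_const (z a) * (fps_X * ?F)"
          by (simp add: algebra_simps)
        then show "Abs_fps (\<lambda>k. (- 1) ^ k * ?e (insert a B) k) $ n = ((1 - fps_const (z a) * fps_X) * ?F) $ n"
          using insert.hyps e0[of B] e0[of "insert a B"]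
          by (cases n) (simp_all add: split algebra_simps)
      qed
      then show ?case using insert by simp
    qed
    then show ?thesis using newton_prod[OF assms newton_linear, of z] by simp
  qed
  then have *: "- (of_nat k * ((- 1) ^ k * ?e A k))
      = (\<Sum>j\<le>k. (\<Sum>x\<in>A. if j = 0 then 0 else z x ^ j) * ((- 1) ^ (k - j) * ?e A (k - j)))"
    unfolding newton_iff by (simp add: mult.commute[of "Abs_fps _"] fps_mult_nth fps_sum_nth atLeast0AtMost)
  have "of_nat k * ?e A k = (- 1) ^ (k + 1) * - (of_nat k * ((- 1) ^ k * ?e A k))"
    by (simp add: algebra_simps flip: power_add power_mult_distrib)
  also have "\<dots> = (\<Sum>j\<le>k. (- 1) ^ (k + 1) *
      ((\<Sum>x\<in>A. if j = 0 then 0 else z x ^ j) * ((- 1) ^ (k - j) * ?e A (k - j))))"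
    unfolding * by (rule sum_distrib_left)
  also have "\<dots> = (\<Sum>i=1..k. (- 1) ^ (k + 1) *
      ((\<Sum>x\<in>A. if i = 0 then 0 else z x ^ i) * ((- 1) ^ (k - i) * ?e A (k - i))))"
    by (rule sum.mono_neutral_right) auto
  also have "\<dots> = (\<Sum>i=1..k. (- 1) ^ (i + 1) * (\<Sum>x\<in>A. z x ^ i) * ?e A (k - i))"
  proof (intro sum.cong refl)
    fix i assume i: "i \<in> {1..k}"
    then have "k + 1 + (k - i) = (i + 1) + 2 * (k - i)" by auto
    then have "(- 1) ^ (k + 1) * (- 1) ^ (k - i) = ((- 1) ^ ((i + 1) + 2 * (k - i)) :: 'a)"
      by (simp only: flip: power_add)
    then have sgn: "(- 1) ^ (k + 1) * (- 1) ^ (k - i) = ((- 1) ^ (i + 1) :: 'a)"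
      by (simp add: power_add)
    have "(\<Sum>x\<in>A. if i = 0 then 0 else z x ^ i) = (\<Sum>x\<in>A. z x ^ i)" using i by simp
    then show "(- 1) ^ (k + 1) * ((\<Sum>x\<in>A. if i = 0 then 0 else z x ^ i) * ((- 1) ^ (k - i) * ?e A (k - i)))
        = (- 1) ^ (i + 1) * (\<Sum>x\<in>A. z x ^ i) * ?e A (k - i)"
      unfolding sgn[symmetric] by (simp add: mult_ac)
  qed
  finally show ?thesis .
qed

text \<open>Newton's identity for the complete symmetric functions when all power sums equal Y, with
  generating function (1 - X)^(- Y). This is why such binomial coefficients serve as
  majorants.\<close>

lemma gchoose_recurrence:
  fixes Y :: real
  shows "real k * ((Y + real k - 1) gchoose k) = Y * (\<Sum>i<k. (Y + real i - 1) gchoose i)"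
proof (cases k)
  case (Suc n)
  have "(\<Sum>i<k. (Y + real i - 1) gchoose i) = (\<Sum>i\<le>n. (Y - 1 + of_nat i) gchoose i)"
    by (simp add: Suc lessThan_Suc_atMost algebra_simps)
  also have "\<dots> = (Y + real n) gchoose n"
    using gbinomial_parallel_sum[of "Y - 1" n] by (simp add: algebra_simps)
  finally have "Y * (\<Sum>i<k. (Y + real i - 1) gchoose i) = Y * ((Y + real n) gchoose n)" by simp
  also have "\<dots> = real k * ((Y + real k - 1) gchoose k)"
    using gbinomial_absorb_comp[of "Y + real n" n] gbinomial_absorption[of n "Y + real n"]
    by (simp add: Suc algebra_simps)
  finally show ?thesis by simp
qed simp

text \<open>Consecutive values satisfy (k + 1) C_(k+1) = (Y + k) C_k, so they increase once Y >=
  1.\<close>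

lemma gchoose_mono_index:
  fixes Y :: real
  assumes "Y \<ge> 1"
  shows "0 \<le> (Y + real k - 1) gchoose k" and "(Y + real k - 1) gchoose k \<le> (Y + real (Suc k) - 1) gchoose (Suc k)"
proof -
  have "0 \<le> (Y + real k - 1) - real i" if "i \<in> {0..<k}" for i
    using that assms by auto
  then show 0: "0 \<le> (Y + real k - 1) gchoose k"
    unfolding gbinomial_prod_rev by (intro divide_nonneg_nonneg prod_nonneg) simp_all
  have "real (Suc k) * ((Y + real (Suc k) - 1) gchoose (Suc k))
      = Y * (\<Sum>i<k. (Y + real i - 1) gchoose i) + Y * ((Y + real k - 1) gchoose k)"
    unfolding gchoose_recurrence by (simp only: sum.lessThan_Suc distrib_left)
  also have "\<dots> = (Y + real k) * ((Y + real k - 1) gchoose k)"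
    unfolding gchoose_recurrence[symmetric] by (simp only: distrib_right add.commute)
  also have "\<dots> \<ge> real (Suc k) * ((Y + real k - 1) gchoose k)"
    using assms 0 by (intro mult_right_mono) auto
  finally show "(Y + real k - 1) gchoose k \<le> (Y + real (Suc k) - 1) gchoose (Suc k)"
    by (rule mult_left_le_imp_le) simp
qed

text \<open>By monotonicity C (k - i) is at most each of the h values at k - i, ..., k - i + h - 1,
  and for distinct multiples i of h these blocks are disjoint.\<close>

lemma sum_multiples_le:
  fixes C :: "nat \<Rightarrow> real"
  assumes mono: "\<And>i j. i \<le> j \<Longrightarrow> C i \<le> C j" and nonneg: "\<And>i. 0 \<le> C i" and h: "h > 0"
  shows "real h * (\<Sum>i | i \<in> {1..k} \<and> h dvd i. C (k - i)) \<le> (\<Sum>i<k. C i)"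
proof (induction k rule: less_induct)
  case (less k)
  show ?case
  proof (cases "h \<le> k")
    case False
    then have "{i. i \<in> {1..k} \<and> h dvd i} = {}" by (auto dest: dvd_imp_le)
    then have "(\<Sum>i | i \<in> {1..k} \<and> h dvd i. C (k - i)) = 0" by (simp only: sum.empty)
    then show ?thesis using nonneg by (simp add: sum_nonneg)
  next
    case True
    have set: "{i. i \<in> {1..k} \<and> h dvd i} = insert h ((\<lambda>i. i + h) ` {i. i \<in> {1..k - h} \<and> h dvd i})"
    proof (intro equalityI subsetI)
      fix i assume i: "i \<in> {i. i \<in> {1..k} \<and> h dvd i}"
      show "i \<in> insert h ((\<lambda>i. i + h) ` {i. i \<in> {1..k - h} \<and> h dvd i})"
      proof (cases "i = h")
        case False
        then have "h < i" using i dvd_imp_le[of h i] by auto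
        then show ?thesis using i by (intro insertI2 image_eqI[of _ _ "i - h"]) auto
      qed simp
    qed (use True h in auto)
    have "(\<Sum>i | i \<in> {1..k} \<and> h dvd i. C (k - i))
        = C (k - h) + (\<Sum>i | i \<in> {1..k - h} \<and> h dvd i. C (k - h - i))"
      unfolding set by (subst sum.insert) (auto simp: sum.reindex inj_on_def add.commute)
    then have "real h * (\<Sum>i | i \<in> {1..k} \<and> h dvd i. C (k - i))
        \<le> (\<Sum>i\<in>{k - h..<k}. C (k - h)) + (\<Sum>i<k - h. C i)"
      using less.IH[of "k - h"] True h by (simp add: distrib_left)
    also have "\<dots> \<le> (\<Sum>i\<in>{k - h..<k}. C i) + (\<Sum>i<k - h. C i)"
      by (intro add_right_mono sum_mono mono) auto
    also have "\<dots> = (\<Sum>i<k. C i)"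
      using True sum.atLeastLessThan_concat[of 0 "k - h" k C] by (simp add: lessThan_atLeast0)
    finally show ?thesis .
  qed
qed

text \<open>
  The bound $C_k = \binom{Y + k - 1}{k}$ satisfies $k C_k = Y \sum_{i<k} C_i$; since $C$ is increasing, the
  indices divisible by $h$ contribute at most the fraction $1/h$ of such a sum.
\<close>
theorem elementary_symmetric_bound:
  fixes z :: "'b \<Rightarrow> complex" and B X Y :: real
  assumes fin: "finite A" and h: "h > 0" and B: "1 \<le> B" "B \<le> X"
    and Y: "B + (X - B) / real h \<le> Y"
    and big: "\<And>i. h dvd i \<Longrightarrow> norm (\<Sum>x\<in>A. z x ^ i) \<le> X"
    and small: "\<And>i. \<not> h dvd i \<Longrightarrow> norm (\<Sum>x\<in>A. z x ^ i) \<le> B"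
  shows "norm (\<Sum>S | S \<subseteq> A \<and> card S = k. \<Prod>x\<in>S. z x) \<le> (Y + real k - 1) gchoose k"
proof (induction k rule: less_induct)
  case (less k)
  let ?e = "\<lambda>k. \<Sum>S | S \<subseteq> A \<and> card S = k. \<Prod>x\<in>S. z x"
  define C where "C k = (Y + real k - 1) gchoose k" for k
  have "0 \<le> (X - B) / real h" using B by simp
  then have Y1: "Y \<ge> 1" using B Y by linarith
  have C0: "0 \<le> C i" for i unfolding C_def using Y1 by (rule gchoose_mono_index)
  have Cmono: "C i \<le> C j" if "i \<le> j" for i j
    using that gchoose_mono_index(2)[OF Y1] unfolding C_def by (rule lift_Suc_mono_le[rotated])
  show ?case
  proof (cases "k = 0")
    case True
    then show ?thesis by (simp only: subsets_card_0[OF fin]) simp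
  next
    case False
    have rev: "(\<Sum>i=1..k. C (k - i)) = (\<Sum>i<k. C i)"
      by (rule sum.reindex_bij_witness[of _ "\<lambda>i. k - i" "\<lambda>i. k - i"]) auto
    have "real k * norm (?e k) = norm (of_nat k * ?e k)" by (simp add: norm_mult)
    \<comment> \<open>Every index pays B, and the multiples of h pay the excess X - B on
      top.\<close>
    also have "\<dots> \<le> (\<Sum>i=1..k. (B + (if h dvd i then X - B else 0)) * C (k - i))"
      unfolding elementary_symmetric_newton[OF fin]
    proof (rule sum_norm_le)
      fix i assume i: "i \<in> {1..k}"
      have "norm (\<Sum>x\<in>A. z x ^ i) \<le> B + (if h dvd i then X - B else 0)"
        using big small by auto
      moreover have "norm (?e (k - i)) \<le> C (k - i)"
        unfolding C_def using i by (intro less.IH) auto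
      ultimately show "norm ((- 1) ^ (i + 1) * (\<Sum>x\<in>A. z x ^ i) * ?e (k - i))
          \<le> (B + (if h dvd i then X - B else 0)) * C (k - i)"
        using B by (simp add: norm_mult norm_power mult_mono)
    qed
    also have "\<dots> = B * (\<Sum>i=1..k. C (k - i)) + (X - B) * (\<Sum>i=1..k. if h dvd i then C (k - i) else 0)"
      by (simp add: distrib_right sum.distrib sum_distrib_left if_distrib[of "\<lambda>x. x * _"] if_distrib[of "\<lambda>x. _ * x"] cong: if_cong)
    also have "(\<Sum>i=1..k. if h dvd i then C (k - i) else 0) = (\<Sum>i | i \<in> {1..k} \<and> h dvd i. C (k - i))"
      by (rule sum.inter_filter[symmetric]) simp
    also have "\<dots> \<le> (\<Sum>i<k. C i) / real h"
      using sum_multiples_le[where C = C and k = k, OF Cmono C0 h] h by (simp add: field_simps)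
    finally have "real k * norm (?e k) \<le> B * (\<Sum>i=1..k. C (k - i)) + (X - B) * ((\<Sum>i<k. C i) / real h)"
      using B by (simp add: mult_left_mono)
    also have "\<dots> = (B + (X - B) / real h) * (\<Sum>i<k. C i)"
      unfolding rev by (simp add: algebra_simps)
    also have "\<dots> \<le> Y * (\<Sum>i<k. C i)"
      using Y C0 by (intro mult_right_mono sum_nonneg) auto
    also have "\<dots> = real k * C k"
      unfolding C_def by (rule gchoose_recurrence[symmetric])
    finally show ?thesis using False by (simp add: C_def)
  qed
qed

section \<open>The function \<open>delta\<close> and the smallest prime divisor\<close>

lemma moebius_prime:
  fixes q :: nat
  assumes "prime q"
  shows "moebius q = - 1"
  using assms by (simp add: moebius_def squarefree_prime prime_factorization_prime)

lemma delta_ge: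
  assumes "n > 0" "prime q" "q dvd n"
  shows "1 / real q \<le> delta n"
  unfolding delta_def
proof (rule member_le_sum)
  show "q \<in> {i. i dvd n \<and> moebius i = - 1}" using assms moebius_prime by simp
  show "finite {i. i dvd n \<and> moebius i = - 1}"
    using assms(1) by (intro finite_subset[OF _ finite_divisors_nat[of n]]) auto
qed auto

lemma delta_prime_power:
  assumes q: "prime q" and m: "m > 0"
  shows "delta (q ^ m) = 1 / real q"
proof -
  have "{i. i dvd q ^ m \<and> moebius i = - 1} = {q}"
  proof (intro equalityI subsetI)
    fix i assume i: "i \<in> {i. i dvd q ^ m \<and> moebius i = - 1}"
    then obtain j where j: "i = q ^ j" using divides_primepow_nat[OF q] by auto
    have "squarefree i" using i by (auto simp: moebius_def split: if_splits)
    then have "\<not> q ^ 2 dvd i" using q unfolding squarefree_def by (metis not_prime_unit)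
    then have "j < 2" unfolding j by (meson le_imp_power_dvd not_le)
    moreover have "moebius 1 = 1" by (simp add: moebius_def)
    then have "j \<noteq> 0" using i j by (intro notI) simp
    ultimately have "j = 1" by simp
    then show "i \<in> {q}" by (simp add: j)
  next
    fix i assume "i \<in> {q}"
    then show "i \<in> {i. i dvd q ^ m \<and> moebius i = - 1}" using q m moebius_prime by simp
  qed
  then show ?thesis by (simp add: delta_def)
qed

lemma smallest_prime_divisor_props:
  assumes "n \<ge> 2"
  shows "prime (smallest_prime_divisor n)" "smallest_prime_divisor n dvd n"
    and "\<And>q. prime q \<Longrightarrow> q dvd n \<Longrightarrow> smallest_prime_divisor n \<le> q"
proof -
  obtain q where "prime q \<and> q dvd n" using prime_factor_nat[of n] assms by auto
  from LeastI[of "\<lambda>p. prime p \<and> p dvd n", OF this]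
  show "prime (smallest_prime_divisor n)" "smallest_prime_divisor n dvd n"
    by (auto simp: smallest_prime_divisor_def)
  show "smallest_prime_divisor n \<le> q" if "prime q" "q dvd n" for q
    unfolding smallest_prime_divisor_def using that by (intro Least_le) simp
qed

text \<open>Write h = h' q^m with q not dividing h', and x = r + h' y. For fixed r the character
  modulo h becomes one modulo q^m in y, so all cancellation comes from the single prime q, and the
  blocks are added trivially.\<close>

lemma complete_sum_bound:
  fixes F :: "int poly"
  assumes n: "n > 0" "h dvd n" and q: "prime q" "q dvd h" and a: "\<not> int q dvd a"
    and F: "degree F = d" "d > 0" and i: "i \<ge> 1" "\<not> int q dvd coeff F i"
    and qd: "real q \<ge> 4.41 ^ d"
  shows "norm (\<Sum>x\<in>{0..<int n}. e_mod h (a * poly F x)) \<le> real n * real q powr (- 1 / real d)"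
proof -
  interpret prime_modulus q by standard (rule q)
  have h: "h > 0" using n by (auto intro: Nat.gr0I)
  obtain h' where h': "h = q ^ multiplicity q h * h'" "\<not> q dvd h'"
    using multiplicity_decompose'[of h q] h q by (metis not_prime_unit less_not_refl)
  define m where "m = multiplicity q h"
  have hm: "h = h' * q ^ m" using h'(1) by (simp add: m_def mult.commute)
  have m: "m \<ge> 1" using h'(2) q(2) hm by (cases m) auto
  have h'0: "h' > 0" using h hm by (cases h') auto
  have q1: "real q > 1" using p_gt_1 by simp
  have block: "norm (\<Sum>y\<in>{0..<int (q ^ m)}. e_mod h (a * poly F (r + int h' * y)))
      \<le> real q powr (real m * (1 - 1 / real d))" for r
  proof -
    define c where "c = pcompose F [:r, 1:]"
    obtain c0 c1 where c: "c = pCons c0 c1" by (cases c)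
    \<comment> \<open>The polynomial a (F(r + h' Y) - F(r)) with one factor h' removed. The
      remaining powers of h' are units modulo q, so \<open>G\<close> is still nonconstant modulo
      q.\<close>
    define G where "G = smult a (pCons 0 (pcompose c1 [:0, int h':]))"
    have cG: "coeff G (Suc j) = a * (int h' ^ j * coeff c (Suc j))" for j
      by (simp add: G_def c coeff_pcompose_linear)
    have "a * poly F (r + int h' * y) = a * c0 + int h' * poly G y" for y
    proof -
      have "poly F (r + int h' * y) = poly c (int h' * y)" by (simp add: c_def poly_pcompose)
      then show ?thesis by (simp add: c G_def poly_pcompose algebra_simps)
    qed
    then have "e_mod h (a * poly F (r + int h' * y)) = e_mod h (a * c0) * e_mod (q ^ m) (poly G y)" for y
      using h'0 by (simp add: e_mod_add hm e_mod_mult_cancel)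
    then have "norm (\<Sum>y\<in>{0..<int (q ^ m)}. e_mod h (a * poly F (r + int h' * y))) = norm (expsum (q ^ m) G)"
      by (simp add: expsum_def norm_mult flip: sum_distrib_left)
    also have "\<dots> \<le> real q powr (real m * (1 - 1 / real d))"
    proof -
      obtain j where j: "1 \<le> j" "\<not> int q dvd coeff c j"
        using pcompose_shift_nonconst[OF i] by (auto simp: c_def)
      obtain l where l: "j = Suc l" using j(1) by (cases j) auto
      have "\<not> int q dvd coeff G j"
        using a h'(2) j(2) q(1) prime_dvd_power[of "int q" "int h'" l]
        by (auto simp: l cG prime_dvd_mult_iff)
      moreover have "int q dvd coeff G i" if id: "i > d" for i
      proof -
        obtain l where l: "i = Suc l" using id by (cases i) auto
        have "degree c \<le> d" using degree_pcompose_le[of F "[:r, 1:]"] F by (simp add: c_def)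
        then have "coeff c i = 0" using id by (intro coeff_eq_0) simp
        then show ?thesis by (simp add: l cG)
      qed
      ultimately show ?thesis
        using F(2) qd j(1) by (intro prime_power_bound[of d G j m]) auto
    qed
    finally show ?thesis .
  qed
  obtain K where K: "n = h * K" using n(2) by blast
  have "(\<Sum>x\<in>{0..<int n}. e_mod h (a * poly F x)) = of_nat K * expsum h (smult a F)"
    using sum_e_mod_poly_multiple[OF h, of "smult a F" K] by (simp add: K)
  also have "expsum h (smult a F) = (\<Sum>r\<in>{0..<int h'}. \<Sum>y\<in>{0..<int (q ^ m)}. e_mod h (a * poly F (r + int h' * y)))"
  proof -
    have "int h = int h' * int (q ^ m)" by (simp add: hm)
    then show ?thesis
      unfolding expsum_def using h'0 by (simp only: poly_smult sum_residue_blocks of_nat_0_less_iff)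
  qed
  finally have "norm (\<Sum>x\<in>{0..<int n}. e_mod h (a * poly F x))
      = real K * norm (\<Sum>r\<in>{0..<int h'}. \<Sum>y\<in>{0..<int (q ^ m)}. e_mod h (a * poly F (r + int h' * y)))"
    by (simp add: norm_mult)
  also have "\<dots> \<le> real K * (\<Sum>r\<in>{0..<int h'}. real q powr (real m * (1 - 1 / real d)))"
    by (intro mult_left_mono sum_norm_le block) auto
  also have "\<dots> = real K * real h' * real q powr (real m * (1 - 1 / real d))" by simp
  also have "real q powr (real m * (1 - 1 / real d)) \<le> real q powr (real m + - 1 / real d)"
  proof (rule powr_mono)
    have "1 / real d \<le> real m / real d" using m F(2) by (intro divide_right_mono) auto
    then show "real m * (1 - 1 / real d) \<le> real m + - 1 / real d" by (simp add: algebra_simps)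
  qed (use q1 in simp)
  also have "real K * real h' * (real q powr (real m + - 1 / real d)) = real n * real q powr (- 1 / real d)"
    using q1 by (simp only: powr_add powr_realpow K hm) simp
  finally show ?thesis by (simp add: mult_left_mono)
qed

text \<open>An arbitrary C >= 4.41 covers both constants at once. In the bound for the incomplete
  sums, the summand c accounts for the points outside \<open>D\<close>.\<close>

theorem subset_sum_bound:
  fixes n d p c k :: nat and f :: "int poly" and C :: real and D :: "int set"
  assumes n: "n \<ge> 2" and p: "p = smallest_prime_divisor n"
    and f: "degree f = d" "d > 0"
    and gcd: "Gcd (insert (int n) (coeff f ` {1..d})) = 1"
    and C: "C \<ge> 4.41"
    and D: "D \<subseteq> {0..<int n}" and card_D: "real (card D) = real n - real c"
    and large: "real n - real c \<ge> C * real n * real p powr (- 1 / real d) + real c"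
  shows "\<bar>real (subset_sum_count n f D k b) - 1 / real n * ((real n - real c) gchoose k)\<bar>
    \<le> (delta n * (real n - real c) + (1 - delta n) * (C * real n * real p powr (- 1 / real d) + real c)
        + real k - 1) gchoose k"
proof -
  define B where "B = C * real n * real p powr (- 1 / real d) + real c"
  define X where "X = real n - real c"
  define Y where "Y = delta n * X + (1 - delta n) * B"
  note p_props = smallest_prime_divisor_props[OF n, folded p]
  have n0: "n > 0" using n by simp
  have finD: "finite D" using D finite_subset by blast
  have p1: "real p > 1" using prime_gt_1_nat[OF p_props(1)] by simp
  have XB: "X \<ge> B" using large by (simp add: X_def B_def)
  have p_large: "real p \<ge> 4.41 ^ d"
  proof -
    have "C * real n * real p powr (- 1 / real d) \<le> real n" using large by linarith
    then have "C * real p powr (- 1 / real d) \<le> 1" using n0 by (simp add: field_simps)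
    then have "C * real p powr (- 1 / real d) * real p powr (1 / real d) \<le> 1 * real p powr (1 / real d)"
      by (intro mult_right_mono) auto
    then have "C \<le> real p powr (1 / real d)"
      using p1 by (simp add: mult.assoc flip: powr_add)
    then have "4.41 \<le> real p powr (1 / real d)" using C by linarith
    then have "4.41 ^ d \<le> (real p powr (1 / real d)) ^ d" by (intro power_mono) auto
    also have "\<dots> = real p" using p1 f(2) by (simp add: powr_powr flip: powr_realpow)
    finally show ?thesis .
  qed
  have B1: "B \<ge> 1"
  proof -
    have "1 \<le> real p powr (1 + - 1 / real d)"
      using p1 f(2) by (intro ge_one_powr_ge_zero) auto
    also have "\<dots> = real p * real p powr (- 1 / real d)" using p1 by (subst powr_add) simp
    also have "\<dots> \<le> real n * real p powr (- 1 / real d)"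
      using p_props(2) n0 dvd_imp_le by (intro mult_right_mono) auto
    also have "\<dots> \<le> C * (real n * real p powr (- 1 / real d))"
      using C mult_right_mono[of 1 C "real n * real p powr (- 1 / real d)"] by simp
    finally show ?thesis by (simp add: B_def mult.assoc)
  qed
  have incomplete: "norm (\<Sum>x\<in>D. e_mod n (a * poly f x)) \<le> B" if a: "\<not> int n dvd a" for a
  proof -
    \<comment> \<open>In lowest terms a / n = a' / h, where h is the order of the character; h > 1
      because n does not divide a.\<close>
    define g where "g = nat (gcd a (int n))"
    have g: "int g = gcd a (int n)" by (simp add: g_def)
    have g0: "g > 0" using g n0 by (simp add: g_def)
    obtain h where h: "n = g * h" using g by (metis gcd_dvd2 dvdE of_nat_dvd_iff)
    obtain a' where a': "a = int g * a'" using g by (metis gcd_dvd1 dvdE)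
    have "int g = gcd (int g * a') (int g * int h)" using g a' h by simp
    then have "int g * 1 = int g * gcd a' (int h)" by (simp add: gcd_mult_distrib_int[symmetric])
    then have cop: "gcd a' (int h) = 1" using g0 by simp
    have "h \<noteq> 1" using a a' h by auto
    then obtain q where q: "prime q" "q dvd h" using prime_factor_nat by blast
    have qn: "q dvd n" using q(2) by (simp add: h)
    have pq: "p \<le> q" using p_props(3)[OF q(1) qn] .
    have qa: "\<not> int q dvd a'"
    proof
      assume "int q dvd a'"
      then have "int q dvd gcd a' (int h)" using q(2) by simp
      then show False using cop prime_gt_1_nat[OF q(1)] by simp
    qed
    \<comment> \<open>The gcd hypothesis enters here: some nonconstant coefficient of f survives
      modulo q.\<close>
    obtain i where i: "i \<in> {1..d}" "\<not> int q dvd coeff f i"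
    proof -
      have "\<not> (\<forall>i\<in>{1..d}. int q dvd coeff f i)"
      proof
        assume "\<forall>i\<in>{1..d}. int q dvd coeff f i"
        then have "int q dvd Gcd (insert (int n) (coeff f ` {1..d}))"
          using qn by (intro Gcd_greatest) auto
        then have "int q dvd 1" by (simp only: gcd)
        then show False using prime_gt_1_nat[OF q(1)] by simp
      qed
      then show ?thesis using that by blast
    qed
    have "e_mod n (a * t) = e_mod h (a' * t)" for t
      using e_mod_mult_cancel[OF g0, of h "a' * t"] by (simp add: h a' mult.assoc)
    then have "norm (\<Sum>x\<in>{0..<int n}. e_mod n (a * poly f x)) = norm (\<Sum>x\<in>{0..<int n}. e_mod h (a' * poly f x))"
      by simp
    also have "\<dots> \<le> real n * real q powr (- 1 / real d)"
      using n0 q qa f i pq p_large by (intro complete_sum_bound[of n h q a' f d i]) (auto simp: h)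
    also have "\<dots> \<le> real n * real p powr (- 1 / real d)"
      using pq p1 by (intro mult_left_mono powr_mono2') auto
    also have "\<dots> \<le> C * real n * real p powr (- 1 / real d)"
      using C mult_right_mono[of 1 C "real n * real p powr (- 1 / real d)"] by (simp add: mult.assoc)
    finally have full: "norm (\<Sum>x\<in>{0..<int n}. e_mod n (a * poly f x)) \<le> C * real n * real p powr (- 1 / real d)" .
    have "norm (\<Sum>x\<in>{0..<int n} - D. e_mod n (a * poly f x)) \<le> (\<Sum>x\<in>{0..<int n} - D. 1)"
      by (rule sum_norm_le) simp
    also have "\<dots> = real c"
      using card_D D finD card_mono[OF _ D] by (simp add: card_Diff_subset of_nat_diff)
    finally have compl: "norm (\<Sum>x\<in>{0..<int n} - D. e_mod n (a * poly f x)) \<le> real c" .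
    have "(\<Sum>x\<in>D. e_mod n (a * poly f x)) = (\<Sum>x\<in>{0..<int n}. e_mod n (a * poly f x))
        - (\<Sum>x\<in>{0..<int n} - D. e_mod n (a * poly f x))"
      using D by (simp add: sum_diff)
    then show ?thesis
      using full compl norm_triangle_ineq4 unfolding B_def by (smt (verit))
  qed
  define E where "E a = (\<Sum>S | S \<subseteq> D \<and> card S = k. \<Prod>x\<in>S. e_mod n (a * poly f x))" for a
  have E_bound: "norm (E a) \<le> (Y + real k - 1) gchoose k" if a: "a \<in> {1..<int n}" for a
  proof -
    define g where "g = nat (gcd a (int n))"
    have g: "int g = gcd a (int n)" by (simp add: g_def)
    have g0: "g > 0" using g n0 by (simp add: g_def)
    obtain h where h: "n = g * h" using g by (metis gcd_dvd2 dvdE of_nat_dvd_iff)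
    obtain a' where a': "a = int g * a'" using g by (metis gcd_dvd1 dvdE)
    have h0: "h > 0" using n0 h by (cases h) auto
    have "int g = gcd (int g * a') (int g * int h)" using g a' h by simp
    then have "int g * 1 = int g * gcd a' (int h)" by (simp add: gcd_mult_distrib_int[symmetric])
    then have cop: "coprime a' (int h)" using g0 by (simp add: coprime_iff_gcd_eq_1)
    have iff: "h dvd i \<longleftrightarrow> int n dvd int i * a" for i
    proof -
      have "int n dvd int i * a \<longleftrightarrow> int g * int h dvd int g * (int i * a')" by (simp add: h a' mult_ac)
      also have "\<dots> \<longleftrightarrow> int h dvd int i * a'" using g0 by simp
      also have "\<dots> \<longleftrightarrow> int h dvd int i"
        using cop by (simp add: coprime_commute coprime_dvd_mult_left_iff)
      finally show ?thesis by simp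
    qed
    have "h \<noteq> 1" using iff[of 1] a by (auto dest: zdvd_imp_le)
    then obtain q where q: "prime q" "q dvd h" using prime_factor_nat by blast
    \<comment> \<open>The order h has a prime divisor q, and the Moebius value -1 at q puts 1 / q
      among the terms of \<open>delta n\<close>.\<close>
    have "1 / real h \<le> 1 / real q"
      using q h0 dvd_imp_le[of q h] prime_gt_0_nat[OF q(1)] by (simp add: frac_le)
    also have "\<dots> \<le> delta n" using n0 q by (intro delta_ge) (auto simp: h)
    finally have "(X - B) * (1 / real h) \<le> (X - B) * delta n" using XB by (intro mult_left_mono) auto
    then have Y: "B + (X - B) / real h \<le> Y" by (simp add: Y_def algebra_simps)
    have pow: "e_mod n (a * poly f x) ^ i = e_mod n (int i * a * poly f x)" for i x
      by (simp add: e_mod_power mult.assoc)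
    show ?thesis
      unfolding E_def
    proof (rule elementary_symmetric_bound[OF finD h0 B1 XB Y])
      fix i assume "h dvd i"
      then have "e_mod n (int i * a * poly f x) = 1" for x
        using iff e_mod_eq_1_iff[OF n0] by simp
      then show "norm (\<Sum>x\<in>D. e_mod n (a * poly f x) ^ i) \<le> X"
        using card_D by (simp add: pow X_def)
    next
      fix i assume "\<not> h dvd i"
      then show "norm (\<Sum>x\<in>D. e_mod n (a * poly f x) ^ i) \<le> B"
        unfolding pow using iff by (intro incomplete) simp
    qed
  qed
  let ?N = "subset_sum_count n f D k b"
  let ?T = "{S. S \<subseteq> D \<and> card S = k}"
  have finT: "finite ?T" using finD by simp
  have "of_nat n * of_nat ?N = (\<Sum>S\<in>?T. \<Sum>a\<in>{0..<int n}. e_mod n (((\<Sum>x\<in>S. poly f x) - b) * a))"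
  proof -
    have "{S. S \<subseteq> D \<and> card S = k \<and> [\<Sum>x\<in>S. poly f x = b] (mod int n)}
        = {S \<in> ?T. int n dvd (\<Sum>x\<in>S. poly f x) - b}"
      by (auto simp: cong_iff_dvd_diff)
    then have "of_nat n * (of_nat ?N :: complex) = (\<Sum>S\<in>{S \<in> ?T. int n dvd (\<Sum>x\<in>S. poly f x) - b}. of_nat n)"
      by (simp add: subset_sum_count_def)
    also have "\<dots> = (\<Sum>S\<in>?T. if int n dvd (\<Sum>x\<in>S. poly f x) - b then of_nat n else 0)"
      by (rule sum.inter_filter[OF finT])
    finally show ?thesis by (simp only: sum_e_mod[OF n0])
  qed
  also have "\<dots> = (\<Sum>a\<in>{0..<int n}. e_mod n (- (a * b)) * E a)"
    unfolding E_def sum_distrib_left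
    by (subst sum.swap, intro sum.cong refl)
      (simp add: algebra_simps sum_distrib_left flip: e_mod_sum e_mod_add)
  also have "{0..<int n} = insert 0 {1..<int n}" using n0 by auto
  also have "(\<Sum>a\<in>insert 0 {1..<int n}. e_mod n (- (a * b)) * E a)
      = of_nat (card D choose k) + (\<Sum>a\<in>{1..<int n}. e_mod n (- (a * b)) * E a)"
    using n_subsets[OF finD, of k] by (simp add: E_def)
  finally have "of_nat n * of_nat ?N - of_nat (card D choose k) = (\<Sum>a\<in>{1..<int n}. e_mod n (- (a * b)) * E a)"
    by simp
  moreover have "norm (\<Sum>a\<in>{1..<int n}. e_mod n (- (a * b)) * E a)
      \<le> (\<Sum>a\<in>{1..<int n}. (Y + real k - 1) gchoose k)"
    by (intro sum_norm_le) (simp add: norm_mult E_bound)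
  moreover have "nat (int n - 1) = n - 1" using n0 by linarith
  ultimately have "norm (of_nat n * of_nat ?N - of_nat (card D choose k) :: complex)
      \<le> real (n - 1) * ((Y + real k - 1) gchoose k)"
    by (simp add: of_nat_diff)
  also have "(of_nat n * of_nat ?N - of_nat (card D choose k) :: complex)
      = of_real (real n * real ?N - real (card D choose k))"
    by simp
  finally have diff: "\<bar>real n * real ?N - real (card D choose k)\<bar> \<le> real (n - 1) * ((Y + real k - 1) gchoose k)"
    by (simp only: norm_of_real)
  \<comment> \<open>Because n >= 2 there is the nontrivial a = 1, whose estimate shows that the
    majorant is nonnegative.\<close>
  have nonneg: "0 \<le> (Y + real k - 1) gchoose k"
    using E_bound[of 1] n by (intro order_trans[OF norm_ge_zero[of "E 1"]]) simp
  have "real (card D choose k) = (real n - real c) gchoose k"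
    using card_D by (simp add: binomial_gbinomial)
  then have "real ?N - 1 / real n * ((real n - real c) gchoose k) = (real n * real ?N - real (card D choose k)) / real n"
    using n0 by (simp add: field_simps)
  then have "\<bar>real ?N - 1 / real n * ((real n - real c) gchoose k)\<bar>
      \<le> real (n - 1) * ((Y + real k - 1) gchoose k) / real n"
    using diff n0 by (simp add: abs_divide divide_right_mono)
  also have "\<dots> \<le> (Y + real k - 1) gchoose k"
    using nonneg n0 by (simp add: divide_le_eq mult_right_mono mult.commute)
  finally show ?thesis by (simp add: Y_def X_def B_def)
qed

text \<open>Already the quadratic Taylor polynomial gives 1 + 1.85 + 1.85^2 / 2 > 4.56, which
  settles d = 1.\<close>

lemma exp_constant_ge:
  assumes "d > 0"
  shows "4.41 \<le> exp (1.85 * real d)"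
proof -
  have "4.41 \<le> 1 + 1.85 + (1.85::real)\<^sup>2 / 2" by (simp add: power2_eq_square)
  also have "\<dots> \<le> exp 1.85" by (rule exp_lower_Taylor_quadratic) simp
  also have "\<dots> \<le> exp (1.85 * real d)" using assms by simp
  finally show ?thesis .
qed

lemma smallest_prime_divisor_prime_power:
  assumes "prime q" "m > 0"
  shows "smallest_prime_divisor (q ^ m) = q"
proof -
  have "2 \<le> q" using assms(1) by (rule prime_ge_2_nat)
  also have "q \<le> q ^ m" using assms prime_gt_0_nat[OF assms(1)] by (intro self_le_power) auto
  finally have n: "q ^ m \<ge> 2" .
  have "smallest_prime_divisor (q ^ m) dvd q"
    using smallest_prime_divisor_props(1,2)[OF n] prime_dvd_power by blast
  then show ?thesis
    using smallest_prime_divisor_props(1)[OF n] assms(1) by (simp add: primes_dvd_imp_eq)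
qed

theorem theorem1p3:
  fixes n d p :: nat and f :: "int poly"
  assumes "n \<ge> 2"
    and "p = smallest_prime_divisor n"
    and "Polynomial.degree f = d" and "d > 0"
    and "Gcd (insert (int n) (poly.coeff f ` {1..d})) = 1"
  shows "(\<forall>(D :: int set) (c :: nat) (b :: int) (k :: nat).
           D \<subseteq> {0..<int n} \<longrightarrow> b \<in> {0..<int n} \<longrightarrow> k \<le> card D \<longrightarrow>
           real (card D) = real n - real c \<longrightarrow>
           real n - real c \<ge> exp (1.85 * real d) * real n * real p powr (- 1 / real d) + real c \<longrightarrow>
           \<bar>real (subset_sum_count n f D k b) - 1 / real n * ((real n - real c) gchoose k)\<bar>
             \<le> (delta n * (real n - real c)
                  + (1 - delta n) *
                      (exp (1.85 * real d) * real n * real p powr (- 1 / real d) + real c)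
                  + real k - 1) gchoose k)
       \<and> (primepow n \<longrightarrow>
         delta n = 1 / real p \<and>
         (\<forall>(D :: int set) (c :: nat) (b :: int) (k :: nat).
           D \<subseteq> {0..<int n} \<longrightarrow> b \<in> {0..<int n} \<longrightarrow> k \<le> card D \<longrightarrow>
           real (card D) = real n - real c \<longrightarrow>
           real n - real c \<ge> 4.41 * real n * real p powr (- 1 / real d) + real c \<longrightarrow>
           \<bar>real (subset_sum_count n f D k b) - 1 / real n * ((real n - real c) gchoose k)\<bar>
             \<le> (delta n * (real n - real c)
                  + (1 - delta n) *
                      (4.41 * real n * real p powr (- 1 / real d) + real c)
                  + real k - 1) gchoose k))"
proof -
  define \<Theta> where "\<Theta> C \<longleftrightarrow> (\<forall>(D :: int set) (c :: nat) (b :: int) (k :: nat).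
      D \<subseteq> {0..<int n} \<longrightarrow> b \<in> {0..<int n} \<longrightarrow> k \<le> card D \<longrightarrow>
      real (card D) = real n - real c \<longrightarrow>
      real n - real c \<ge> C * real n * real p powr (- 1 / real d) + real c \<longrightarrow>
      \<bar>real (subset_sum_count n f D k b) - 1 / real n * ((real n - real c) gchoose k)\<bar>
        \<le> (delta n * (real n - real c) + (1 - delta n) * (C * real n * real p powr (- 1 / real d) + real c)
             + real k - 1) gchoose k)" for C :: real
  have \<Theta>: "\<Theta> C" if "C \<ge> 4.41" for C
    unfolding \<Theta>_def using subset_sum_bound[OF assms that] by blast
  have "delta n = 1 / real p" if primepow: "primepow n"
  proof -
    obtain q m where "prime q" "m > 0" "n = q ^ m"
      using primepow unfolding primepow_def by blast
    then show ?thesis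
      using assms(2) delta_prime_power smallest_prime_divisor_prime_power by simp
  qed
  moreover have "\<Theta> (exp (1.85 * real d))" "\<Theta> 4.41"
    using \<Theta> exp_constant_ge[OF assms(4)] by simp_all
  ultimately show ?thesis
    unfolding \<Theta>_def by blast
qed

end
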